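(* Let $\pi:A\to H$ be a surjective map of Hopf algebras. The assignments $V\mapsto A\otimes V$ and $\mathcal{F}\mapsto F(\mathcal{F})=\mathcal{F}/A^+\mathcal{F}$ define functors $$A\otimes-:\mathsf{YD}^H_A\to{}^A_A\mathsf{Mod}^H_A,\qquad F:{}^A_A\mathsf{Mod}^H_A\to\mathsf{YD}^H_A,$$ and these give an adjoint equivalence of categories between ${}^A_A\mathsf{Mod}^H_A$ and the category $\mathsf{YD}^H_A$ of relative Yetter--Drinfeld modules, with unit $$\mathcal{F}\to A\otimes F(\mathcal{F}),\qquad f\mapsto f_{(-1)}\otimes[f_{(0)}],$$ and counit $$F(A\otimes V)\to V,\qquad [a\otimes v]\mapsto\varepsilon(a)v.$$
   Context: Hopf algebras are over $\mathbb{C}$ with bijective antipode; $A^+=\ker\varepsilon$; Sweedler notation is used, with $f_{(-1)}\otimes f_{(0)}$ denoting a left coaction and $f_{(0)}\otimes f_{(1)}$ a right coaction. $A$ is a right $H$-comodule algebra via $(\mathrm{id}\otimes\pi)\Delta$. Objects of ${}^A_A\mathsf{Mod}^H_A$ are $A$-bimodules $\mathcal{F}$ with an $(A,H)$-bicomodule structure $(\Delta_L,\Delta_R)$ such that, for $a,a'\in A$, $f\in\mathcal{F}$, $\Delta_L(afa')=\Delta(a)\Delta_L(f)\Delta(a')$ and $\Delta_R(afa')=((\mathrm{id}\otimes\pi)\Delta(a))\,\Delta_R(f)\,((\mathrm{id}\otimes\pi)\Delta(a'))$; morphisms are the maps preserving all structures. Objects of $\mathsf{YD}^H_A$ are right $A$-modules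 $V$ (action $\triangleleft$) with a right $H$-comodule structure such that $v_{(0)}\triangleleft a_{(1)}\otimes v_{(1)}\pi(a_{(2)})=(v\triangleleft a_{(2)})_{(0)}\otimes\pi(a_{(1)})(v\triangleleft a_{(2)})_{(1)}$ for all $v\in V$, $a\in A$; morphisms are the $A$-linear, $H$-colinear maps. For $V\in\mathsf{YD}^H_A$, $A\otimes V$ has left $A$-action and left $A$-coaction on the first tensor factor, right $A$-action $(b\otimes v)a=ba_{(1)}\otimes(v\triangleleft a_{(2)})$, and right $H$-coaction $a\otimes v\mapsto a_{(1)}\otimes v_{(0)}\otimes\pi(a_{(2)})v_{(1)}$. For $\mathcal{F}\in{}^A_A\mathsf{Mod}^H_A$, $F(\mathcal{F})=\mathcal{F}/A^+\mathcal{F}$ has the right $A$-action induced from $\mathcal{F}$ and right $H$-coaction $[f]\mapsto[f_{(0)}]\otimes\pi(S(f_{(-1)}))f_{(1)}$, where $f_{(-1)}\otimes f_{(0)}\otimes f_{(1)}$ is the combined bicoaction. Both functors act on morphisms in the evident way. *)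

theory Defs
  imports Complex_Main "HOL-Algebra.Module" "HOL-Algebra.AbelCoset" "HOL-Library.FuncSet"
begin

section \<open>Complex vector spaces and tensor products\<close>

definition CC :: "(complex, complex) module"
  where "CC = \<lparr>carrier = UNIV, mult = (*), one = 1, zero = 0, add = (+), smult = (*)\<rparr>"

text \<open>
  As usual in \<^theory>\<open>HOL-Algebra.Module\<close>, vector spaces over \<open>CC\<close> are module records; the ring
  multiplication and unit present in such a record are irrelevant.
\<close>

definition linear_map :: "(complex, 'v, 'm) module_scheme \<Rightarrow> (complex, 'w, 'n) module_scheme \<Rightarrow> ('v \<Rightarrow> 'w) \<Rightarrow> bool"
  where "linear_map V W f \<longleftrightarrow>
    f \<in> carrier V \<rightarrow> carrier W \<and>
    (\<forall>x\<in>carrier V. \<forall>y\<in>carrier V. f (x \<oplus>\<^bsub>V\<^esub> y) = f x \<oplus>\<^bsub>W\<^esub> f y) \<and>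
    (\<forall>c. \<forall>x\<in>carrier V. f (c \<odot>\<^bsub>V\<^esub> x) = c \<odot>\<^bsub>W\<^esub> f x)"

definition bilinear_map ::
  "(complex, 'v, 'm) module_scheme \<Rightarrow> (complex, 'w, 'n) module_scheme \<Rightarrow> (complex, 'x, 'k) module_scheme \<Rightarrow>
    ('v \<Rightarrow> 'w \<Rightarrow> 'x) \<Rightarrow> bool"
  where "bilinear_map V W X b \<longleftrightarrow>
    (\<forall>v\<in>carrier V. linear_map W X (b v)) \<and> (\<forall>w\<in>carrier W. linear_map V X (\<lambda>v. b v w))"

text \<open>
  The list \<open>[(v\<^sub>1, w\<^sub>1), \<dots>, (v\<^sub>n, w\<^sub>n)]\<close> stands for the formal sum of the \<open>v\<^sub>i \<otimes> w\<^sub>i\<close>; scalars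
  need not be recorded, since they can be absorbed into either entry.  An element of the tensor
  product is a class of formal sums modulo the bilinearity relations.
\<close>

type_synonym ('v, 'w) tens = "('v \<times> 'w) list set"

inductive_set tensor_rel ::
  "(complex, 'v, 'm) module_scheme \<Rightarrow> (complex, 'w, 'n) module_scheme \<Rightarrow> (('v \<times> 'w) list \<times> ('v \<times> 'w) list) set"
  for V :: "(complex, 'v, 'm) module_scheme" and W :: "(complex, 'w, 'n) module_scheme"
  where
    refl: "l \<in> lists (carrier V \<times> carrier W) \<Longrightarrow> (l, l) \<in> tensor_rel V W"
  | sym: "(l, m) \<in> tensor_rel V W \<Longrightarrow> (m, l) \<in> tensor_rel V W"
  | trans: "(l, m) \<in> tensor_rel V W \<Longrightarrow> (m, n) \<in> tensor_rel V W \<Longrightarrow> (l, n) \<in> tensor_rel V W"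
  | append: "(l, l') \<in> tensor_rel V W \<Longrightarrow> (m, m') \<in> tensor_rel V W \<Longrightarrow> (l @ m, l' @ m') \<in> tensor_rel V W"
  | commute: "l \<in> lists (carrier V \<times> carrier W) \<Longrightarrow> m \<in> lists (carrier V \<times> carrier W) \<Longrightarrow>
      (l @ m, m @ l) \<in> tensor_rel V W"
  | zero: "w \<in> carrier W \<Longrightarrow> ([(\<zero>\<^bsub>V\<^esub>, w)], []) \<in> tensor_rel V W"
  | add_left: "v \<in> carrier V \<Longrightarrow> v' \<in> carrier V \<Longrightarrow> w \<in> carrier W \<Longrightarrow>
      ([(v \<oplus>\<^bsub>V\<^esub> v', w)], [(v, w), (v', w)]) \<in> tensor_rel V W"
  | add_right: "v \<in> carrier V \<Longrightarrow> w \<in> carrier W \<Longrightarrow> w' \<in> carrier W \<Longrightarrow>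
      ([(v, w \<oplus>\<^bsub>W\<^esub> w')], [(v, w), (v, w')]) \<in> tensor_rel V W"
  | balance: "v \<in> carrier V \<Longrightarrow> w \<in> carrier W \<Longrightarrow>
      ([(c \<odot>\<^bsub>V\<^esub> v, w)], [(v, c \<odot>\<^bsub>W\<^esub> w)]) \<in> tensor_rel V W"

definition tensor ::
  "(complex, 'v, 'm) module_scheme \<Rightarrow> (complex, 'w, 'n) module_scheme \<Rightarrow> (complex, ('v, 'w) tens) module"
  (infixr \<open>\<boxtimes>\<close> 75)
  where "V \<boxtimes> W = \<lparr>
    carrier = lists (carrier V \<times> carrier W) // tensor_rel V W,
    mult = undefined, one = undefined,
    zero = tensor_rel V W `` {[]},
    add = (\<lambda>s t. \<Union>l\<in>s. \<Union>m\<in>t. tensor_rel V W `` {l @ m}),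
    smult = (\<lambda>c t. \<Union>l\<in>t. tensor_rel V W `` {map (\<lambda>(v, w). (c \<odot>\<^bsub>V\<^esub> v, w)) l}) \<rparr>"

definition pure ::
  "(complex, 'v, 'm) module_scheme \<Rightarrow> (complex, 'w, 'n) module_scheme \<Rightarrow> 'v \<Rightarrow> 'w \<Rightarrow> ('v, 'w) tens"
  where "pure V W v w = tensor_rel V W `` {[(v, w)]}"

text \<open>
  \<open>tsum X t (\<lambda>v w. b v w)\<close> is the value at \<open>t\<close> of the linear map into \<open>X\<close> induced by the bilinear
  map \<open>b\<close> (see \<open>tsum_pure\<close> and \<open>linear_map_tsum\<close> below).  For \<open>t = \<Delta>(a)\<close> it is
  the Sweedler expression \<open>b(a\<^sub>1, a\<^sub>2)\<close>, and similarly for coactions.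
\<close>

definition formal_sum :: "(complex, 'x, 'k) module_scheme \<Rightarrow> ('v \<Rightarrow> 'w \<Rightarrow> 'x) \<Rightarrow> ('v \<times> 'w) list \<Rightarrow> 'x"
  where "formal_sum X b l = foldr (\<lambda>(v, w) s. b v w \<oplus>\<^bsub>X\<^esub> s) l \<zero>\<^bsub>X\<^esub>"

definition tsum :: "(complex, 'x, 'k) module_scheme \<Rightarrow> ('v, 'w) tens \<Rightarrow> ('v \<Rightarrow> 'w \<Rightarrow> 'x) \<Rightarrow> 'x"
  where "tsum X t b = the_elem (formal_sum X b ` t)"

definition tmap ::
  "(complex, 'v, 'm) module_scheme \<Rightarrow> (complex, 'w, 'n) module_scheme \<Rightarrow>
    ('v0 \<Rightarrow> 'v) \<Rightarrow> ('w0 \<Rightarrow> 'w) \<Rightarrow> ('v0, 'w0) tens \<Rightarrow> ('v, 'w) tens"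
  where "tmap V W f g t = tsum (V \<boxtimes> W) t (\<lambda>v w. pure V W (f v) (g w))"

definition tassoc ::
  "(complex, 'u, 'm) module_scheme \<Rightarrow> (complex, 'v, 'n) module_scheme \<Rightarrow> (complex, 'w, 'k) module_scheme \<Rightarrow>
    (('u, 'v) tens, 'w) tens \<Rightarrow> ('u, ('v, 'w) tens) tens"
  where "tassoc U V W t =
    tsum (U \<boxtimes> V \<boxtimes> W) t (\<lambda>s w. tsum (U \<boxtimes> V \<boxtimes> W) s (\<lambda>u v. pure U (V \<boxtimes> W) u (pure V W v w)))"

subsection \<open>Universal property\<close>

lemma CC_simps [simp]:
  "carrier CC = UNIV" "x \<otimes>\<^bsub>CC\<^esub> y = x * y" "x \<oplus>\<^bsub>CC\<^esub> y = x + y" "\<zero>\<^bsub>CC\<^esub> = 0" "\<one>\<^bsub>CC\<^esub> = 1" "x \<odot>\<^bsub>CC\<^esub> y = x * y"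
  by (simp_all add: CC_def)

lemma formal_sum_simps [simp]:
  "formal_sum X b [] = \<zero>\<^bsub>X\<^esub>"
  "formal_sum X b ((v, w) # l) = b v w \<oplus>\<^bsub>X\<^esub> formal_sum X b l"
  by (simp_all add: formal_sum_def)

lemma tensor_rel_subset:
  assumes "module CC V" "module CC W"
  shows "(l, m) \<in> tensor_rel V W \<Longrightarrow> l \<in> lists (carrier V \<times> carrier W) \<and> m \<in> lists (carrier V \<times> carrier W)"
proof (induction rule: tensor_rel.induct)
qed (use assms in \<open>auto simp: module.smult_closed abelian_monoid.zero_closed abelian_monoid.a_closed
    module_def abelian_group_def intro: module.smult_closed\<close>)

lemma equiv_tensor_rel:
  assumes "module CC V" "module CC W"
  shows "equiv (lists (carrier V \<times> carrier W)) (tensor_rel V W)"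
  using tensor_rel_subset[OF assms]
  by (intro equivI refl_onI symI transI subsetI) (auto intro: tensor_rel.refl tensor_rel.sym tensor_rel.trans)

lemma formal_sum_closed:
  assumes "module CC X" "bilinear_map V W X b" "l \<in> lists (carrier V \<times> carrier W)"
  shows "formal_sum X b l \<in> carrier X"
proof -
  interpret X: module CC X by fact
  show ?thesis using assms(3)
    by (induction l) (use assms(2) in \<open>auto simp: bilinear_map_def linear_map_def Pi_iff\<close>)
qed

lemma formal_sum_append:
  assumes "module CC X" "bilinear_map V W X b"
    "l \<in> lists (carrier V \<times> carrier W)" "m \<in> lists (carrier V \<times> carrier W)"
  shows "formal_sum X b (l @ m)
    = formal_sum X b l \<oplus>\<^bsub>X\<^esub> formal_sum X b m"
proof -
  interpret X: module CC X by fact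
  have "b v w \<in> carrier X" if "v \<in> carrier V" "w \<in> carrier W" for v w
    using that assms(2) by (auto simp: bilinear_map_def linear_map_def Pi_iff)
  with assms(3) show ?thesis
    by (induction l) (auto simp: formal_sum_closed[OF assms(1,2)] formal_sum_closed[OF assms(1,2,4)]
      X.M.a_assoc in_lists_conv_set)
qed

lemma formal_sum_respects:
  assumes V: "module CC V" and W: "module CC W" and X: "module CC X" and b: "bilinear_map V W X b"
  shows "(l, m) \<in> tensor_rel V W \<Longrightarrow>
    formal_sum X b l = formal_sum X b m"
proof (induction rule: tensor_rel.induct)
  interpret X: module CC X by fact
  interpret V: module CC V by fact
  interpret W: module CC W by fact
  have bc: "b v w \<in> carrier X" if "v \<in> carrier V" "w \<in> carrier W" for v w
    using that b by (auto simp: bilinear_map_def linear_map_def Pi_iff)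
  {
    case (append l l' m m')
    then show ?case
      using tensor_rel_subset[OF V W] formal_sum_append[OF X b] by metis
  next
    case (commute l m)
    then show ?case
      using formal_sum_append[OF X b] formal_sum_closed[OF X b] X.M.a_comm by metis
  next
    case (zero w)
    have "b \<zero>\<^bsub>V\<^esub> w = 0 \<odot>\<^bsub>X\<^esub> b \<zero>\<^bsub>V\<^esub> w"
      using zero b V.smult_r_null[of 0] by (auto simp: bilinear_map_def linear_map_def)
         (metis CC_simps(1) UNIV_I V.M.zero_closed V.smult_r_null)
    also have "\<dots> = \<zero>\<^bsub>X\<^esub>"
      using X.smult_l_null[of "b \<zero>\<^bsub>V\<^esub> w"] bc zero by simp
    finally show ?case by simp
  next
    case (add_left v v' w)
    then show ?case using b bc by (auto simp: bilinear_map_def linear_map_def)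
  next
    case (add_right v w w')
    then show ?case using b bc by (auto simp: bilinear_map_def linear_map_def)
  next
    case (balance v w c)
    then show ?case using b bc by (auto simp: bilinear_map_def linear_map_def)
  }
qed auto

lemma tsum_class:
  assumes "module CC V" "module CC W" "module CC X" "bilinear_map V W X b"
    "l \<in> lists (carrier V \<times> carrier W)"
  shows "tsum X (tensor_rel V W `` {l}) b = formal_sum X b l"
proof -
  have "formal_sum X b ` (tensor_rel V W `` {l})
      = {formal_sum X b l}"
  proof (intro equalityI subsetI)
    fix y assume "y \<in> formal_sum X b ` (tensor_rel V W `` {l})"
    then obtain m where "(l, m) \<in> tensor_rel V W" "y = formal_sum X b m" by blast
    then show "y \<in> {formal_sum X b l}" using formal_sum_respects[OF assms(1-4)] by simp
  qed (use tensor_rel.refl[OF assms(5)] in blast)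
  then show ?thesis by (simp add: tsum_def)
qed

lemma tsum_pure:
  assumes "module CC V" "module CC W" "module CC X" "bilinear_map V W X b"
    "v \<in> carrier V" "w \<in> carrier W"
  shows "tsum X (pure V W v w) b = b v w"
proof -
  interpret X: module CC X by fact
  show ?thesis
    using assms by (auto simp: pure_def tsum_class bilinear_map_def linear_map_def Pi_iff)
qed

lemma formal_lists_closed:
  assumes "module CC V" "l \<in> lists (carrier V \<times> carrier W)"
  shows "map (\<lambda>(v, w). (c \<odot>\<^bsub>V\<^esub> v, w)) l \<in> lists (carrier V \<times> carrier W)"
  using assms(2) by (induction l) (auto intro: module.smult_closed[OF assms(1)])

lemma tensor_rel_smult:
  assumes V: "module CC V" and W: "module CC W"
  shows "(l, m) \<in> tensor_rel V W \<Longrightarrow>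
    (map (\<lambda>(v, w). (c \<odot>\<^bsub>V\<^esub> v, w)) l, map (\<lambda>(v, w). (c \<odot>\<^bsub>V\<^esub> v, w)) m) \<in> tensor_rel V W"
proof (induction rule: tensor_rel.induct)
  interpret V: module CC V by fact
  interpret W: module CC W by fact
  {
    case (balance v w d)
    have "c \<odot>\<^bsub>V\<^esub> (d \<odot>\<^bsub>V\<^esub> v) = d \<odot>\<^bsub>V\<^esub> (c \<odot>\<^bsub>V\<^esub> v)"
      using balance V.smult_assoc1[of c d v] V.smult_assoc1[of d c v] by (simp add: mult.commute)
    then show ?case
      using balance tensor_rel.balance[of "c \<odot>\<^bsub>V\<^esub> v" V w W d] by simp
  next
    case (zero w)
    then show ?case using tensor_rel.zero[of w W V] V.smult_r_null[of c] by simp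
  next
    case (add_left v v' w)
    then show ?case using tensor_rel.add_left[of "c \<odot>\<^bsub>V\<^esub> v" V "c \<odot>\<^bsub>V\<^esub> v'" w W]
        V.smult_r_distr[of c v v'] by simp
  next
    case (add_right v w w')
    then show ?case using tensor_rel.add_right[of "c \<odot>\<^bsub>V\<^esub> v" V] by simp
  next
    case (commute l m)
    then show ?case
      using formal_lists_closed[OF V] tensor_rel.commute by (metis map_append)
  next
    case (refl l)
    then show ?case using formal_lists_closed[OF V] by (blast intro: tensor_rel.refl)
  }
qed (auto intro: tensor_rel.sym tensor_rel.trans tensor_rel.append)

lemma tensor_carrierE:
  assumes "t \<in> carrier (V \<boxtimes> W)"
  obtains l where "l \<in> lists (carrier V \<times> carrier W)" "t = tensor_rel V W `` {l}"
  using assms by (auto simp: tensor_def quotient_def)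

lemma tensor_carrierI:
  "l \<in> lists (carrier V \<times> carrier W) \<Longrightarrow> tensor_rel V W `` {l} \<in> carrier (V \<boxtimes> W)"
  by (auto simp: tensor_def intro: quotientI)

lemma tensor_add_class:
  assumes "module CC V" "module CC W"
    "l \<in> lists (carrier V \<times> carrier W)" "m \<in> lists (carrier V \<times> carrier W)"
  shows "tensor_rel V W `` {l} \<oplus>\<^bsub>V \<boxtimes> W\<^esub> tensor_rel V W `` {m} = tensor_rel V W `` {l @ m}"
proof -
  note eq = equiv_tensor_rel[OF assms(1,2)]
  have "(\<lambda>l m. tensor_rel V W `` {l @ m}) respects2 tensor_rel V W"
    by (rule congruent2I'[of _ _ ]) (auto intro!: equiv_class_eq[OF eq] tensor_rel.append)
  from UN_equiv_class2[OF eq eq this assms(3,4)] show ?thesis by (simp add: tensor_def)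
qed

lemma tensor_smult_class:
  assumes "module CC V" "module CC W" "l \<in> lists (carrier V \<times> carrier W)"
  shows "c \<odot>\<^bsub>V \<boxtimes> W\<^esub> (tensor_rel V W `` {l}) = tensor_rel V W `` {map (\<lambda>(v, w). (c \<odot>\<^bsub>V\<^esub> v, w)) l}"
proof -
  note eq = equiv_tensor_rel[OF assms(1,2)]
  have "(\<lambda>l. tensor_rel V W `` {map (\<lambda>(v, w). (c \<odot>\<^bsub>V\<^esub> v, w)) l}) respects tensor_rel V W"
    by (rule congruentI) (auto intro!: equiv_class_eq[OF eq] tensor_rel_smult[OF assms(1,2)])
  from UN_equiv_class[OF eq this assms(3)] show ?thesis by (simp add: tensor_def)
qed

lemma tensor_module:
  assumes V: "module CC V" and W: "module CC W"
  shows "module CC (V \<boxtimes> W)"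
proof -
  interpret V: module CC V by fact
  interpret W: module CC W by fact
  note eq = equiv_tensor_rel[OF V W]
  note eqI = equiv_class_eq[OF eq]
  note [simp] = tensor_add_class[OF V W] tensor_smult_class[OF V W]
  note [simp] = formal_lists_closed[OF V]
  let ?L = "lists (carrier V \<times> carrier W)"
  have z: "\<zero>\<^bsub>V \<boxtimes> W\<^esub> = tensor_rel V W `` {[]}" by (simp add: tensor_def)
  have zero: "(map (\<lambda>(v, w). (\<zero>\<^bsub>V\<^esub>, w)) l, []) \<in> tensor_rel V W" if "l \<in> ?L" for l
    using that
  proof (induction l)
    case (Cons p l)
    then show ?case
      using tensor_rel.append[OF tensor_rel.zero[of "snd p" W V] Cons.IH] by (auto simp: split_beta)
  qed (auto intro: tensor_rel.refl)
  have split: "(map (\<lambda>(v, w). ((c + d) \<odot>\<^bsub>V\<^esub> v, w)) l,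
      map (\<lambda>(v, w). (c \<odot>\<^bsub>V\<^esub> v, w)) l @ map (\<lambda>(v, w). (d \<odot>\<^bsub>V\<^esub> v, w)) l) \<in> tensor_rel V W"
    if "l \<in> ?L" for c d l
    using that
  proof (induction l)
    case (Cons p l)
    obtain v w where p: "p = (v, w)" "v \<in> carrier V" "w \<in> carrier W" using Cons.hyps by auto
    let ?f = "\<lambda>c. map (\<lambda>(v, w). (c \<odot>\<^bsub>V\<^esub> v, w)) l"
    have cv: "c \<odot>\<^bsub>V\<^esub> v \<in> carrier V" "d \<odot>\<^bsub>V\<^esub> v \<in> carrier V" using p by simp_all
    have fl: "?f c \<in> ?L" "?f d \<in> ?L" using Cons.hyps by simp_all
    have 1: "(((c + d) \<odot>\<^bsub>V\<^esub> v, w) # ?f (c + d),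
        [(c \<odot>\<^bsub>V\<^esub> v, w), (d \<odot>\<^bsub>V\<^esub> v, w)] @ (?f c @ ?f d)) \<in> tensor_rel V W"
      using tensor_rel.append[OF tensor_rel.add_left[OF cv p(3)] Cons.IH] V.smult_l_distr[of c d v] p by simp
    have 2: "([(d \<odot>\<^bsub>V\<^esub> v, w)] @ ?f c, ?f c @ [(d \<odot>\<^bsub>V\<^esub> v, w)]) \<in> tensor_rel V W"
      using fl cv p by (intro tensor_rel.commute) auto
    have 3: "([(c \<odot>\<^bsub>V\<^esub> v, w)] @ (([(d \<odot>\<^bsub>V\<^esub> v, w)] @ ?f c) @ ?f d),
        [(c \<odot>\<^bsub>V\<^esub> v, w)] @ ((?f c @ [(d \<odot>\<^bsub>V\<^esub> v, w)]) @ ?f d)) \<in> tensor_rel V W"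
      using fl cv p by (intro tensor_rel.append 2 tensor_rel.refl) auto
    show ?case using tensor_rel.trans[OF 1] 3 p by simp
  qed (auto intro: tensor_rel.refl)
  define L where "L = ?L"
  note [simp del] = tensor_add_class[OF V W] tensor_smult_class[OF V W]
  note [simp] = tensor_add_class[OF V W, folded L_def] tensor_smult_class[OF V W, folded L_def]
    formal_lists_closed[OF V, where W = W, folded L_def]
  note E = tensor_carrierE[where V = V and W = W, folded L_def]
    and I = tensor_carrierI[where V = V and W = W, folded L_def]
    and comm = tensor_rel.commute[where V = V and W = W, folded L_def]
    and zero = zero[folded L_def] and split = split[folded L_def]
  have [simp]: "[] \<in> L" "\<And>l m. l \<in> L \<Longrightarrow> m \<in> L \<Longrightarrow> l @ m \<in> L"
    by (auto simp: L_def)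
  have one: "map (\<lambda>(v, w). (1 \<odot>\<^bsub>V\<^esub> v, w)) l = l" if "l \<in> L" for l
    using that V.smult_one unfolding L_def by (induction l) auto
  have smult_assoc: "map (\<lambda>(v, w). ((c * d) \<odot>\<^bsub>V\<^esub> v, w)) l
      = map (\<lambda>(v, w). (c \<odot>\<^bsub>V\<^esub> v, w)) (map (\<lambda>(v, w). (d \<odot>\<^bsub>V\<^esub> v, w)) l)" if "l \<in> L" for c d l
    using that V.smult_assoc1[of c d] unfolding L_def by (induction l) auto
  show ?thesis
  proof (rule moduleI)
    show "abelian_group (V \<boxtimes> W)"
    proof (rule abelian_groupI)
      fix x assume "x \<in> carrier (V \<boxtimes> W)"
      then obtain l where l: "l \<in> L" "x = tensor_rel V W `` {l}" by (rule E)
      have m0: "map (\<lambda>(v, w). (0 \<odot>\<^bsub>V\<^esub> v, w)) l = map (\<lambda>(v, w). (\<zero>\<^bsub>V\<^esub>, w)) l"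
        using l(1) V.smult_l_null unfolding L_def by (induction l) auto
      have "tensor_rel V W `` {map (\<lambda>(v, w). ((-1) \<odot>\<^bsub>V\<^esub> v, w)) l @ l} = tensor_rel V W `` {[]}"
        using split[OF l(1), of "-1" 1] zero[OF l(1)] m0 one[OF l(1)]
        by (intro eqI) (auto intro: tensor_rel.trans tensor_rel.sym)
      then have "(tensor_rel V W `` {map (\<lambda>(v, w). ((-1) \<odot>\<^bsub>V\<^esub> v, w)) l}) \<oplus>\<^bsub>V \<boxtimes> W\<^esub> x = \<zero>\<^bsub>V \<boxtimes> W\<^esub>"
        using l z by simp
      then show "\<exists>y\<in>carrier (V \<boxtimes> W). y \<oplus>\<^bsub>V \<boxtimes> W\<^esub> x = \<zero>\<^bsub>V \<boxtimes> W\<^esub>"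
        using I l(1) by (metis formal_lists_closed[OF V, where W = W, folded L_def])
    next
      fix x y assume "x \<in> carrier (V \<boxtimes> W)" "y \<in> carrier (V \<boxtimes> W)"
      then show "x \<oplus>\<^bsub>V \<boxtimes> W\<^esub> y = y \<oplus>\<^bsub>V \<boxtimes> W\<^esub> x"
        by (elim E) (simp add: eqI[OF comm])
    next
      fix x y assume "x \<in> carrier (V \<boxtimes> W)" "y \<in> carrier (V \<boxtimes> W)"
      then show "x \<oplus>\<^bsub>V \<boxtimes> W\<^esub> y \<in> carrier (V \<boxtimes> W)"
        by (elim E) (simp add: I)
    next
      fix x y z assume "x \<in> carrier (V \<boxtimes> W)" "y \<in> carrier (V \<boxtimes> W)" "z \<in> carrier (V \<boxtimes> W)"
      then show "x \<oplus>\<^bsub>V \<boxtimes> W\<^esub> y \<oplus>\<^bsub>V \<boxtimes> W\<^esub> z = x \<oplus>\<^bsub>V \<boxtimes> W\<^esub> (y \<oplus>\<^bsub>V \<boxtimes> W\<^esub> z)"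
        by (elim E) simp
    next
      show "\<zero>\<^bsub>V \<boxtimes> W\<^esub> \<in> carrier (V \<boxtimes> W)"
        by (simp add: z I)
    next
      fix x assume "x \<in> carrier (V \<boxtimes> W)"
      then show "\<zero>\<^bsub>V \<boxtimes> W\<^esub> \<oplus>\<^bsub>V \<boxtimes> W\<^esub> x = x"
        by (elim E) (simp add: z)
    qed
  next
    show "cring CC"
      using V unfolding module_def by blast
  next
    fix c d x assume "x \<in> carrier (V \<boxtimes> W)"
    then show "(c \<oplus>\<^bsub>CC\<^esub> d) \<odot>\<^bsub>V \<boxtimes> W\<^esub> x = c \<odot>\<^bsub>V \<boxtimes> W\<^esub> x \<oplus>\<^bsub>V \<boxtimes> W\<^esub> d \<odot>\<^bsub>V \<boxtimes> W\<^esub> x"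
      by (elim E) (simp add: eqI[OF split])
  next
    fix c d x assume "x \<in> carrier (V \<boxtimes> W)"
    then show "(c \<otimes>\<^bsub>CC\<^esub> d) \<odot>\<^bsub>V \<boxtimes> W\<^esub> x = c \<odot>\<^bsub>V \<boxtimes> W\<^esub> (d \<odot>\<^bsub>V \<boxtimes> W\<^esub> x)"
      by (elim E) (simp add: smult_assoc del: map_map)
  next
    fix c x assume "x \<in> carrier (V \<boxtimes> W)"
    then show "c \<odot>\<^bsub>V \<boxtimes> W\<^esub> x \<in> carrier (V \<boxtimes> W)"
      by (elim E) (simp add: I)
  next
    fix c x y assume "x \<in> carrier (V \<boxtimes> W)" "y \<in> carrier (V \<boxtimes> W)"
    then show "c \<odot>\<^bsub>V \<boxtimes> W\<^esub> (x \<oplus>\<^bsub>V \<boxtimes> W\<^esub> y) = c \<odot>\<^bsub>V \<boxtimes> W\<^esub> x \<oplus>\<^bsub>V \<boxtimes> W\<^esub> c \<odot>\<^bsub>V \<boxtimes> W\<^esub> y"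
      by (elim E) simp
  next
    fix x assume "x \<in> carrier (V \<boxtimes> W)"
    then show "\<one>\<^bsub>CC\<^esub> \<odot>\<^bsub>V \<boxtimes> W\<^esub> x = x"
      by (elim E) (simp add: one)
  qed
qed

text \<open>The map induced by a bilinear map is linear; with \<open>tsum_pure\<close>, this is the universal property.\<close>

lemma linear_map_tsum:
  assumes V: "module CC V" and W: "module CC W" and X: "module CC X" and b: "bilinear_map V W X b"
  shows "linear_map (V \<boxtimes> W) X (\<lambda>t. tsum X t b)"
proof -
  interpret X: module CC X by fact
  note ts = tsum_class[OF V W X b]
  have sm: "formal_sum X b (map (\<lambda>(v, w). (c \<odot>\<^bsub>V\<^esub> v, w)) l) = c \<odot>\<^bsub>X\<^esub> formal_sum X b l"
    if "l \<in> lists (carrier V \<times> carrier W)" for c l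
    using that
  proof (induction l)
    case (Cons p l)
    have "b (fst p) (snd p) \<in> carrier X" "b (c \<odot>\<^bsub>V\<^esub> fst p) (snd p) = c \<odot>\<^bsub>X\<^esub> b (fst p) (snd p)"
      using Cons.hyps b by (auto simp: bilinear_map_def linear_map_def Pi_iff)
    then show ?case
      using Cons X.smult_r_distr[of c] formal_sum_closed[OF X b Cons.hyps(2)] by (auto simp: split_beta formal_sum_def[symmetric])
  qed (use X.smult_r_null in auto)
  show ?thesis
    unfolding linear_map_def
  proof (intro conjI ballI allI Pi_I)
    fix s assume "s \<in> carrier (V \<boxtimes> W)"
    then obtain l where l: "l \<in> lists (carrier V \<times> carrier W)" "s = tensor_rel V W `` {l}"
      by (rule tensor_carrierE)
    show "tsum X s b \<in> carrier X"
      unfolding l(2) ts[OF l(1)] by (rule formal_sum_closed[OF X b l(1)])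
    show "tsum X (c \<odot>\<^bsub>V \<boxtimes> W\<^esub> s) b = c \<odot>\<^bsub>X\<^esub> tsum X s b" for c
      unfolding l(2) ts[OF l(1)] tensor_smult_class[OF V W l(1)]
        ts[OF formal_lists_closed[OF V l(1)]] by (rule sm[OF l(1)])
    fix t assume "t \<in> carrier (V \<boxtimes> W)"
    then obtain m where m: "m \<in> lists (carrier V \<times> carrier W)" "t = tensor_rel V W `` {m}"
      by (rule tensor_carrierE)
    show "tsum X (s \<oplus>\<^bsub>V \<boxtimes> W\<^esub> t) b = tsum X s b \<oplus>\<^bsub>X\<^esub> tsum X t b"
      unfolding l(2) m(2) tensor_add_class[OF V W l(1) m(1)] ts[OF l(1)] ts[OF m(1)]
      using ts[of "l @ m"] l(1) m(1) formal_sum_append[OF X b l(1) m(1)] by simp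
  qed
qed

section \<open>Hopf algebras\<close>

record 'a hopf = "(complex, 'a) module" +
  comult :: "'a \<Rightarrow> ('a, 'a) tens"
  counit :: "'a \<Rightarrow> complex"
  antipode :: "'a \<Rightarrow> 'a"

locale cplx_algebra = module CC A + ring A for A (structure) +
  assumes smult_left: "\<lbrakk>x \<in> carrier A; y \<in> carrier A\<rbrakk> \<Longrightarrow> (c \<odot>\<^bsub>A\<^esub> x) \<otimes>\<^bsub>A\<^esub> y = c \<odot>\<^bsub>A\<^esub> (x \<otimes>\<^bsub>A\<^esub> y)"
    and smult_right: "\<lbrakk>x \<in> carrier A; y \<in> carrier A\<rbrakk> \<Longrightarrow> x \<otimes>\<^bsub>A\<^esub> (c \<odot>\<^bsub>A\<^esub> y) = c \<odot>\<^bsub>A\<^esub> (x \<otimes>\<^bsub>A\<^esub> y)"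

locale hopf_algebra = cplx_algebra A for A :: "'a hopf" (structure) +
  assumes comult_linear: "linear_map A (A \<boxtimes> A) (comult A)"
    and coassoc: "a \<in> carrier A \<Longrightarrow>
      tassoc A A A (tmap (A \<boxtimes> A) A (comult A) id (comult A a)) = tmap A (A \<boxtimes> A) id (comult A) (comult A a)"
    and counit_linear: "linear_map A CC (counit A)"
    and counit_left: "a \<in> carrier A \<Longrightarrow> tsum A (comult A a) (\<lambda>a\<^sub>1 a\<^sub>2. counit A a\<^sub>1 \<odot>\<^bsub>A\<^esub> a\<^sub>2) = a"
    and counit_right: "a \<in> carrier A \<Longrightarrow> tsum A (comult A a) (\<lambda>a\<^sub>1 a\<^sub>2. counit A a\<^sub>2 \<odot>\<^bsub>A\<^esub> a\<^sub>1) = a"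
    and comult_mult: "\<lbrakk>a \<in> carrier A; b \<in> carrier A\<rbrakk> \<Longrightarrow>
      comult A (a \<otimes>\<^bsub>A\<^esub> b) = tsum (A \<boxtimes> A) (comult A a) (\<lambda>a\<^sub>1 a\<^sub>2. tsum (A \<boxtimes> A) (comult A b) (\<lambda>b\<^sub>1 b\<^sub>2.
        pure A A (a\<^sub>1 \<otimes>\<^bsub>A\<^esub> b\<^sub>1) (a\<^sub>2 \<otimes>\<^bsub>A\<^esub> b\<^sub>2)))"
    and comult_one: "comult A \<one>\<^bsub>A\<^esub> = pure A A \<one>\<^bsub>A\<^esub> \<one>\<^bsub>A\<^esub>"
    and counit_mult: "\<lbrakk>a \<in> carrier A; b \<in> carrier A\<rbrakk> \<Longrightarrow> counit A (a \<otimes>\<^bsub>A\<^esub> b) = counit A a * counit A b"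
    and counit_one: "counit A \<one>\<^bsub>A\<^esub> = 1"
    and antipode_linear: "linear_map A A (antipode A)"
    and antipode_left: "a \<in> carrier A \<Longrightarrow>
      tsum A (comult A a) (\<lambda>a\<^sub>1 a\<^sub>2. antipode A a\<^sub>1 \<otimes>\<^bsub>A\<^esub> a\<^sub>2) = counit A a \<odot>\<^bsub>A\<^esub> \<one>\<^bsub>A\<^esub>"
    and antipode_right: "a \<in> carrier A \<Longrightarrow>
      tsum A (comult A a) (\<lambda>a\<^sub>1 a\<^sub>2. a\<^sub>1 \<otimes>\<^bsub>A\<^esub> antipode A a\<^sub>2) = counit A a \<odot>\<^bsub>A\<^esub> \<one>\<^bsub>A\<^esub>"
    and antipode_bij: "bij_betw (antipode A) (carrier A) (carrier A)"

text \<open>Compatibility with the antipodes is automatic.\<close>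

definition hopf_map :: "'a hopf \<Rightarrow> 'h hopf \<Rightarrow> ('a \<Rightarrow> 'h) \<Rightarrow> bool"
  where "hopf_map A H p \<longleftrightarrow>
    linear_map A H p \<and>
    (\<forall>a\<in>carrier A. \<forall>b\<in>carrier A. p (a \<otimes>\<^bsub>A\<^esub> b) = p a \<otimes>\<^bsub>H\<^esub> p b) \<and>
    p \<one>\<^bsub>A\<^esub> = \<one>\<^bsub>H\<^esub> \<and>
    (\<forall>a\<in>carrier A. comult H (p a) = tmap H H p p (comult A a)) \<and>
    (\<forall>a\<in>carrier A. counit H (p a) = counit A a)"

section \<open>Modules, comodules, and the two categories of objects\<close>

definition left_action :: "'a hopf \<Rightarrow> (complex, 'v, 'm) module_scheme \<Rightarrow> ('a \<Rightarrow> 'v \<Rightarrow> 'v) \<Rightarrow> bool"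
  where "left_action A V act \<longleftrightarrow>
    bilinear_map A V V act \<and>
    (\<forall>v\<in>carrier V. act \<one>\<^bsub>A\<^esub> v = v) \<and>
    (\<forall>a\<in>carrier A. \<forall>b\<in>carrier A. \<forall>v\<in>carrier V. act (a \<otimes>\<^bsub>A\<^esub> b) v = act a (act b v))"

definition right_action :: "'a hopf \<Rightarrow> (complex, 'v, 'm) module_scheme \<Rightarrow> ('v \<Rightarrow> 'a \<Rightarrow> 'v) \<Rightarrow> bool"
  where "right_action A V act \<longleftrightarrow>
    bilinear_map V A V act \<and>
    (\<forall>v\<in>carrier V. act v \<one>\<^bsub>A\<^esub> = v) \<and>
    (\<forall>a\<in>carrier A. \<forall>b\<in>carrier A. \<forall>v\<in>carrier V. act v (a \<otimes>\<^bsub>A\<^esub> b) = act (act v a) b)"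

definition left_coaction :: "'a hopf \<Rightarrow> (complex, 'v, 'm) module_scheme \<Rightarrow> ('v \<Rightarrow> ('a, 'v) tens) \<Rightarrow> bool"
  where "left_coaction A V co \<longleftrightarrow>
    linear_map V (A \<boxtimes> V) co \<and>
    (\<forall>v\<in>carrier V. tsum V (co v) (\<lambda>a w. counit A a \<odot>\<^bsub>V\<^esub> w) = v) \<and>
    (\<forall>v\<in>carrier V. tassoc A A V (tmap (A \<boxtimes> A) V (comult A) id (co v)) = tmap A (A \<boxtimes> V) id co (co v))"

definition right_coaction :: "'h hopf \<Rightarrow> (complex, 'v, 'm) module_scheme \<Rightarrow> ('v \<Rightarrow> ('v, 'h) tens) \<Rightarrow> bool"
  where "right_coaction H V co \<longleftrightarrow>
    linear_map V (V \<boxtimes> H) co \<and>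
    (\<forall>v\<in>carrier V. tsum V (co v) (\<lambda>w h. counit H h \<odot>\<^bsub>V\<^esub> w) = v) \<and>
    (\<forall>v\<in>carrier V. tassoc V H H (tmap (V \<boxtimes> H) H co id (co v)) = tmap V (H \<boxtimes> H) id (comult H) (co v))"

text \<open>
  In the Sweedler expressions below, left coactions are written with bound variables \<open>f\<^sub>1\<close> (in \<open>A\<close>) and \<open>f\<^sub>0\<close>,
  right coactions with \<open>f\<^sub>0\<close> and \<open>f\<^sub>1\<close> (in \<open>H\<close>).
\<close>

record ('a, 'h, 'v) right_data = "(complex, 'v) module" +
  ract :: "'v \<Rightarrow> 'a \<Rightarrow> 'v"
  rcoact :: "'v \<Rightarrow> ('v, 'h) tens"

record ('a, 'h, 'v) bi_data = "('a, 'h, 'v) right_data" +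
  lact :: "'a \<Rightarrow> 'v \<Rightarrow> 'v"
  lcoact :: "'v \<Rightarrow> ('a, 'v) tens"

text \<open>The objects of \<open>YD\<^sup>H\<^sub>A\<close>.\<close>

definition yd_module :: "'a hopf \<Rightarrow> 'h hopf \<Rightarrow> ('a \<Rightarrow> 'h) \<Rightarrow> ('a, 'h, 'v) right_data \<Rightarrow> bool"
  where "yd_module A H p V \<longleftrightarrow>
    module CC V \<and> right_action A V (ract V) \<and> right_coaction H V (rcoact V) \<and>
    (\<forall>v\<in>carrier V. \<forall>a\<in>carrier A.
      tsum (V \<boxtimes> H) (rcoact V v) (\<lambda>v\<^sub>0 v\<^sub>1. tsum (V \<boxtimes> H) (comult A a) (\<lambda>a\<^sub>1 a\<^sub>2.
        pure V H (ract V v\<^sub>0 a\<^sub>1) (v\<^sub>1 \<otimes>\<^bsub>H\<^esub> p a\<^sub>2))) =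
      tsum (V \<boxtimes> H) (comult A a) (\<lambda>a\<^sub>1 a\<^sub>2. tsum (V \<boxtimes> H) (rcoact V (ract V v a\<^sub>2)) (\<lambda>w\<^sub>0 w\<^sub>1.
        pure V H w\<^sub>0 (p a\<^sub>1 \<otimes>\<^bsub>H\<^esub> w\<^sub>1))))"

text \<open>
  The right \<open>H\<close>-coaction of \<open>A\<close>, and the objects of the category of \<open>A\<close>-bimodules with
  compatible \<open>(A, H)\<close>-bicomodule structure.
\<close>

definition alg_coact :: "'a hopf \<Rightarrow> 'h hopf \<Rightarrow> ('a \<Rightarrow> 'h) \<Rightarrow> 'a \<Rightarrow> ('a, 'h) tens"
  where "alg_coact A H p a = tmap A H id p (comult A a)"

definition bicomodule_bimodule :: "'a hopf \<Rightarrow> 'h hopf \<Rightarrow> ('a \<Rightarrow> 'h) \<Rightarrow> ('a, 'h, 'v) bi_data \<Rightarrow> bool"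
  where "bicomodule_bimodule A H p M \<longleftrightarrow>
    module CC M \<and> left_action A M (lact M) \<and> right_action A M (ract M) \<and>
    (\<forall>a\<in>carrier A. \<forall>b\<in>carrier A. \<forall>f\<in>carrier M. ract M (lact M a f) b = lact M a (ract M f b)) \<and>
    left_coaction A M (lcoact M) \<and> right_coaction H M (rcoact M) \<and>
    (\<forall>f\<in>carrier M. tassoc A M H (tmap (A \<boxtimes> M) H (lcoact M) id (rcoact M f))
      = tmap A (M \<boxtimes> H) id (rcoact M) (lcoact M f)) \<and>
    (\<forall>a\<in>carrier A. \<forall>b\<in>carrier A. \<forall>f\<in>carrier M.
      lcoact M (ract M (lact M a f) b) =
      tsum (A \<boxtimes> M) (comult A a) (\<lambda>a\<^sub>1 a\<^sub>2. tsum (A \<boxtimes> M) (lcoact M f) (\<lambda>f\<^sub>1 f\<^sub>0.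
        tsum (A \<boxtimes> M) (comult A b) (\<lambda>b\<^sub>1 b\<^sub>2.
          pure A M (a\<^sub>1 \<otimes>\<^bsub>A\<^esub> f\<^sub>1 \<otimes>\<^bsub>A\<^esub> b\<^sub>1) (ract M (lact M a\<^sub>2 f\<^sub>0) b\<^sub>2))))) \<and>
    (\<forall>a\<in>carrier A. \<forall>b\<in>carrier A. \<forall>f\<in>carrier M.
      rcoact M (ract M (lact M a f) b) =
      tsum (M \<boxtimes> H) (alg_coact A H p a) (\<lambda>a\<^sub>0 a\<^sub>1. tsum (M \<boxtimes> H) (rcoact M f) (\<lambda>f\<^sub>0 f\<^sub>1.
        tsum (M \<boxtimes> H) (alg_coact A H p b) (\<lambda>b\<^sub>0 b\<^sub>1.
          pure M H (ract M (lact M a\<^sub>0 f\<^sub>0) b\<^sub>0) (a\<^sub>1 \<otimes>\<^bsub>H\<^esub> f\<^sub>1 \<otimes>\<^bsub>H\<^esub> b\<^sub>1)))))"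

section \<open>Categories and adjoint equivalences\<close>

record ('o, 'm) category =
  Obj :: "'o set"
  Hom :: "'o \<Rightarrow> 'o \<Rightarrow> 'm set"
  Ident :: "'o \<Rightarrow> 'm"
  Comp :: "'o \<Rightarrow> 'o \<Rightarrow> 'o \<Rightarrow> 'm \<Rightarrow> 'm \<Rightarrow> 'm"  \<comment> \<open>\<open>Comp C X Y Z g f\<close> is \<open>g \<circ> f : X \<rightarrow> Y \<rightarrow> Z\<close>\<close>

definition is_category :: "('o, 'm) category \<Rightarrow> bool"
  where "is_category C \<longleftrightarrow>
    (\<forall>X\<in>Obj C. Ident C X \<in> Hom C X X) \<and>
    (\<forall>X\<in>Obj C. \<forall>Y\<in>Obj C. \<forall>Z\<in>Obj C. \<forall>f\<in>Hom C X Y. \<forall>g\<in>Hom C Y Z. Comp C X Y Z g f \<in> Hom C X Z) \<and>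
    (\<forall>X\<in>Obj C. \<forall>Y\<in>Obj C. \<forall>f\<in>Hom C X Y. Comp C X Y Y (Ident C Y) f = f \<and> Comp C X X Y f (Ident C X) = f) \<and>
    (\<forall>W\<in>Obj C. \<forall>X\<in>Obj C. \<forall>Y\<in>Obj C. \<forall>Z\<in>Obj C. \<forall>f\<in>Hom C W X. \<forall>g\<in>Hom C X Y. \<forall>h\<in>Hom C Y Z.
      Comp C W Y Z h (Comp C W X Y g f) = Comp C W X Z (Comp C X Y Z h g) f)"

record ('o, 'm, 'p, 'n) functor_data =
  on_obj :: "'o \<Rightarrow> 'p"
  on_hom :: "'o \<Rightarrow> 'o \<Rightarrow> 'm \<Rightarrow> 'n"

definition is_functor :: "('o, 'm) category \<Rightarrow> ('p, 'n) category \<Rightarrow> ('o, 'm, 'p, 'n) functor_data \<Rightarrow> bool"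
  where "is_functor C D F \<longleftrightarrow>
    is_category C \<and> is_category D \<and>
    (\<forall>X\<in>Obj C. on_obj F X \<in> Obj D) \<and>
    (\<forall>X\<in>Obj C. \<forall>Y\<in>Obj C. \<forall>f\<in>Hom C X Y. on_hom F X Y f \<in> Hom D (on_obj F X) (on_obj F Y)) \<and>
    (\<forall>X\<in>Obj C. on_hom F X X (Ident C X) = Ident D (on_obj F X)) \<and>
    (\<forall>X\<in>Obj C. \<forall>Y\<in>Obj C. \<forall>Z\<in>Obj C. \<forall>f\<in>Hom C X Y. \<forall>g\<in>Hom C Y Z.
      on_hom F X Z (Comp C X Y Z g f) =
        Comp D (on_obj F X) (on_obj F Y) (on_obj F Z) (on_hom F Y Z g) (on_hom F X Y f))"

definition id_functor :: "('o, 'm, 'o, 'm) functor_data"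
  where "id_functor = \<lparr>on_obj = (\<lambda>X. X), on_hom = (\<lambda>X Y f. f)\<rparr>"

definition comp_functor ::
  "('p, 'n, 'q, 'k) functor_data \<Rightarrow> ('o, 'm, 'p, 'n) functor_data \<Rightarrow> ('o, 'm, 'q, 'k) functor_data"
  where "comp_functor G F = \<lparr>
    on_obj = (\<lambda>X. on_obj G (on_obj F X)),
    on_hom = (\<lambda>X Y f. on_hom G (on_obj F X) (on_obj F Y) (on_hom F X Y f))\<rparr>"

definition is_iso :: "('o, 'm) category \<Rightarrow> 'o \<Rightarrow> 'o \<Rightarrow> 'm \<Rightarrow> bool"
  where "is_iso C X Y f \<longleftrightarrow>
    f \<in> Hom C X Y \<and> (\<exists>g\<in>Hom C Y X. Comp C X Y X g f = Ident C X \<and> Comp C Y X Y f g = Ident C Y)"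

definition natural_transformation ::
  "('o, 'm) category \<Rightarrow> ('p, 'n) category \<Rightarrow> ('o, 'm, 'p, 'n) functor_data \<Rightarrow> ('o, 'm, 'p, 'n) functor_data \<Rightarrow>
    ('o \<Rightarrow> 'n) \<Rightarrow> bool"
  where "natural_transformation C D F G \<eta> \<longleftrightarrow>
    is_functor C D F \<and> is_functor C D G \<and>
    (\<forall>X\<in>Obj C. \<eta> X \<in> Hom D (on_obj F X) (on_obj G X)) \<and>
    (\<forall>X\<in>Obj C. \<forall>Y\<in>Obj C. \<forall>f\<in>Hom C X Y.
      Comp D (on_obj F X) (on_obj F Y) (on_obj G Y) (\<eta> Y) (on_hom F X Y f) =
      Comp D (on_obj F X) (on_obj G X) (on_obj G Y) (on_hom G X Y f) (\<eta> X))"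

definition adjunction ::
  "('o, 'm) category \<Rightarrow> ('p, 'n) category \<Rightarrow> ('o, 'm, 'p, 'n) functor_data \<Rightarrow> ('p, 'n, 'o, 'm) functor_data \<Rightarrow>
    ('o \<Rightarrow> 'm) \<Rightarrow> ('p \<Rightarrow> 'n) \<Rightarrow> bool"
  where "adjunction C D F G \<eta> \<epsilon> \<longleftrightarrow>
    is_functor C D F \<and> is_functor D C G \<and>
    natural_transformation C C id_functor (comp_functor G F) \<eta> \<and>
    natural_transformation D D (comp_functor F G) id_functor \<epsilon> \<and>
    (\<forall>X\<in>Obj C. Comp D (on_obj F X) (on_obj F (on_obj G (on_obj F X))) (on_obj F X)
      (\<epsilon> (on_obj F X)) (on_hom F X (on_obj G (on_obj F X)) (\<eta> X)) = Ident D (on_obj F X)) \<and>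
    (\<forall>Y\<in>Obj D. Comp C (on_obj G Y) (on_obj G (on_obj F (on_obj G Y))) (on_obj G Y)
      (on_hom G (on_obj F (on_obj G Y)) Y (\<epsilon> Y)) (\<eta> (on_obj G Y)) = Ident C (on_obj G Y))"

definition adjoint_equivalence ::
  "('o, 'm) category \<Rightarrow> ('p, 'n) category \<Rightarrow> ('o, 'm, 'p, 'n) functor_data \<Rightarrow> ('p, 'n, 'o, 'm) functor_data \<Rightarrow>
    ('o \<Rightarrow> 'm) \<Rightarrow> ('p \<Rightarrow> 'n) \<Rightarrow> bool"
  where "adjoint_equivalence C D F G \<eta> \<epsilon> \<longleftrightarrow>
    adjunction C D F G \<eta> \<epsilon> \<and>
    (\<forall>X\<in>Obj C. is_iso C X (on_obj G (on_obj F X)) (\<eta> X)) \<and>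
    (\<forall>Y\<in>Obj D. is_iso D (on_obj F (on_obj G Y)) Y (\<epsilon> Y))"

text \<open>
  Morphisms are functions between carriers, normalised to \<^const>\<open>undefined\<close> outside the domain so
  that two morphisms are equal iff they agree on the carrier.
\<close>

definition yd_category :: "'a hopf \<Rightarrow> 'h hopf \<Rightarrow> ('a \<Rightarrow> 'h) \<Rightarrow> (('a, 'h, 'v) right_data, 'v \<Rightarrow> 'v) category"
  where "yd_category A H p = \<lparr>
    Obj = {V. yd_module A H p V},
    Hom = (\<lambda>V W. {f \<in> extensional (carrier V). linear_map V W f \<and>
      (\<forall>v\<in>carrier V. \<forall>a\<in>carrier A. f (ract V v a) = ract W (f v) a) \<and>
      (\<forall>v\<in>carrier V. rcoact W (f v) = tmap W H f id (rcoact V v))}),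
    Ident = (\<lambda>V. \<lambda>v\<in>carrier V. v),
    Comp = (\<lambda>U V W g f. compose (carrier U) g f) \<rparr>"

definition bimod_category :: "'a hopf \<Rightarrow> 'h hopf \<Rightarrow> ('a \<Rightarrow> 'h) \<Rightarrow> (('a, 'h, 'v) bi_data, 'v \<Rightarrow> 'v) category"
  where "bimod_category A H p = \<lparr>
    Obj = {M. bicomodule_bimodule A H p M},
    Hom = (\<lambda>M N. {f \<in> extensional (carrier M). linear_map M N f \<and>
      (\<forall>m\<in>carrier M. \<forall>a\<in>carrier A. f (lact M a m) = lact N a (f m)) \<and>
      (\<forall>m\<in>carrier M. \<forall>a\<in>carrier A. f (ract M m a) = ract N (f m) a) \<and>
      (\<forall>m\<in>carrier M. lcoact N (f m) = tmap A N id f (lcoact M m)) \<and>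
      (\<forall>m\<in>carrier M. rcoact N (f m) = tmap N H f id (rcoact M m))}),
    Ident = (\<lambda>M. \<lambda>m\<in>carrier M. m),
    Comp = (\<lambda>L M N g f. compose (carrier L) g f) \<rparr>"

section \<open>The two functors\<close>

text \<open>
  Both categories are taken over one universe of elements which is closed under the two constructions:
  the type \<open>('a, 'x) univ\<close> contains an arbitrary type \<open>'x\<close> of atoms, together with the formal sums
  of elements \<open>a \<otimes> u\<close>.  A quotient of a set of such elements is represented by choosing
  an element of each class; that way \<open>A \<otimes> V\<close> and \<open>M / A\<^sup>+M\<close> have their carriers in the
  universe again.
\<close>

datatype ('a, 'x) univ = Atom 'x | Formal "('a \<times> ('a, 'x) univ) list"

definition encode :: "('a, ('a, 'x) univ) tens \<Rightarrow> ('a, 'x) univ"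
  where "encode t = Formal (SOME l. l \<in> t)"

definition decode ::
  "'a hopf \<Rightarrow> (complex, ('a, 'x) univ, 'm) module_scheme \<Rightarrow> ('a, 'x) univ \<Rightarrow> ('a, ('a, 'x) univ) tens"
  where "decode A V = inv_into (carrier (A \<boxtimes> V)) encode"

text \<open>The element \<open>a \<otimes> v\<close> and the vector space \<open>A \<otimes> V\<close>, transported along \<open>encode\<close>.\<close>

definition upure ::
  "'a hopf \<Rightarrow> (complex, ('a, 'x) univ, 'm) module_scheme \<Rightarrow> 'a \<Rightarrow> ('a, 'x) univ \<Rightarrow> ('a, 'x) univ"
  where "upure A V a v = encode (pure A V a v)"

definition utensor ::
  "'a hopf \<Rightarrow> (complex, ('a, 'x) univ, 'm) module_scheme \<Rightarrow> (complex, ('a, 'x) univ) module"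
  where "utensor A V = \<lparr>
    carrier = encode ` carrier (A \<boxtimes> V),
    mult = undefined, one = undefined,
    zero = encode \<zero>\<^bsub>A \<boxtimes> V\<^esub>,
    add = (\<lambda>x y. encode (decode A V x \<oplus>\<^bsub>A \<boxtimes> V\<^esub> decode A V y)),
    smult = (\<lambda>c x. encode (c \<odot>\<^bsub>A \<boxtimes> V\<^esub> decode A V x)) \<rparr>"

definition free_obj ::
  "'a hopf \<Rightarrow> 'h hopf \<Rightarrow> ('a \<Rightarrow> 'h) \<Rightarrow> ('a, 'h, ('a, 'x) univ) right_data \<Rightarrow> ('a, 'h, ('a, 'x) univ) bi_data"
  where "free_obj A H p V = (let U = utensor A V in \<lparr>
    carrier = carrier U, mult = mult U, one = one U, zero = zero U, add = add U, smult = smult U,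
    ract = (\<lambda>x a. tsum U (decode A V x) (\<lambda>b v. tsum U (comult A a) (\<lambda>a\<^sub>1 a\<^sub>2.
      upure A V (b \<otimes>\<^bsub>A\<^esub> a\<^sub>1) (ract V v a\<^sub>2)))),
    rcoact = (\<lambda>x. tsum (U \<boxtimes> H) (decode A V x) (\<lambda>a v.
      tsum (U \<boxtimes> H) (comult A a) (\<lambda>a\<^sub>1 a\<^sub>2. tsum (U \<boxtimes> H) (rcoact V v) (\<lambda>v\<^sub>0 v\<^sub>1.
        pure U H (upure A V a\<^sub>1 v\<^sub>0) (p a\<^sub>2 \<otimes>\<^bsub>H\<^esub> v\<^sub>1))))),
    lact = (\<lambda>a x. tsum U (decode A V x) (\<lambda>b v. upure A V (a \<otimes>\<^bsub>A\<^esub> b) v)),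
    lcoact = (\<lambda>x. tsum (A \<boxtimes> U) (decode A V x) (\<lambda>a v. tsum (A \<boxtimes> U) (comult A a) (\<lambda>a\<^sub>1 a\<^sub>2.
      pure A U a\<^sub>1 (upure A V a\<^sub>2 v)))) \<rparr>)"

definition free_functor ::
  "'a hopf \<Rightarrow> 'h hopf \<Rightarrow> ('a \<Rightarrow> 'h) \<Rightarrow>
    (('a, 'h, ('a, 'x) univ) right_data, ('a, 'x) univ \<Rightarrow> ('a, 'x) univ,
     ('a, 'h, ('a, 'x) univ) bi_data, ('a, 'x) univ \<Rightarrow> ('a, 'x) univ) functor_data"
  where "free_functor A H p = \<lparr>
    on_obj = free_obj A H p,
    on_hom = (\<lambda>V W f. \<lambda>x\<in>carrier (free_obj A H p V).
      tsum (free_obj A H p W) (decode A V x) (\<lambda>a v. upure A W a (f v))) \<rparr>"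

text \<open>The subspace \<open>A\<^sup>+M\<close>, and the chosen representative of the class of \<open>f\<close> modulo \<open>A\<^sup>+M\<close>.\<close>

definition augmentation :: "'a hopf \<Rightarrow> ('a, 'h, 'v) bi_data \<Rightarrow> 'v set"
  where "augmentation A M =
    (\<lambda>N. submodule N CC M) hull {lact M a f | a f. a \<in> carrier A \<and> counit A a = 0 \<and> f \<in> carrier M}"

definition cls :: "'a hopf \<Rightarrow> ('a, 'h, 'v) bi_data \<Rightarrow> 'v \<Rightarrow> 'v"
  where "cls A M f = (SOME g. g \<in> augmentation A M +>\<^bsub>M\<^esub> f)"

definition quot_space :: "'a hopf \<Rightarrow> ('a, 'h, 'v) bi_data \<Rightarrow> (complex, 'v) module"
  where "quot_space A M = \<lparr>
    carrier = cls A M ` carrier M,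
    mult = undefined, one = undefined,
    zero = cls A M \<zero>\<^bsub>M\<^esub>,
    add = (\<lambda>x y. cls A M (x \<oplus>\<^bsub>M\<^esub> y)),
    smult = (\<lambda>c x. cls A M (c \<odot>\<^bsub>M\<^esub> x)) \<rparr>"

text \<open>The Sweedler expression \<open>[f_(0)] \<otimes> p(S(f_(-1))) f_(1)\<close>; it is a function of \<open>f\<close>, not yet of \<open>[f]\<close>.\<close>

definition quot_coact_formula ::
  "'a hopf \<Rightarrow> 'h hopf \<Rightarrow> ('a \<Rightarrow> 'h) \<Rightarrow> ('a, 'h, 'v) bi_data \<Rightarrow> 'v \<Rightarrow> ('v, 'h) tens"
  where "quot_coact_formula A H p M f = (let Q = quot_space A M in
    tsum (Q \<boxtimes> H) (tmap A (M \<boxtimes> H) id (rcoact M) (lcoact M f)) (\<lambda>a t.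
      tsum (Q \<boxtimes> H) t (\<lambda>f\<^sub>0 f\<^sub>1. pure Q H (cls A M f\<^sub>0) (p (antipode A a) \<otimes>\<^bsub>H\<^esub> f\<^sub>1))))"

text \<open>
  Elements of the quotient are representatives of themselves, so the induced maps are given by applying
  the formulas to them; independence of the representative is part of what has to be proved.
\<close>

definition quot_obj ::
  "'a hopf \<Rightarrow> 'h hopf \<Rightarrow> ('a \<Rightarrow> 'h) \<Rightarrow> ('a, 'h, 'v) bi_data \<Rightarrow> ('a, 'h, 'v) right_data"
  where "quot_obj A H p M = (let Q = quot_space A M in \<lparr>
    carrier = carrier Q, mult = mult Q, one = one Q, zero = zero Q, add = add Q, smult = smult Q,
    ract = (\<lambda>x a. cls A M (ract M x a)),
    rcoact = quot_coact_formula A H p M \<rparr>)"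

definition quot_functor ::
  "'a hopf \<Rightarrow> 'h hopf \<Rightarrow> ('a \<Rightarrow> 'h) \<Rightarrow>
    (('a, 'h, 'v) bi_data, 'v \<Rightarrow> 'v, ('a, 'h, 'v) right_data, 'v \<Rightarrow> 'v) functor_data"
  where "quot_functor A H p = \<lparr>
    on_obj = quot_obj A H p,
    on_hom = (\<lambda>M N f. \<lambda>x\<in>carrier (quot_obj A H p M). cls A N (f x)) \<rparr>"

definition unit_map ::
  "'a hopf \<Rightarrow> 'h hopf \<Rightarrow> ('a \<Rightarrow> 'h) \<Rightarrow> ('a, 'h, ('a, 'x) univ) bi_data \<Rightarrow> ('a, 'x) univ \<Rightarrow> ('a, 'x) univ"
  where "unit_map A H p M = (let Q = quot_obj A H p M in
    (\<lambda>f\<in>carrier M. tsum (free_obj A H p Q) (lcoact M f) (\<lambda>a g. upure A Q a (cls A M g))))"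

definition counit_map ::
  "'a hopf \<Rightarrow> 'h hopf \<Rightarrow> ('a \<Rightarrow> 'h) \<Rightarrow> ('a, 'h, ('a, 'x) univ) right_data \<Rightarrow> ('a, 'x) univ \<Rightarrow> ('a, 'x) univ"
  where "counit_map A H p V =
    (\<lambda>x\<in>carrier (quot_obj A H p (free_obj A H p V)). tsum V (decode A V x) (\<lambda>a v. counit A a \<odot>\<^bsub>V\<^esub> v))"

end

theory Submission
  imports Defs
begin

text \<open>
  The counit \<open>[a \<otimes> v] \<mapsto> \<epsilon>(a)v\<close> is inverted by \<open>v \<mapsto> [1 \<otimes> v]\<close>.  The unit is inverted by means of the map
  \<open>P(f) = S(f\<^sub>(\<^sub>-\<^sub>1\<^sub>)) f\<^sub>(\<^sub>0\<^sub>)\<close>, which satisfies \<open>P(bf) = \<epsilon>(b)P(f)\<close> because \<open>S\<close> is antimultiplicative and so is defined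
  on \<open>M / A\<^sup>+M\<close>: the inverse is \<open>a \<otimes> [f] \<mapsto> a P(f)\<close>, since \<open>f\<^sub>(\<^sub>-\<^sub>2\<^sub>) S(f\<^sub>(\<^sub>-\<^sub>1\<^sub>)) f\<^sub>(\<^sub>0\<^sub>) = f\<close> and since the unit, being
  left \<open>A\<close>-linear, maps \<open>P(f)\<close> to \<open>S(f\<^sub>(\<^sub>-\<^sub>2\<^sub>)) f\<^sub>(\<^sub>-\<^sub>1\<^sub>) \<otimes> [f\<^sub>(\<^sub>0\<^sub>)] = 1 \<otimes> [f]\<close>.  The Yetter-Drinfeld structure of
  \<open>M / A\<^sup>+M\<close> rests on \<open>S\<close> being an antihomomorphism of algebras and of coalgebras; in each case the remaining
  cancellations are \<open>a\<^sub>1 S(a\<^sub>2) = \<epsilon>(a) = S(a\<^sub>1) a\<^sub>2\<close> after reordering by coassociativity.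
\<close>

section \<open>Linear and bilinear maps of modules\<close>

text \<open>Sweedler notation suppresses two things that have to be supplied here: independence of a
  sum from the list that represents the tensor, and the order of nested sums. Multilinearity settles
  the first. For the second, the rewrite rules aim at a normal form: iterated coproducts nest in the
  right-hand leg, the coproduct of a left coaction leg becomes an iterated left coaction, iterated
  right coactions become coproducts in \<open>H\<close>, and left coactions stand outside right
  ones. The order of two independent sums is not settled by any orientation; such exchanges are made
  by explicit instances of \<open>bsum_swap\<close>. The encoding is a second obstacle: elements of
  \<open>A \<otimes> V\<close> are encoded lists and elements of \<open>M / A^+M\<close> are chosen
  representatives, so neither can be computed with directly. Identities are therefore tested on
  \<open>upure A V a v\<close> (\<open>free_extB\<close>) and on \<open>cls A M m\<close>
  (\<open>quot_ball\<close>), where the structure maps have explicit formulas.\<close>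

text \<open>
  The predicates \<open>lin\<close>, \<open>bilin\<close>, \<open>trilin\<close> include that the spaces are modules; without this the congruence rule
  \<open>lin_cong\<close> would be conditional and of no use to the simplifier.
\<close>

definition lin :: "(complex, 'v, 'm) module_scheme \<Rightarrow> (complex, 'w, 'n) module_scheme \<Rightarrow> ('v \<Rightarrow> 'w) \<Rightarrow> bool"
  where "lin V W f \<longleftrightarrow> module CC V \<and> module CC W \<and> linear_map V W f"

definition bilin ::
  "(complex, 'v, 'm) module_scheme \<Rightarrow> (complex, 'w, 'n) module_scheme \<Rightarrow> (complex, 'x, 'k) module_scheme \<Rightarrow>
    ('v \<Rightarrow> 'w \<Rightarrow> 'x) \<Rightarrow> bool"
  where "bilin V W X b \<longleftrightarrow> module CC V \<and> module CC W \<and> module CC X \<and> bilinear_map V W X b"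

definition trilin ::
  "(complex, 'u, 'l) module_scheme \<Rightarrow> (complex, 'v, 'm) module_scheme \<Rightarrow> (complex, 'w, 'n) module_scheme \<Rightarrow>
    (complex, 'x, 'k) module_scheme \<Rightarrow> ('u \<Rightarrow> 'v \<Rightarrow> 'w \<Rightarrow> 'x) \<Rightarrow> bool"
  where "trilin U V W X b \<longleftrightarrow>
    module CC U \<and> module CC V \<and> module CC W \<and> module CC X \<and>
    (\<forall>v\<in>carrier V. \<forall>w\<in>carrier W. lin U X (\<lambda>u. b u v w)) \<and>
    (\<forall>u\<in>carrier U. \<forall>w\<in>carrier W. lin V X (\<lambda>v. b u v w)) \<and>
    (\<forall>u\<in>carrier U. \<forall>v\<in>carrier V. lin W X (\<lambda>w. b u v w))"

text \<open>
  Unlike \<open>tsum\<close>, the sum below ranges over a fixed list of pairs in the carriers, whatever \<open>b\<close> and \<open>t\<close> are.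
  This makes the congruence rule \<open>bsum_cong\<close> unconditional, so that the simplifier may use membership of
  the Sweedler components when it rewrites below the binder.
\<close>

definition tlist ::
  "(complex, 'v, 'm) module_scheme \<Rightarrow> (complex, 'w, 'n) module_scheme \<Rightarrow> ('v, 'w) tens \<Rightarrow> ('v \<times> 'w) list"
  where "tlist V W t =
    (if t \<in> carrier (V \<boxtimes> W)
     then SOME l. l \<in> lists (carrier V \<times> carrier W) \<and> t = tensor_rel V W `` {l} else [])"

definition bsum ::
  "(complex, 'v, 'm) module_scheme \<Rightarrow> (complex, 'w, 'n) module_scheme \<Rightarrow> (complex, 'x, 'k) module_scheme \<Rightarrow>
    ('v, 'w) tens \<Rightarrow> ('v \<Rightarrow> 'w \<Rightarrow> 'x) \<Rightarrow> 'x"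
  where "bsum V W X t b = formal_sum X b (tlist V W t)"

lemma tlist:
  shows tlist_closed: "tlist V W t \<in> lists (carrier V \<times> carrier W)"
    and class_tlist: "t \<in> carrier (V \<boxtimes> W) \<Longrightarrow> t = tensor_rel V W `` {tlist V W t}"
proof -
  have "tlist V W t \<in> lists (carrier V \<times> carrier W) \<and> t = tensor_rel V W `` {tlist V W t}"
    if "t \<in> carrier (V \<boxtimes> W)"
    using someI_ex[of "\<lambda>l. l \<in> lists (carrier V \<times> carrier W) \<and> t = tensor_rel V W `` {l}"]
      tensor_carrierE[OF that] that by (auto simp: tlist_def)
  moreover have "tlist V W t \<in> lists (carrier V \<times> carrier W)" if "t \<notin> carrier (V \<boxtimes> W)"
    using that by (simp add: tlist_def)
  ultimately show "tlist V W t \<in> lists (carrier V \<times> carrier W)"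
    "t \<in> carrier (V \<boxtimes> W) \<Longrightarrow> t = tensor_rel V W `` {tlist V W t}" by blast+
qed

lemma bsum_cong [cong]:
  assumes "t = t'" "\<And>v w. v \<in> carrier V \<Longrightarrow> w \<in> carrier W \<Longrightarrow> b v w = b' v w"
  shows "bsum V W X t b = bsum V W X t' b'"
proof -
  have "formal_sum X b l = formal_sum X b' l" if "l \<in> lists (carrier V \<times> carrier W)" for l
    using that by (induction l) (use assms(2) in auto)
  then show ?thesis using tlist_closed assms(1) unfolding bsum_def by blast
qed

lemma linD:
  assumes "lin V W f"
  shows "module CC V" "module CC W" "x \<in> carrier V \<Longrightarrow> f x \<in> carrier W"
    "x \<in> carrier V \<Longrightarrow> y \<in> carrier V \<Longrightarrow> f (x \<oplus>\<^bsub>V\<^esub> y) = f x \<oplus>\<^bsub>W\<^esub> f y"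
    "x \<in> carrier V \<Longrightarrow> f (c \<odot>\<^bsub>V\<^esub> x) = c \<odot>\<^bsub>W\<^esub> f x"
  using assms by (auto simp: lin_def linear_map_def)

lemma linI:
  assumes "module CC V" "module CC W" "\<And>x. x \<in> carrier V \<Longrightarrow> f x \<in> carrier W"
    "\<And>x y. x \<in> carrier V \<Longrightarrow> y \<in> carrier V \<Longrightarrow> f (x \<oplus>\<^bsub>V\<^esub> y) = f x \<oplus>\<^bsub>W\<^esub> f y"
    "\<And>c x. x \<in> carrier V \<Longrightarrow> f (c \<odot>\<^bsub>V\<^esub> x) = c \<odot>\<^bsub>W\<^esub> f x"
  shows "lin V W f"
  using assms by (auto simp: lin_def linear_map_def)

lemma module_smult_closed:
  assumes "module CC V" "x \<in> carrier V" shows "c \<odot>\<^bsub>V\<^esub> x \<in> carrier V"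
  using module.smult_closed[OF assms(1)] assms(2) by simp

lemma module_add_closed:
  assumes "module CC V" "x \<in> carrier V" "y \<in> carrier V" shows "x \<oplus>\<^bsub>V\<^esub> y \<in> carrier V"
proof -
  interpret module CC V by fact
  show ?thesis using assms by simp
qed

lemma module_zero_closed:
  assumes "module CC V" shows "\<zero>\<^bsub>V\<^esub> \<in> carrier V"
proof -
  interpret module CC V by fact
  show ?thesis by simp
qed

lemma module_smult_zero:
  assumes "module CC V" shows "c \<odot>\<^bsub>V\<^esub> \<zero>\<^bsub>V\<^esub> = \<zero>\<^bsub>V\<^esub>"
proof -
  interpret module CC V by fact
  show ?thesis using smult_r_null[of c] by simp
qed

lemma smult_smult:
  assumes "module CC V" "x \<in> carrier V" shows "c \<odot>\<^bsub>V\<^esub> (d \<odot>\<^bsub>V\<^esub> x) = (c * d) \<odot>\<^bsub>V\<^esub> x"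
  using module.smult_assoc1[OF assms(1), of c d x] assms(2) by simp

lemma smult_left_commute:
  assumes "module CC V" "x \<in> carrier V" shows "c \<odot>\<^bsub>V\<^esub> (d \<odot>\<^bsub>V\<^esub> x) = d \<odot>\<^bsub>V\<^esub> (c \<odot>\<^bsub>V\<^esub> x)"
  using assms by (simp add: smult_smult mult.commute)

lemma lin_zero:
  assumes "lin V W f" shows "f \<zero>\<^bsub>V\<^esub> = \<zero>\<^bsub>W\<^esub>"
proof -
  interpret V: module CC V using assms by (rule linD)
  interpret W: module CC W using assms by (rule linD)
  have "f (0 \<odot>\<^bsub>V\<^esub> \<zero>\<^bsub>V\<^esub>) = 0 \<odot>\<^bsub>W\<^esub> f \<zero>\<^bsub>V\<^esub>"
    using linD(5)[OF assms V.M.zero_closed] .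
  then show ?thesis
    using V.smult_l_null[OF V.M.zero_closed] W.smult_l_null[OF linD(3)[OF assms V.M.zero_closed]] by simp
qed

lemma lin_cong [cong]:
  assumes "\<And>x. x \<in> carrier V \<Longrightarrow> f x = g x"
  shows "lin V W f = lin V W g"
proof -
  have "lin V W g" if h: "lin V W f" "\<And>x. x \<in> carrier V \<Longrightarrow> f x = g x" for f g
  proof (rule linI)
    note 1 = linD[OF h(1)]
    show "module CC V" "module CC W" using 1 by auto
    fix x assume x: "x \<in> carrier V"
    show "g x \<in> carrier W" using 1(3)[of x] x h(2) by simp
    show "g (c \<odot>\<^bsub>V\<^esub> x) = c \<odot>\<^bsub>W\<^esub> g x" for c
      using 1(5)[of x c] x h(2) module_smult_closed[OF 1(1)] by simp
    fix y assume y: "y \<in> carrier V"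
    show "g (x \<oplus>\<^bsub>V\<^esub> y) = g x \<oplus>\<^bsub>W\<^esub> g y"
      using 1(4)[of x y] x y h(2) module_add_closed[OF 1(1)] by simp
  qed
  then show ?thesis using assms by metis
qed

lemma bilinI:
  assumes "module CC V" "module CC W" "module CC X"
    "\<And>v. v \<in> carrier V \<Longrightarrow> lin W X (b v)" "\<And>w. w \<in> carrier W \<Longrightarrow> lin V X (\<lambda>v. b v w)"
  shows "bilin V W X b"
  using assms by (auto simp: bilin_def bilinear_map_def lin_def)

lemma bilinD:
  assumes "bilin V W X b"
  shows "module CC V" "module CC W" "module CC X"
    "v \<in> carrier V \<Longrightarrow> lin W X (b v)" "w \<in> carrier W \<Longrightarrow> lin V X (\<lambda>v. b v w)"
    "v \<in> carrier V \<Longrightarrow> w \<in> carrier W \<Longrightarrow> b v w \<in> carrier X"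
  using assms by (auto simp: bilin_def bilinear_map_def lin_def linear_map_def)

lemma trilinI:
  assumes "module CC U" "module CC V" "module CC W" "module CC X"
    "\<And>v w. v \<in> carrier V \<Longrightarrow> w \<in> carrier W \<Longrightarrow> lin U X (\<lambda>u. b u v w)"
    "\<And>u w. u \<in> carrier U \<Longrightarrow> w \<in> carrier W \<Longrightarrow> lin V X (\<lambda>v. b u v w)"
    "\<And>u v. u \<in> carrier U \<Longrightarrow> v \<in> carrier V \<Longrightarrow> lin W X (\<lambda>w. b u v w)"
  shows "trilin U V W X b"
  using assms by (auto simp: trilin_def)

lemma trilinD:
  assumes "trilin U V W X b"
  shows "module CC U" "module CC V" "module CC W" "module CC X"
    "v \<in> carrier V \<Longrightarrow> w \<in> carrier W \<Longrightarrow> lin U X (\<lambda>u. b u v w)"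
    "u \<in> carrier U \<Longrightarrow> w \<in> carrier W \<Longrightarrow> lin V X (\<lambda>v. b u v w)"
    "u \<in> carrier U \<Longrightarrow> v \<in> carrier V \<Longrightarrow> lin W X (\<lambda>w. b u v w)"
    "u \<in> carrier U \<Longrightarrow> v \<in> carrier V \<Longrightarrow> w \<in> carrier W \<Longrightarrow> b u v w \<in> carrier X"
  using assms linD(3)[of W X "b u v" w] by (auto simp: trilin_def)

lemma lin_id: "module CC V \<Longrightarrow> lin V V (\<lambda>x. x)"
  by (rule linI) auto

lemma lin_comp:
  assumes "lin V X f" "lin U V g" shows "lin U X (\<lambda>x. f (g x))"
  using linD[OF assms(1)] linD[OF assms(2)] by (intro linI) auto

lemma lin_smult:
  assumes "lin U X f" shows "lin U X (\<lambda>x. c \<odot>\<^bsub>X\<^esub> f x)"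
proof -
  note f = linD[OF assms]
  interpret X: module CC X by (rule f)
  show ?thesis
    by (rule linI)
       (use f X.smult_r_distr[of c] in \<open>auto simp: smult_left_commute module_smult_closed\<close>)
qed

lemma lin_scalar:
  assumes "module CC U" "linear_map U CC s" "module CC X" "x \<in> carrier X"
  shows "lin U X (\<lambda>u. s u \<odot>\<^bsub>X\<^esub> x)"
proof -
  interpret X: module CC X by fact
  show ?thesis
    by (rule linI)
       (use assms X.smult_l_distr[of _ _ x] in \<open>auto simp: smult_smult module_smult_closed linear_map_def\<close>)
qed

lemma bilin_comp1: "bilin V W X b \<Longrightarrow> lin U V g \<Longrightarrow> w \<in> carrier W \<Longrightarrow> lin U X (\<lambda>x. b (g x) w)"
  by (rule lin_comp[of V X "\<lambda>v. b v w"]) (auto dest: bilinD)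

lemma bilin_comp2: "bilin V W X b \<Longrightarrow> lin U W g \<Longrightarrow> v \<in> carrier V \<Longrightarrow> lin U X (\<lambda>x. b v (g x))"
  by (rule lin_comp[of W X "b v"]) (auto dest: bilinD)

section \<open>Sums over tensors\<close>

lemma formal_sum_in:
  assumes "module CC X" "l \<in> lists (carrier V \<times> carrier W)"
    "\<And>v w. v \<in> carrier V \<Longrightarrow> w \<in> carrier W \<Longrightarrow> b v w \<in> carrier X"
  shows "formal_sum X b l \<in> carrier X"
  using assms(2) by (induction l) (use assms in \<open>auto simp: module_zero_closed module_add_closed\<close>)

lemma bsum_closed:
  assumes "module CC X" "\<And>v w. v \<in> carrier V \<Longrightarrow> w \<in> carrier W \<Longrightarrow> b v w \<in> carrier X"
  shows "bsum V W X t b \<in> carrier X"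
  unfolding bsum_def by (rule formal_sum_in[OF assms(1) tlist_closed assms(2)])

text \<open>\<open>tsum\<close> asks for a value common to all representing lists,
  \<open>bsum\<close> evaluates one fixed list; bilinearity makes all lists give the same value.
  Through this bridge the formulas of the definitions enter the calculus of
  \<open>bsum\<close>.\<close>

lemma tsum_bsum:
  assumes "bilin V W X b" "t \<in> carrier (V \<boxtimes> W)"
  shows "tsum X t b = bsum V W X t b"
proof -
  have "tsum X (tensor_rel V W `` {tlist V W t}) b = bsum V W X t b"
    using tsum_class[of V W X b "tlist V W t"] assms tlist_closed by (metis bilin_def bsum_def)
  then show ?thesis using class_tlist[OF assms(2)] by simp
qed

lemma pure_closed: "v \<in> carrier V \<Longrightarrow> w \<in> carrier W \<Longrightarrow> pure V W v w \<in> carrier (V \<boxtimes> W)"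
  unfolding pure_def by (rule tensor_carrierI) auto

lemma bsum_pure:
  assumes "bilin V W X b" "v \<in> carrier V" "w \<in> carrier W"
  shows "bsum V W X (pure V W v w) b = b v w"
  using tsum_bsum[OF assms(1) pure_closed[OF assms(2,3)]] tsum_pure[of V W X b v w] assms
  by (simp add: bilin_def)

lemma lin_bsum:
  assumes "bilin V W X b" shows "lin (V \<boxtimes> W) X (\<lambda>t. bsum V W X t b)"
proof -
  have "linear_map (V \<boxtimes> W) X (\<lambda>t. tsum X t b)"
    using assms by (auto simp: bilin_def intro: linear_map_tsum)
  then have "lin (V \<boxtimes> W) X (\<lambda>t. tsum X t b)"
    using assms by (auto simp: bilin_def lin_def intro: tensor_module)
  then show ?thesis by (simp add: tsum_bsum[OF assms] cong: lin_cong)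
qed

text \<open>The sum runs over a fixed list, so additivity of \<open>f\<close> alone moves it inside.
  This is the rule that pulls inner Sweedler sums out of linear maps.\<close>

lemma bsum_lin:
  assumes f: "lin X Y f" and b: "\<And>v w. v \<in> carrier V \<Longrightarrow> w \<in> carrier W \<Longrightarrow> b v w \<in> carrier X"
  shows "f (bsum V W X t b) = bsum V W Y t (\<lambda>v w. f (b v w))"
proof -
  have "f (formal_sum X b l) = formal_sum Y (\<lambda>v w. f (b v w)) l"
    if "l \<in> lists (carrier V \<times> carrier W)" for l
    using that
  proof (induction l)
    case Nil then show ?case by (simp add: lin_zero[OF f])
  next
    case (Cons p l)
    then show ?case
      using b linD[OF f] formal_sum_in[OF linD(1)[OF f] Cons.hyps(2), of b] by auto
  qed
  then show ?thesis unfolding bsum_def using tlist_closed by blast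
qed

text \<open>A sum of linear maps over a list that does not vary with the parameter is linear. This
  discharges the linearity side conditions of nested Sweedler expressions.\<close>

lemma lin_bsum_param:
  assumes U: "module CC U" "module CC X"
    and b: "\<And>v w. v \<in> carrier V \<Longrightarrow> w \<in> carrier W \<Longrightarrow> lin U X (\<lambda>u. b u v w)"
  shows "lin U X (\<lambda>u. bsum V W X t (b u))"
proof -
  interpret X: module CC X by fact
  have "lin U X (\<lambda>u. formal_sum X (b u) l)" if "l \<in> lists (carrier V \<times> carrier W)" for l
    using that
  proof (induction l)
    case Nil then show ?case using U module_smult_zero[OF U(2)] by (auto intro!: linI)
  next
    case (Cons p l)
    obtain v w where p: "p = (v, w)" "v \<in> carrier V" "w \<in> carrier W" using Cons.hyps by auto
    note 1 = linD[OF b[OF p(2,3)]] and 2 = linD[OF Cons.IH]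
    show ?case unfolding p(1) formal_sum_simps
    proof (rule linI)
      show "b (x \<oplus>\<^bsub>U\<^esub> y) v w \<oplus>\<^bsub>X\<^esub> formal_sum X (b (x \<oplus>\<^bsub>U\<^esub> y)) l =
        b x v w \<oplus>\<^bsub>X\<^esub> formal_sum X (b x) l \<oplus>\<^bsub>X\<^esub> (b y v w \<oplus>\<^bsub>X\<^esub> formal_sum X (b y) l)"
        if "x \<in> carrier U" "y \<in> carrier U" for x y
        using that 1 2 by (simp add: X.M.a_ac)
      show "b (c \<odot>\<^bsub>U\<^esub> x) v w \<oplus>\<^bsub>X\<^esub> formal_sum X (b (c \<odot>\<^bsub>U\<^esub> x)) l = c \<odot>\<^bsub>X\<^esub> (b x v w \<oplus>\<^bsub>X\<^esub> formal_sum X (b x) l)"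
        if "x \<in> carrier U" for c x
        using that 1 2 X.smult_r_distr[of c] by simp
    qed (use 1 2 U in auto)
  qed
  then show ?thesis unfolding bsum_def using tlist_closed by blast
qed

text \<open>The class of a list is the sum of the classes of its one-element pieces. Hence a linear
  map on a tensor product is recovered from its values on pure tensors.\<close>

lemma bsum_pure_id:
  assumes VW: "module CC V" "module CC W" and t: "t \<in> carrier (V \<boxtimes> W)"
  shows "bsum V W (V \<boxtimes> W) t (pure V W) = t"
proof -
  have "formal_sum (V \<boxtimes> W) (pure V W) l = tensor_rel V W `` {l}"
    if "l \<in> lists (carrier V \<times> carrier W)" for l
    using that
  proof (induction l)
    case Nil then show ?case by (simp add: tensor_def)
  next
    case (Cons p l)
    then show ?case
      using tensor_add_class[OF VW, of "[p]" l] by (cases p) (auto simp: pure_def)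
  qed
  then show ?thesis using tlist_closed class_tlist[OF t] unfolding bsum_def by metis
qed

lemma bilin_pure:
  assumes VW: "module CC V" "module CC W" shows "bilin V W (V \<boxtimes> W) (pure V W)"
proof (intro bilinI linI)
  note eqI = equiv_class_eq[OF equiv_tensor_rel[OF VW]]
  interpret V: module CC V by fact
  interpret W: module CC W by fact
  fix v w assume vw: "v \<in> carrier V" "w \<in> carrier W"
  show "pure V W v w \<in> carrier (V \<boxtimes> W)" by (rule pure_closed[OF vw])
  then show "pure V W v w \<in> carrier (V \<boxtimes> W)" .
  have c1: "pure V W (c \<odot>\<^bsub>V\<^esub> v) w = c \<odot>\<^bsub>V \<boxtimes> W\<^esub> pure V W v w" for c
    using tensor_smult_class[OF VW, of "[(v, w)]" c] vw by (simp add: pure_def)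
  then show "pure V W (c \<odot>\<^bsub>V\<^esub> v) w = c \<odot>\<^bsub>V \<boxtimes> W\<^esub> pure V W v w" for c .
  have "pure V W v (c \<odot>\<^bsub>W\<^esub> w) = pure V W (c \<odot>\<^bsub>V\<^esub> v) w" for c
    unfolding pure_def by (rule eqI) (intro tensor_rel.sym[OF tensor_rel.balance] vw)
  then show "pure V W v (c \<odot>\<^bsub>W\<^esub> w) = c \<odot>\<^bsub>V \<boxtimes> W\<^esub> pure V W v w" for c
    using c1 by simp
next
  note eqI = equiv_class_eq[OF equiv_tensor_rel[OF VW]]
  show "pure V W v (w \<oplus>\<^bsub>W\<^esub> w') = pure V W v w \<oplus>\<^bsub>V \<boxtimes> W\<^esub> pure V W v w'"
    if "v \<in> carrier V" "w \<in> carrier W" "w' \<in> carrier W" for v w w'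
    using tensor_add_class[OF VW, of "[(v, w)]" "[(v, w')]"] that eqI[OF tensor_rel.add_right[OF that]]
    by (simp add: pure_def)
  show "pure V W (v \<oplus>\<^bsub>V\<^esub> v') w = pure V W v w \<oplus>\<^bsub>V \<boxtimes> W\<^esub> pure V W v' w"
    if "w \<in> carrier W" "v \<in> carrier V" "v' \<in> carrier V" for v v' w
    using tensor_add_class[OF VW, of "[(v, w)]" "[(v', w)]"] that eqI[OF tensor_rel.add_left[OF that(2,3,1)]]
    by (simp add: pure_def)
qed (use VW in \<open>auto intro: tensor_module\<close>)

text \<open>Finite sums over two fixed lists commute, provided neither tensor depends on the
  summation variables of the other. Having no preferred direction, the rule is kept out of the
  simplification sets and is applied to explicit instances.\<close>

lemma bsum_swap:
  assumes X: "module CC X"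
    and f: "\<And>a b c d. \<lbrakk>a \<in> carrier V; b \<in> carrier W; c \<in> carrier P; d \<in> carrier Q\<rbrakk> \<Longrightarrow> f a b c d \<in> carrier X"
  shows "bsum V W X s (\<lambda>a b. bsum P Q X t (\<lambda>c d. f a b c d)) = bsum P Q X t (\<lambda>c d. bsum V W X s (\<lambda>a b. f a b c d))"
proof -
  interpret X: module CC X by fact
  obtain l where l: "l \<in> lists (carrier V \<times> carrier W)" "\<And>b. bsum V W X s b = formal_sum X b l"
    using tlist_closed bsum_def by metis
  obtain m where m: "m \<in> lists (carrier P \<times> carrier Q)" "\<And>b. bsum P Q X t b = formal_sum X b m"
    using tlist_closed bsum_def by metis
  have 0: "formal_sum X (\<lambda>c d. \<zero>\<^bsub>X\<^esub>) m = \<zero>\<^bsub>X\<^esub>" by (induction m) auto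
  have plus: "formal_sum X (\<lambda>c d. g c d \<oplus>\<^bsub>X\<^esub> h c d) m = formal_sum X g m \<oplus>\<^bsub>X\<^esub> formal_sum X h m"
    if "\<And>c d. c \<in> carrier P \<Longrightarrow> d \<in> carrier Q \<Longrightarrow> g c d \<in> carrier X"
      "\<And>c d. c \<in> carrier P \<Longrightarrow> d \<in> carrier Q \<Longrightarrow> h c d \<in> carrier X" for g h
    using m(1)
  proof (induction m)
    case (Cons p m)
    have "formal_sum X g m \<in> carrier X" "formal_sum X h m \<in> carrier X"
      using Cons.hyps that by (auto intro: formal_sum_in[OF X])
    with Cons that show ?case by (auto simp: X.M.a_ac)
  qed simp
  have "formal_sum X (\<lambda>a b. formal_sum X (f a b) m) l = formal_sum X (\<lambda>c d. formal_sum X (\<lambda>a b. f a b c d) l) m"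
    using l(1)
  proof (induction l)
    case (Cons p l)
    obtain a b where p: "p = (a, b)" "a \<in> carrier V" "b \<in> carrier W" using Cons.hyps by auto
    show ?case unfolding p(1) formal_sum_simps Cons.IH
      by (rule plus[symmetric]) (use p f Cons.hyps in \<open>auto intro: formal_sum_in[OF X]\<close>)
  qed (simp add: 0)
  then show ?thesis by (simp add: l m)
qed

lemma lin_tensor_ext:
  assumes "lin (V \<boxtimes> W) X f" "lin (V \<boxtimes> W) X g" "module CC V" "module CC W"
    "\<And>v w. v \<in> carrier V \<Longrightarrow> w \<in> carrier W \<Longrightarrow> f (pure V W v w) = g (pure V W v w)"
    and t: "t \<in> carrier (V \<boxtimes> W)"
  shows "f t = g t"
proof -
  have "h t = bsum V W X t (\<lambda>v w. h (pure V W v w))" if "lin (V \<boxtimes> W) X h" for h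
    using bsum_lin[OF that, of V W "pure V W" t] bsum_pure_id[OF assms(3,4) t] pure_closed[of _ V _ W] by simp
  from this[OF assms(1)] this[OF assms(2)] show ?thesis by (simp add: assms(5))
qed

text \<open>
  The next lemmas list the facts about a linear or bilinear operation which turn nested Sweedler
  expressions into a normal form with all sums outermost.
\<close>

lemma lin_rules:
  assumes "lin V X f"
  shows "x \<in> carrier V \<Longrightarrow> f x \<in> carrier X"
    "lin U V g \<Longrightarrow> lin U X (\<lambda>u. f (g u))"
    "(\<And>p q. p \<in> carrier P \<Longrightarrow> q \<in> carrier Q \<Longrightarrow> b p q \<in> carrier V) \<Longrightarrow>
      f (bsum P Q V t b) = bsum P Q X t (\<lambda>p q. f (b p q))"
    "x \<in> carrier V \<Longrightarrow> f (c \<odot>\<^bsub>V\<^esub> x) = c \<odot>\<^bsub>X\<^esub> f x"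
    "lin V X f" "module CC V" "module CC X"
  using linD[OF assms] lin_comp[OF assms] assms by (auto intro: bsum_lin)

lemma bilin_rules:
  assumes "bilin V W X f"
  shows "x \<in> carrier V \<Longrightarrow> y \<in> carrier W \<Longrightarrow> f x y \<in> carrier X"
    "lin U V g \<Longrightarrow> y \<in> carrier W \<Longrightarrow> lin U X (\<lambda>u. f (g u) y)"
    "x \<in> carrier V \<Longrightarrow> lin U W h \<Longrightarrow> lin U X (\<lambda>u. f x (h u))"
    "(\<And>p q. p \<in> carrier P \<Longrightarrow> q \<in> carrier Q \<Longrightarrow> b p q \<in> carrier V) \<Longrightarrow> y \<in> carrier W \<Longrightarrow>
      f (bsum P Q V t b) y = bsum P Q X t (\<lambda>p q. f (b p q) y)"
    "(\<And>p q. p \<in> carrier P \<Longrightarrow> q \<in> carrier Q \<Longrightarrow> b' p q \<in> carrier W) \<Longrightarrow> x \<in> carrier V \<Longrightarrow>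
      f x (bsum P Q W t b') = bsum P Q X t (\<lambda>p q. f x (b' p q))"
    "x \<in> carrier V \<Longrightarrow> y \<in> carrier W \<Longrightarrow> f (c \<odot>\<^bsub>V\<^esub> x) y = c \<odot>\<^bsub>X\<^esub> f x y"
    "x \<in> carrier V \<Longrightarrow> y \<in> carrier W \<Longrightarrow> f x (c \<odot>\<^bsub>W\<^esub> y) = c \<odot>\<^bsub>X\<^esub> f x y"
    "bilin V W X f"
    "y \<in> carrier W \<Longrightarrow> lin V X (\<lambda>v. f v y)"
    "x \<in> carrier V \<Longrightarrow> lin W X (f x)"
    "module CC V" "module CC W" "module CC X"
proof -
  note f = bilinD[OF assms]
  show "x \<in> carrier V \<Longrightarrow> y \<in> carrier W \<Longrightarrow> f x y \<in> carrier X"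
    "lin U V g \<Longrightarrow> y \<in> carrier W \<Longrightarrow> lin U X (\<lambda>u. f (g u) y)"
    "x \<in> carrier V \<Longrightarrow> lin U W h \<Longrightarrow> lin U X (\<lambda>u. f x (h u))"
    using f(6) bilin_comp1[OF assms] bilin_comp2[OF assms] by auto
  show "(\<And>p q. p \<in> carrier P \<Longrightarrow> q \<in> carrier Q \<Longrightarrow> b p q \<in> carrier V) \<Longrightarrow> y \<in> carrier W \<Longrightarrow>
      f (bsum P Q V t b) y = bsum P Q X t (\<lambda>p q. f (b p q) y)"
    by (rule bsum_lin[OF f(5)])
  show "(\<And>p q. p \<in> carrier P \<Longrightarrow> q \<in> carrier Q \<Longrightarrow> b' p q \<in> carrier W) \<Longrightarrow> x \<in> carrier V \<Longrightarrow>
      f x (bsum P Q W t b') = bsum P Q X t (\<lambda>p q. f x (b' p q))"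
    by (rule bsum_lin[OF f(4)])
  show "x \<in> carrier V \<Longrightarrow> y \<in> carrier W \<Longrightarrow> f (c \<odot>\<^bsub>V\<^esub> x) y = c \<odot>\<^bsub>X\<^esub> f x y"
    "x \<in> carrier V \<Longrightarrow> y \<in> carrier W \<Longrightarrow> f x (c \<odot>\<^bsub>W\<^esub> y) = c \<odot>\<^bsub>X\<^esub> f x y"
    using linD(5)[OF f(5)] linD(5)[OF f(4)] by auto
  show "y \<in> carrier W \<Longrightarrow> lin V X (\<lambda>v. f v y)" "x \<in> carrier V \<Longrightarrow> lin W X (f x)" "module CC V" "module CC W" "module CC X" using f by auto
qed (rule assms)

text \<open>The module facts among \<open>bilin_rules\<close> are left out: for \<open>pure\<close>
  they would conclude \<open>module CC V\<close> and \<open>module CC W\<close> from themselves, or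
  repeat \<open>tensor_module\<close>.\<close>

lemmas pure_rules = bilin_rules(1-10)[OF bilin_pure]

lemma bsum_bsum:
  assumes "bilin V W X c" "\<And>p q. p \<in> carrier P \<Longrightarrow> q \<in> carrier Q \<Longrightarrow> b p q \<in> carrier (V \<boxtimes> W)"
  shows "bsum V W X (bsum P Q (V \<boxtimes> W) t b) c = bsum P Q X t (\<lambda>p q. bsum V W X (b p q) c)"
  using bsum_lin[OF lin_bsum[OF assms(1)] assms(2)] .

lemma bsum_smult_arg:
  assumes "bilin V W X c" "t \<in> carrier (V \<boxtimes> W)"
  shows "bsum V W X (z \<odot>\<^bsub>V \<boxtimes> W\<^esub> t) c = z \<odot>\<^bsub>X\<^esub> bsum V W X t c"
  using linD(5)[OF lin_bsum[OF assms(1)] assms(2)] .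

lemma bsum_smult:
  assumes "module CC X" "\<And>v w. v \<in> carrier V \<Longrightarrow> w \<in> carrier W \<Longrightarrow> b v w \<in> carrier X"
  shows "bsum V W X t (\<lambda>v w. z \<odot>\<^bsub>X\<^esub> b v w) = z \<odot>\<^bsub>X\<^esub> bsum V W X t b"
  using bsum_lin[OF lin_smult[OF lin_id[OF assms(1)]], of V W b z t] assms(2) by simp

lemma lin_bsum_comp: "lin U (V \<boxtimes> W) g \<Longrightarrow> bilin V W X b \<Longrightarrow> lin U X (\<lambda>u. bsum V W X (g u) b)"
  using lin_comp[OF lin_bsum] .

lemmas tens_rules = tensor_module lin_id lin_smult bilinI trilinI bsum_closed bsum_pure bsum_bsum bsum_smult_arg
  lin_bsum_param lin_bsum_comp module_smult_closed module_zero_closed pure_rules bsum_pure_id bsum_smult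

lemma tmap_bsum:
  assumes "lin V0 V f" "lin W0 W g" "t \<in> carrier (V0 \<boxtimes> W0)"
  shows "tmap V W f g t = bsum V0 W0 (V \<boxtimes> W) t (\<lambda>v w. pure V W (f v) (g w))"
  unfolding tmap_def
  by (rule tsum_bsum) (use linD[OF assms(1)] linD[OF assms(2)] assms in \<open>simp_all add: tens_rules lin_rules[OF assms(1)] lin_rules[OF assms(2)]\<close>)

section \<open>Coassociativity in Sweedler form\<close>

text \<open>The map \<open>f\<close> is kept general so that comultiplications, left coactions and
  right coactions are covered at once.\<close>

lemma tassoc_bsum:
  assumes UVW: "module CC U" "module CC V" "module CC W" and f: "lin P (U \<boxtimes> V) f"
    and t: "t \<in> carrier (P \<boxtimes> W)"
  shows "tassoc U V W (tmap (U \<boxtimes> V) W f id t) = bsum P W (U \<boxtimes> V \<boxtimes> W) t (\<lambda>x w.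
    bsum U V (U \<boxtimes> V \<boxtimes> W) (f x) (\<lambda>u v. pure U (V \<boxtimes> W) u (pure V W v w)))" (is "_ = ?R")
proof -
  note [simp] = tens_rules UVW lin_rules[OF f]
  have 1: "tmap (U \<boxtimes> V) W f id t = bsum P W ((U \<boxtimes> V) \<boxtimes> W) t (\<lambda>x w. pure (U \<boxtimes> V) W (f x) w)"
    using tmap_bsum[OF f lin_id[OF UVW(3)] t] by (simp add: id_def)
  have 2: "bilin (U \<boxtimes> V) W (U \<boxtimes> V \<boxtimes> W)
      (\<lambda>s w. bsum U V (U \<boxtimes> V \<boxtimes> W) s (\<lambda>u v. pure U (V \<boxtimes> W) u (pure V W v w)))"
    by simp
  \<comment> \<open>The outer \<open>tsum\<close> can become a \<open>bsum\<close> only once its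
    integrand, itself a \<open>tsum\<close>, is known to be bilinear; this is checked pointwise,
    where the inner sum can already be converted.\<close>
  have 3: "bilin (U \<boxtimes> V) W (U \<boxtimes> V \<boxtimes> W)
      (\<lambda>s w. tsum (U \<boxtimes> V \<boxtimes> W) s (\<lambda>u v. pure U (V \<boxtimes> W) u (pure V W v w)))"
    by (rule bilinI) (simp_all add: tsum_bsum[of U V])
  show ?thesis
    unfolding tassoc_def
    by (subst tsum_bsum[OF 3]) (simp_all add: 1 tsum_bsum[of U V])
qed

lemma tmap_id_bsum:
  assumes U: "module CC U" "module CC V" "module CC W" and g: "lin Q (V \<boxtimes> W) g" and t: "t \<in> carrier (U \<boxtimes> Q)"
  shows "tmap U (V \<boxtimes> W) id g t = bsum U Q (U \<boxtimes> V \<boxtimes> W) t (\<lambda>u x.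
    bsum V W (U \<boxtimes> V \<boxtimes> W) (g x) (\<lambda>v w. pure U (V \<boxtimes> W) u (pure V W v w)))"
proof -
  note [simp] = tens_rules U lin_rules[OF g]
  have "pure U (V \<boxtimes> W) u (g x) = bsum V W (U \<boxtimes> V \<boxtimes> W) (g x) (\<lambda>v w. pure U (V \<boxtimes> W) u (pure V W v w))"
    if "u \<in> carrier U" "x \<in> carrier Q" for u x
    using bsum_lin[of "V \<boxtimes> W" "U \<boxtimes> V \<boxtimes> W" "pure U (V \<boxtimes> W) u" V W "pure V W" "g x"] that by simp
  moreover have "tmap U (V \<boxtimes> W) id g t = bsum U Q (U \<boxtimes> V \<boxtimes> W) t (\<lambda>u x. pure U (V \<boxtimes> W) u (g x))"
    using tmap_bsum[OF lin_id[OF U(1)] g t] by (simp add: id_def)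
  ultimately show ?thesis by (auto intro: bsum_cong)
qed

text \<open>Common source of coassociativity for comultiplications, for both kinds of coaction, and
  of the bicomodule condition: each is an equation in \<open>U \<boxtimes> V \<boxtimes> W\<close>,
  and applying the linear map induced by \<open>b\<close> to it gives the Sweedler form.\<close>

lemma bsum_assoc:
  assumes UVW: "module CC U" "module CC V" "module CC W"
    and f: "lin P (U \<boxtimes> V) f" and t: "t \<in> carrier (P \<boxtimes> W)"
    and g: "lin Q (V \<boxtimes> W) g" and t': "t' \<in> carrier (U \<boxtimes> Q)"
    and eq: "tassoc U V W (tmap (U \<boxtimes> V) W f id t) = tmap U (V \<boxtimes> W) id g t'"
    and b: "trilin U V W X b"
  shows "bsum P W X t (\<lambda>x w. bsum U V X (f x) (\<lambda>u v. b u v w)) =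
    bsum U Q X t' (\<lambda>u x. bsum V W X (g x) (\<lambda>v w. b u v w))"
proof -
  note [simp] = tens_rules lin_rules[OF f] lin_rules[OF g] trilinD[OF b]
  \<comment> \<open>\<open>h\<close> is the linear map on the triple tensor product that corresponds
    to the trilinear map \<open>b\<close>.\<close>
  define h where "h = (\<lambda>s. bsum U (V \<boxtimes> W) X s (\<lambda>u r. bsum V W X r (\<lambda>v w. b u v w)))"
  have h: "lin (U \<boxtimes> V \<boxtimes> W) X h" unfolding h_def by simp
  have hp: "h (pure U (V \<boxtimes> W) u (pure V W v w)) = b u v w"
    if "u \<in> carrier U" "v \<in> carrier V" "w \<in> carrier W" for u v w
    unfolding h_def using that by simp
  have "h (tassoc U V W (tmap (U \<boxtimes> V) W f id t)) = bsum P W X t (\<lambda>x w. bsum U V X (f x) (\<lambda>u v. b u v w))"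
    unfolding tassoc_bsum[OF UVW f t] by (simp add: lin_rules[OF h] hp)
  moreover have "h (tmap U (V \<boxtimes> W) id g t') = bsum U Q X t' (\<lambda>u x. bsum V W X (g x) (\<lambda>v w. b u v w))"
    unfolding tmap_id_bsum[OF UVW g t'] by (simp add: lin_rules[OF h] hp)
  ultimately show ?thesis using eq by simp
qed

section \<open>Hopf algebras\<close>

context hopf_algebra
begin

lemma module_A: "module CC A" ..

lemma bilin_mult: "bilin A A A (\<otimes>)"
  by (intro bilinI linI) (simp_all add: module_A smult_left smult_right l_distr r_distr module_smult_closed)

lemma lin_comult: "lin A (A \<boxtimes> A) (comult A)"
  using comult_linear by (simp add: lin_def module_A tensor_module)

lemma lin_antipode: "lin A A (antipode A)"
  using antipode_linear by (simp add: lin_def module_A)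

lemma lin_counit_smult:
  assumes "module CC X" "x \<in> carrier X" "lin U A g" shows "lin U X (\<lambda>u. counit A (g u) \<odot>\<^bsub>X\<^esub> x)"
  using lin_comp[OF lin_scalar[OF module_A counit_linear assms(1,2)] assms(3)] .

lemma tsum_comult:
  "bilin A A X b \<Longrightarrow> a \<in> carrier A \<Longrightarrow> tsum X (comult A a) b = bsum A A X (comult A a) b"
  by (rule tsum_bsum) (use linD[OF lin_comult] in auto)

lemmas hopf_rules = module_A bilin_rules[OF bilin_mult] lin_rules[OF lin_comult] lin_rules[OF lin_antipode]
  lin_counit_smult tsum_comult counit_mult counit_one

text \<open>Oriented from coproducts of the first leg to coproducts of the second, so that rewriting
  ends in right-nested iterated coproducts.\<close>

lemma coassoc_bsum:
  assumes "trilin A A A X b" "a \<in> carrier A"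
  shows "bsum A A X (comult A a) (\<lambda>x w. bsum A A X (comult A x) (\<lambda>u v. b u v w)) =
    bsum A A X (comult A a) (\<lambda>u x. bsum A A X (comult A x) (\<lambda>v w. b u v w))"
  by (rule bsum_assoc[OF module_A module_A module_A lin_comult _ lin_comult _ _ assms(1)])
    (use assms(2) coassoc in \<open>simp_all add: hopf_rules\<close>)

lemma comult_mult_bsum:
  assumes "a \<in> carrier A" "b \<in> carrier A"
  shows "comult A (a \<otimes> b) = bsum A A (A \<boxtimes> A) (comult A a) (\<lambda>a\<^sub>1 a\<^sub>2. bsum A A (A \<boxtimes> A) (comult A b) (\<lambda>b\<^sub>1 b\<^sub>2.
    pure A A (a\<^sub>1 \<otimes> b\<^sub>1) (a\<^sub>2 \<otimes> b\<^sub>2)))"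
  using assms by (simp add: comult_mult hopf_rules tens_rules)

text \<open>The linear map \<open>g\<close> stands for the rest of a Sweedler expression as a
  function of one leg, which makes the axiom usable deep inside a formula. The counit and antipode
  rules that follow have the same shape.\<close>

lemma counit_left_bsum:
  assumes g: "lin A X g" and a: "a \<in> carrier A"
  shows "bsum A A X (comult A a) (\<lambda>a\<^sub>1 a\<^sub>2. counit A a\<^sub>1 \<odot>\<^bsub>X\<^esub> g a\<^sub>2) = g a"
proof -
  note [simp] = hopf_rules tens_rules lin_rules[OF g]
  show ?thesis using arg_cong[OF counit_left[OF a], of g] a by simp
qed

lemma counit_right_bsum:
  assumes g: "lin A X g" and a: "a \<in> carrier A"
  shows "bsum A A X (comult A a) (\<lambda>a\<^sub>1 a\<^sub>2. counit A a\<^sub>2 \<odot>\<^bsub>X\<^esub> g a\<^sub>1) = g a"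
proof -
  note [simp] = hopf_rules tens_rules lin_rules[OF g]
  show ?thesis using arg_cong[OF counit_right[OF a], of g] a by simp
qed

lemma antipode_left_bsum:
  assumes g: "lin A X g" and a: "a \<in> carrier A"
  shows "bsum A A X (comult A a) (\<lambda>a\<^sub>1 a\<^sub>2. g (antipode A a\<^sub>1 \<otimes> a\<^sub>2)) = counit A a \<odot>\<^bsub>X\<^esub> g \<one>"
proof -
  note [simp] = hopf_rules tens_rules lin_rules[OF g]
  show ?thesis using arg_cong[OF antipode_left[OF a], of g] a by simp
qed

lemma antipode_right_bsum:
  assumes g: "lin A X g" and a: "a \<in> carrier A"
  shows "bsum A A X (comult A a) (\<lambda>a\<^sub>1 a\<^sub>2. g (a\<^sub>1 \<otimes> antipode A a\<^sub>2)) = counit A a \<odot>\<^bsub>X\<^esub> g \<one>"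
proof -
  note [simp] = hopf_rules tens_rules lin_rules[OF g]
  show ?thesis using arg_cong[OF antipode_right[OF a], of g] a by simp
qed

abbreviation sw :: "(complex, 'x, 'm) module_scheme \<Rightarrow> 'a \<Rightarrow> ('a \<Rightarrow> 'a \<Rightarrow> 'x) \<Rightarrow> 'x"
  where "sw X a b \<equiv> bsum A A X (comult A a) b"

text \<open>After reassociation to the right, the product of \<open>a\<^sub>1\<close> and
  \<open>S(a\<^sub>2)\<close> is no longer a subterm when a factor follows; this variant matches the
  reassociated form.\<close>

lemma antipode_right_bsum':
  assumes g: "lin A X g" and a: "a \<in> carrier A" "z \<in> carrier A"
  shows "sw X a (\<lambda>a\<^sub>1 a\<^sub>2. g (a\<^sub>1 \<otimes> (antipode A a\<^sub>2 \<otimes> z))) = counit A a \<odot>\<^bsub>X\<^esub> g z"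
proof -
  note [simp] = hopf_rules tens_rules lin_rules[OF g] m_assoc
  show ?thesis using antipode_right_bsum[of X "\<lambda>w. g (w \<otimes> z)" a] a by simp
qed

text \<open>Applying the counit to \<open>S(a\<^sub>1) a\<^sub>2 = \<epsilon>(a) 1\<close> gives
  \<open>\<epsilon>(S(a\<^sub>1)) \<epsilon>(a\<^sub>2) = \<epsilon>(a)\<close>, and the counit
  axiom contracts the left side to \<open>\<epsilon>(S(a))\<close>.\<close>

lemma counit_antipode:
  assumes a: "a \<in> carrier A"
  shows "counit A (antipode A a) = counit A a"
proof -
  \<comment> \<open>The scalars are viewed as a vector space over themselves, so that the counit
    becomes a \<open>lin\<close> map to which the Sweedler rules apply.\<close>
  have CC: "module CC CC"
    by (intro moduleI abelian_groupI is_cring) (auto simp: algebra_simps intro: exI[of _ "- _"])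
  have e: "lin A CC (counit A)" using counit_linear by (simp add: lin_def module_A CC)
  note [simp] = hopf_rules tens_rules lin_rules[OF e]
  have "counit A a = sw CC a (\<lambda>a\<^sub>1 a\<^sub>2. counit A (antipode A a\<^sub>1 \<otimes> a\<^sub>2))"
    using antipode_left_bsum[OF e a] by simp
  also have "\<dots> = sw CC a (\<lambda>a\<^sub>1 a\<^sub>2. counit A a\<^sub>2 \<odot>\<^bsub>CC\<^esub> counit A (antipode A a\<^sub>1))"
    by (simp add: mult.commute)
  also have "\<dots> = counit A (antipode A a)"
    by (rule counit_right_bsum) (use a in simp_all)
  finally show ?thesis by simp
qed

text \<open>Uniqueness of convolution inverses: both sides invert the multiplication as a map on
  \<open>A \<otimes> A\<close>. Concretely, the sum of \<open>S(a\<^sub>1 b\<^sub>1) a\<^sub>2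
  b\<^sub>2 S(b\<^sub>3) S(a\<^sub>3)\<close> is evaluated twice. Cancelling from the right leaves
  \<open>S(ab)\<close>, cancelling \<open>S(a\<^sub>1 b\<^sub>1) a\<^sub>2 b\<^sub>2\<close> first
  leaves \<open>S(b) S(a)\<close>.\<close>

lemma antipode_mult:
  assumes a: "a \<in> carrier A" and b: "b \<in> carrier A"
  shows "antipode A (a \<otimes> b) = antipode A b \<otimes> antipode A a"
proof -
  note [simp] = hopf_rules tens_rules m_assoc
  let ?S = "antipode A" and ?e = "counit A"
  let ?F = "\<lambda>a\<^sub>1 a\<^sub>2 a\<^sub>3 b\<^sub>1 b\<^sub>2 b\<^sub>3. ?S (a\<^sub>1 \<otimes> b\<^sub>1) \<otimes> (a\<^sub>2 \<otimes> (b\<^sub>2 \<otimes> (?S b\<^sub>3 \<otimes> ?S a\<^sub>3)))"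
  let ?T = "sw A a (\<lambda>a\<^sub>1 x. sw A x (\<lambda>a\<^sub>2 a\<^sub>3. sw A b (\<lambda>b\<^sub>1 y. sw A y (\<lambda>b\<^sub>2 b\<^sub>3. ?F a\<^sub>1 a\<^sub>2 a\<^sub>3 b\<^sub>1 b\<^sub>2 b\<^sub>3))))"
  have 1: "sw A y (\<lambda>b\<^sub>2 b\<^sub>3. u \<otimes> (v \<otimes> (b\<^sub>2 \<otimes> (?S b\<^sub>3 \<otimes> w)))) = ?e y \<odot> (u \<otimes> (v \<otimes> w))"
    if "u \<in> carrier A" "v \<in> carrier A" "w \<in> carrier A" "y \<in> carrier A" for u v w y
    using antipode_right_bsum'[of A "\<lambda>z. u \<otimes> (v \<otimes> z)" y w] that by simp
  have 2: "sw A b (\<lambda>b\<^sub>1 y. ?e y \<odot> (?S (u \<otimes> b\<^sub>1) \<otimes> v)) = ?S (u \<otimes> b) \<otimes> v"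
    if "u \<in> carrier A" "v \<in> carrier A" for u v
    using counit_right_bsum[of A "\<lambda>y. ?S (u \<otimes> y) \<otimes> v" b] that b by simp
  have 3: "sw A x (\<lambda>a\<^sub>2 a\<^sub>3. u \<otimes> (a\<^sub>2 \<otimes> ?S a\<^sub>3)) = ?e x \<odot> u" if "u \<in> carrier A" "x \<in> carrier A" for u x
    using antipode_right_bsum[of A "\<lambda>w. u \<otimes> w" x] that by simp
  have "?T = ?S (a \<otimes> b)"
    using counit_right_bsum[of A "\<lambda>y. ?S (y \<otimes> b)" a] a b by (simp add: 1 2 3)
  moreover have "sw A a (\<lambda>x a\<^sub>3. sw A x (\<lambda>a\<^sub>1 a\<^sub>2. sw A b (\<lambda>y b\<^sub>3. sw A y (\<lambda>b\<^sub>1 b\<^sub>2. ?F a\<^sub>1 a\<^sub>2 a\<^sub>3 b\<^sub>1 b\<^sub>2 b\<^sub>3)))) = ?T"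
    using a b by (simp add: coassoc_bsum)
  \<comment> \<open>The coproducts of \<open>x\<close> and \<open>y\<close> are brought next to each
    other, where together they form the coproduct of the product of \<open>x\<close> and
    \<open>y\<close>; the antipode axiom is then applied to that product.\<close>
  moreover have "sw A a (\<lambda>x a\<^sub>3. sw A x (\<lambda>a\<^sub>1 a\<^sub>2. sw A b (\<lambda>y b\<^sub>3. sw A y (\<lambda>b\<^sub>1 b\<^sub>2. ?F a\<^sub>1 a\<^sub>2 a\<^sub>3 b\<^sub>1 b\<^sub>2 b\<^sub>3))))
      = sw A a (\<lambda>x a\<^sub>3. sw A b (\<lambda>y b\<^sub>3. sw A x (\<lambda>a\<^sub>1 a\<^sub>2. sw A y (\<lambda>b\<^sub>1 b\<^sub>2. ?F a\<^sub>1 a\<^sub>2 a\<^sub>3 b\<^sub>1 b\<^sub>2 b\<^sub>3))))"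
    using a b by (intro bsum_cong refl bsum_swap) simp_all
  moreover have "sw A x (\<lambda>a\<^sub>1 a\<^sub>2. sw A y (\<lambda>b\<^sub>1 b\<^sub>2. ?F a\<^sub>1 a\<^sub>2 a\<^sub>3 b\<^sub>1 b\<^sub>2 b\<^sub>3)) = ?e x \<odot> (?e y \<odot> (?S b\<^sub>3 \<otimes> ?S a\<^sub>3))"
    if "x \<in> carrier A" "y \<in> carrier A" "a\<^sub>3 \<in> carrier A" "b\<^sub>3 \<in> carrier A" for x y a\<^sub>3 b\<^sub>3
    using antipode_left_bsum[of A "\<lambda>w. w \<otimes> (?S b\<^sub>3 \<otimes> ?S a\<^sub>3)" "x \<otimes> y"] that
    by (simp add: comult_mult_bsum smult_smult)
  moreover have "sw A b (\<lambda>y b\<^sub>3. ?e y \<odot> (?S b\<^sub>3 \<otimes> u)) = ?S b \<otimes> u" if "u \<in> carrier A" for u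
    using counit_left_bsum[of A "\<lambda>y. ?S y \<otimes> u" b] that b by simp
  moreover have "sw A a (\<lambda>x a\<^sub>3. ?e x \<odot> (?S b \<otimes> ?S a\<^sub>3)) = ?S b \<otimes> ?S a"
    using counit_left_bsum[of A "\<lambda>y. ?S b \<otimes> ?S y" a] a b by simp
  ultimately show ?thesis using a b by simp
qed

text \<open>Both sides are convolution inverses of the comultiplication. The sum of
  \<open>\<Delta>(S(a\<^sub>1)) (a\<^sub>2 \<otimes> a\<^sub>3) (S(a\<^sub>5) \<otimes>
  S(a\<^sub>4))\<close> is evaluated twice. Cancelling \<open>a\<^sub>3 S(a\<^sub>4)\<close> and
  then the two factors around it leaves \<open>\<Delta>(S(a))\<close>; reading
  \<open>a\<^sub>2 \<otimes> a\<^sub>3\<close> as a coproduct and using multiplicativity of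
  \<open>\<Delta>\<close> cancels the left part and leaves the right side.\<close>

lemma comult_antipode:
  assumes a: "a \<in> carrier A"
  shows "comult A (antipode A a) = sw (A \<boxtimes> A) a (\<lambda>a\<^sub>1 a\<^sub>2. pure A A (antipode A a\<^sub>2) (antipode A a\<^sub>1))"
proof -
  note [simp] = hopf_rules tens_rules m_assoc
  let ?S = "antipode A" and ?e = "counit A" and ?Y = "A \<boxtimes> A"
  let ?F = "\<lambda>a\<^sub>1 a\<^sub>2 a\<^sub>3 a\<^sub>4 a\<^sub>5. bsum A A ?Y (comult A (?S a\<^sub>1)) (\<lambda>d e.
    pure A A (d \<otimes> (a\<^sub>2 \<otimes> ?S a\<^sub>5)) (e \<otimes> (a\<^sub>3 \<otimes> ?S a\<^sub>4)))"
  let ?E = "sw ?Y a (\<lambda>a\<^sub>1 x. sw ?Y x (\<lambda>a\<^sub>2 y. sw ?Y y (\<lambda>a\<^sub>3 z. sw ?Y z (\<lambda>a\<^sub>4 a\<^sub>5. ?F a\<^sub>1 a\<^sub>2 a\<^sub>3 a\<^sub>4 a\<^sub>5))))"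
  have "sw ?Y a (\<lambda>a\<^sub>1 x. sw ?Y x (\<lambda>a\<^sub>2 y. sw ?Y y (\<lambda>w a\<^sub>5. sw ?Y w (\<lambda>a\<^sub>3 a\<^sub>4. ?F a\<^sub>1 a\<^sub>2 a\<^sub>3 a\<^sub>4 a\<^sub>5)))) = ?E"
    using a by (simp add: coassoc_bsum)
  moreover have "sw ?Y w (\<lambda>a\<^sub>3 a\<^sub>4. ?F a\<^sub>1 a\<^sub>2 a\<^sub>3 a\<^sub>4 a\<^sub>5) =
     ?e w \<odot>\<^bsub>?Y\<^esub> (bsum A A ?Y (comult A (?S a\<^sub>1)) (\<lambda>d e. pure A A (d \<otimes> (a\<^sub>2 \<otimes> ?S a\<^sub>5)) e))"
    if "a\<^sub>1 \<in> carrier A" "a\<^sub>2 \<in> carrier A" "a\<^sub>5 \<in> carrier A" "w \<in> carrier A" for a\<^sub>1 a\<^sub>2 a\<^sub>5 w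
    using antipode_right_bsum[of ?Y "\<lambda>u. bsum A A ?Y (comult A (?S a\<^sub>1)) (\<lambda>d e.
      pure A A (d \<otimes> (a\<^sub>2 \<otimes> ?S a\<^sub>5)) (e \<otimes> u))" w] that by simp
  moreover have "sw ?Y y (\<lambda>w a\<^sub>5. ?e w \<odot>\<^bsub>?Y\<^esub> (bsum A A ?Y (comult A (?S a\<^sub>1)) (\<lambda>d e. pure A A (d \<otimes> (a\<^sub>2 \<otimes> ?S a\<^sub>5)) e)))
     = bsum A A ?Y (comult A (?S a\<^sub>1)) (\<lambda>d e. pure A A (d \<otimes> (a\<^sub>2 \<otimes> ?S y)) e)"
    if "a\<^sub>1 \<in> carrier A" "a\<^sub>2 \<in> carrier A" "y \<in> carrier A" for a\<^sub>1 a\<^sub>2 y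
    by (rule counit_left_bsum) (use that in simp_all)
  moreover have "sw ?Y x (\<lambda>a\<^sub>2 y. bsum A A ?Y (comult A (?S a\<^sub>1)) (\<lambda>d e. pure A A (d \<otimes> (a\<^sub>2 \<otimes> ?S y)) e))
     = ?e x \<odot>\<^bsub>?Y\<^esub> comult A (?S a\<^sub>1)"
    if "a\<^sub>1 \<in> carrier A" "x \<in> carrier A" for a\<^sub>1 x
    using antipode_right_bsum[of ?Y "\<lambda>u. bsum A A ?Y (comult A (?S a\<^sub>1)) (\<lambda>d e.
      pure A A (d \<otimes> u) e)" x] that by simp
  moreover have "sw ?Y a (\<lambda>a\<^sub>1 x. ?e x \<odot>\<^bsub>?Y\<^esub> comult A (?S a\<^sub>1)) = comult A (?S a)"
    by (rule counit_right_bsum) (use a in simp_all)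
  ultimately have E1: "?E = comult A (?S a)" by simp
  \<comment> \<open>\<open>sw1\<close> and \<open>sw2\<close> move the coproduct of
    \<open>S(a\<^sub>1)\<close> outward, into the order in which multiplicativity expands the
    coproduct of \<open>S(a\<^sub>1) w\<close>.\<close>
  have sw1: "sw ?Y z (\<lambda>a\<^sub>4 a\<^sub>5. ?F a\<^sub>1 a\<^sub>2 a\<^sub>3 a\<^sub>4 a\<^sub>5) = bsum A A ?Y (comult A (?S a\<^sub>1)) (\<lambda>d e.
      sw ?Y z (\<lambda>a\<^sub>4 a\<^sub>5. pure A A (d \<otimes> (a\<^sub>2 \<otimes> ?S a\<^sub>5)) (e \<otimes> (a\<^sub>3 \<otimes> ?S a\<^sub>4))))"
    if "a\<^sub>1 \<in> carrier A" "a\<^sub>2 \<in> carrier A" "a\<^sub>3 \<in> carrier A" for a\<^sub>1 a\<^sub>2 a\<^sub>3 z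
    by (rule bsum_swap) (use that in simp_all)
  have sw2: "sw ?Y w (\<lambda>a\<^sub>2 a\<^sub>3. bsum A A ?Y (comult A (?S a\<^sub>1)) (\<lambda>d e.
      sw ?Y z (\<lambda>a\<^sub>4 a\<^sub>5. pure A A (d \<otimes> (a\<^sub>2 \<otimes> ?S a\<^sub>5)) (e \<otimes> (a\<^sub>3 \<otimes> ?S a\<^sub>4))))) =
    bsum A A ?Y (comult A (?S a\<^sub>1)) (\<lambda>d e. sw ?Y w (\<lambda>a\<^sub>2 a\<^sub>3.
      sw ?Y z (\<lambda>a\<^sub>4 a\<^sub>5. pure A A (d \<otimes> (a\<^sub>2 \<otimes> ?S a\<^sub>5)) (e \<otimes> (a\<^sub>3 \<otimes> ?S a\<^sub>4)))))"
    if "a\<^sub>1 \<in> carrier A" for a\<^sub>1 w z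
    by (rule bsum_swap) (use that in simp_all)
  have "sw ?Y a (\<lambda>v z. sw ?Y v (\<lambda>a\<^sub>1 w. sw ?Y w (\<lambda>a\<^sub>2 a\<^sub>3. sw ?Y z (\<lambda>a\<^sub>4 a\<^sub>5. ?F a\<^sub>1 a\<^sub>2 a\<^sub>3 a\<^sub>4 a\<^sub>5)))) = ?E"
    using a by (simp add: coassoc_bsum)
  moreover have "sw ?Y a (\<lambda>v z. sw ?Y v (\<lambda>a\<^sub>1 w. sw ?Y w (\<lambda>a\<^sub>2 a\<^sub>3. sw ?Y z (\<lambda>a\<^sub>4 a\<^sub>5. ?F a\<^sub>1 a\<^sub>2 a\<^sub>3 a\<^sub>4 a\<^sub>5))))
    = sw ?Y a (\<lambda>v z. sw ?Y v (\<lambda>a\<^sub>1 w. bsum A A ?Y (comult A (?S a\<^sub>1)) (\<lambda>d e. sw ?Y w (\<lambda>a\<^sub>2 a\<^sub>3.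
       sw ?Y z (\<lambda>a\<^sub>4 a\<^sub>5. pure A A (d \<otimes> (a\<^sub>2 \<otimes> ?S a\<^sub>5)) (e \<otimes> (a\<^sub>3 \<otimes> ?S a\<^sub>4)))))))"
    using a by (simp add: sw1 sw2)
  moreover have "sw ?Y v (\<lambda>a\<^sub>1 w. bsum A A ?Y (comult A (?S a\<^sub>1)) (\<lambda>d e. sw ?Y w (\<lambda>a\<^sub>2 a\<^sub>3.
       sw ?Y z (\<lambda>a\<^sub>4 a\<^sub>5. pure A A (d \<otimes> (a\<^sub>2 \<otimes> ?S a\<^sub>5)) (e \<otimes> (a\<^sub>3 \<otimes> ?S a\<^sub>4))))))
     = ?e v \<odot>\<^bsub>?Y\<^esub> sw ?Y z (\<lambda>a\<^sub>4 a\<^sub>5. pure A A (?S a\<^sub>5) (?S a\<^sub>4))" if "v \<in> carrier A" "z \<in> carrier A" for v z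
    using antipode_left_bsum[of ?Y "\<lambda>y. bsum A A ?Y (comult A y) (\<lambda>d e. sw ?Y z (\<lambda>a\<^sub>4 a\<^sub>5. pure A A (d \<otimes> ?S a\<^sub>5) (e \<otimes> ?S a\<^sub>4)))" v] that
    by (simp add: comult_mult_bsum comult_one)
  moreover have "sw ?Y a (\<lambda>v z. ?e v \<odot>\<^bsub>?Y\<^esub> sw ?Y z (\<lambda>a\<^sub>4 a\<^sub>5. pure A A (?S a\<^sub>5) (?S a\<^sub>4)))
     = sw ?Y a (\<lambda>a\<^sub>4 a\<^sub>5. pure A A (?S a\<^sub>5) (?S a\<^sub>4))"
    by (rule counit_left_bsum) (use a in simp_all)
  ultimately have E2: "?E = sw ?Y a (\<lambda>a\<^sub>4 a\<^sub>5. pure A A (?S a\<^sub>5) (?S a\<^sub>4))" by simp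
  from E1 E2 show ?thesis by simp
qed

text \<open>The cancellation is immediate when the first two legs come from one coproduct; the
  right-nested form is stated because that is what the normal form produces in
  \<open>yd_quot\<close>.\<close>

lemma antipode_right_absorb:
  assumes K: "bilin A A X K" and a: "a \<in> carrier A"
  shows "sw X a (\<lambda>a\<^sub>1 x. sw X x (\<lambda>a\<^sub>2 a\<^sub>3. K (a\<^sub>1 \<otimes> antipode A a\<^sub>2) a\<^sub>3)) = K \<one> a"
proof -
  note [simp] = hopf_rules tens_rules bilin_rules[OF K]
  have "sw X a (\<lambda>x a\<^sub>3. sw X x (\<lambda>a\<^sub>1 a\<^sub>2. K (a\<^sub>1 \<otimes> antipode A a\<^sub>2) a\<^sub>3)) = K \<one> a"
    using a antipode_right_bsum[of X "\<lambda>w. K w _"] counit_left_bsum[of X "K \<one>" a] by simp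
  then show ?thesis using a by (simp add: coassoc_bsum)
qed

end

section \<open>Actions and coactions in Sweedler form\<close>

context hopf_algebra
begin

lemma left_actionD:
  assumes "left_action A V act" "module CC V"
  shows "bilin A V V act" "v \<in> carrier V \<Longrightarrow> act \<one> v = v"
    "a \<in> carrier A \<Longrightarrow> b \<in> carrier A \<Longrightarrow> v \<in> carrier V \<Longrightarrow> act (a \<otimes> b) v = act a (act b v)"
  using assms by (auto simp: left_action_def bilin_def module_A)

lemma right_actionD:
  assumes "right_action A V act" "module CC V"
  shows "bilin V A V act" "v \<in> carrier V \<Longrightarrow> act v \<one> = v"
    "a \<in> carrier A \<Longrightarrow> b \<in> carrier A \<Longrightarrow> v \<in> carrier V \<Longrightarrow> act v (a \<otimes> b) = act (act v a) b"
  using assms by (auto simp: right_action_def bilin_def module_A)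

lemma bilin_counit_left: "module CC V \<Longrightarrow> bilin A V V (\<lambda>a v. counit A a \<odot>\<^bsub>V\<^esub> v)"
  by (intro bilinI) (simp_all add: hopf_rules tens_rules)

lemma bilin_counit_right: "module CC V \<Longrightarrow> bilin V A V (\<lambda>v a. counit A a \<odot>\<^bsub>V\<^esub> v)"
  by (intro bilinI) (simp_all add: hopf_rules tens_rules)

text \<open>Coassociativity appears here only for the universal trilinear map built from
  \<open>pure\<close>, the form that is convenient to verify; \<open>left_coaction_assoc\<close>
  yields it for every trilinear map. The case split is on linearity of \<open>co\<close>, without
  which the sums cannot be translated.\<close>

lemma left_coaction_iff:
  assumes V: "module CC V"
  shows "left_coaction A V co \<longleftrightarrow> lin V (A \<boxtimes> V) co \<and>
    (\<forall>v\<in>carrier V. bsum A V V (co v) (\<lambda>a w. counit A a \<odot>\<^bsub>V\<^esub> w) = v) \<and>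
    (\<forall>v\<in>carrier V. bsum A V (A \<boxtimes> A \<boxtimes> V) (co v) (\<lambda>x w.
        bsum A A (A \<boxtimes> A \<boxtimes> V) (comult A x) (\<lambda>a b. pure A (A \<boxtimes> V) a (pure A V b w))) =
      bsum A V (A \<boxtimes> A \<boxtimes> V) (co v) (\<lambda>a w.
        bsum A V (A \<boxtimes> A \<boxtimes> V) (co w) (\<lambda>b u. pure A (A \<boxtimes> V) a (pure A V b u))))"
proof (cases "linear_map V (A \<boxtimes> V) co")
  case True
  then have co: "lin V (A \<boxtimes> V) co" by (simp add: lin_def V tensor_module module_A)
  show ?thesis
    using True lin_rules[OF co] tsum_bsum[OF bilin_counit_left[OF V]]
      tassoc_bsum[OF module_A module_A V lin_comult] tmap_id_bsum[OF module_A module_A V co]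
    unfolding left_coaction_def by simp
qed (auto simp: left_coaction_def lin_def)

lemma left_coaction_assoc:
  assumes co: "left_coaction A V co" "module CC V" and b: "trilin A A V X b" and v: "v \<in> carrier V"
  shows "bsum A V X (co v) (\<lambda>x w. bsum A A X (comult A x) (\<lambda>a a'. b a a' w)) =
    bsum A V X (co v) (\<lambda>a w. bsum A V X (co w) (\<lambda>a' u. b a a' u))"
proof -
  have "lin V (A \<boxtimes> V) co" using co left_coaction_iff by auto
  from bsum_assoc[OF module_A module_A co(2) lin_comult _ this _ _ b, of "co v" "co v"] show ?thesis
    using co(1) lin_rules[OF \<open>lin V (A \<boxtimes> V) co\<close>] v by (auto simp: left_coaction_def)
qed

lemma right_coaction_iff:
  assumes V: "module CC V"
  shows "right_coaction A V co \<longleftrightarrow> lin V (V \<boxtimes> A) co \<and>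
    (\<forall>v\<in>carrier V. bsum V A V (co v) (\<lambda>w a. counit A a \<odot>\<^bsub>V\<^esub> w) = v) \<and>
    (\<forall>v\<in>carrier V. bsum V A (V \<boxtimes> A \<boxtimes> A) (co v) (\<lambda>w b.
        bsum V A (V \<boxtimes> A \<boxtimes> A) (co w) (\<lambda>u a. pure V (A \<boxtimes> A) u (pure A A a b))) =
      bsum V A (V \<boxtimes> A \<boxtimes> A) (co v) (\<lambda>w x.
        bsum A A (V \<boxtimes> A \<boxtimes> A) (comult A x) (\<lambda>a b. pure V (A \<boxtimes> A) w (pure A A a b))))"
proof (cases "linear_map V (V \<boxtimes> A) co")
  case True
  then have co: "lin V (V \<boxtimes> A) co" by (simp add: lin_def V tensor_module module_A)
  show ?thesis
    using True lin_rules[OF co] tsum_bsum[OF bilin_counit_right[OF V]]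
      tassoc_bsum[OF V module_A module_A co] tmap_id_bsum[OF V module_A module_A lin_comult]
    unfolding right_coaction_def by simp
qed (auto simp: right_coaction_def lin_def)

lemma right_coaction_assoc:
  assumes co: "right_coaction A V co" "module CC V" and b: "trilin V A A X b" and v: "v \<in> carrier V"
  shows "bsum V A X (co v) (\<lambda>w a'. bsum V A X (co w) (\<lambda>u a. b u a a')) =
    bsum V A X (co v) (\<lambda>w x. bsum A A X (comult A x) (\<lambda>a a'. b w a a'))"
proof -
  have "lin V (V \<boxtimes> A) co" using co right_coaction_iff by auto
  from bsum_assoc[OF co(2) module_A module_A this _ lin_comult _ _ b, of "co v" "co v"] show ?thesis
    using co(1) lin_rules[OF \<open>lin V (V \<boxtimes> A) co\<close>] v by (auto simp: right_coaction_def)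
qed

lemma left_coaction_counit:
  assumes co: "left_coaction A V co" "module CC V" and g: "lin V X g" and v: "v \<in> carrier V"
  shows "bsum A V X (co v) (\<lambda>a w. counit A a \<odot>\<^bsub>X\<^esub> g w) = g v"
proof -
  note [simp] = hopf_rules tens_rules lin_rules[OF g]
  have "bsum A V V (co v) (\<lambda>a w. counit A a \<odot>\<^bsub>V\<^esub> w) = v" using co v left_coaction_iff by blast
  from arg_cong[OF this, of g] show ?thesis by simp
qed

lemma right_coaction_counit:
  assumes co: "right_coaction A V co" "module CC V" and g: "lin V X g" and v: "v \<in> carrier V"
  shows "bsum V A X (co v) (\<lambda>w a. counit A a \<odot>\<^bsub>X\<^esub> g w) = g v"
proof -
  note [simp] = hopf_rules tens_rules lin_rules[OF g]
  have "bsum V A V (co v) (\<lambda>w a. counit A a \<odot>\<^bsub>V\<^esub> w) = v" using co v right_coaction_iff by blast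
  from arg_cong[OF this, of g] show ?thesis by simp
qed

end

section \<open>The map \<open>p\<close> of Hopf algebras\<close>

locale hopf_hom = A: hopf_algebra A + H: hopf_algebra H
  for A :: "'a hopf" and H :: "'h hopf" + fixes p :: "'a \<Rightarrow> 'h"
  assumes hopf_map: "hopf_map A H p"
begin

lemma lin_p: "lin A H p"
  using hopf_map by (simp add: hopf_map_def lin_def A.module_A H.module_A)

lemma p_mult: "a \<in> carrier A \<Longrightarrow> b \<in> carrier A \<Longrightarrow> p (a \<otimes>\<^bsub>A\<^esub> b) = p a \<otimes>\<^bsub>H\<^esub> p b"
  and p_one: "p \<one>\<^bsub>A\<^esub> = \<one>\<^bsub>H\<^esub>"
  and counit_p: "a \<in> carrier A \<Longrightarrow> counit H (p a) = counit A a"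
  using hopf_map by (auto simp: hopf_map_def)

lemma comult_p:
  "a \<in> carrier A \<Longrightarrow> comult H (p a) = bsum A A (H \<boxtimes> H) (comult A a) (\<lambda>a\<^sub>1 a\<^sub>2. pure H H (p a\<^sub>1) (p a\<^sub>2))"
  using hopf_map tmap_bsum[OF lin_p lin_p] lin_rules[OF A.lin_comult] by (auto simp: hopf_map_def)

lemmas hh_rules = A.hopf_rules H.hopf_rules tens_rules lin_rules[OF lin_p] p_mult p_one counit_p

lemma alg_coact_bsum:
  "a \<in> carrier A \<Longrightarrow> alg_coact A H p a = bsum A A (A \<boxtimes> H) (comult A a) (\<lambda>a\<^sub>1 a\<^sub>2. pure A H a\<^sub>1 (p a\<^sub>2))"
  using tmap_bsum[OF lin_id[OF A.module_A] lin_p] lin_rules[OF A.lin_comult]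
  by (simp add: alg_coact_def id_def)

lemma tsum_alg_coact:
  assumes "bilin A H X b" "a \<in> carrier A"
  shows "tsum X (alg_coact A H p a) b = bsum A A X (comult A a) (\<lambda>a\<^sub>1 a\<^sub>2. b a\<^sub>1 (p a\<^sub>2))"
  using assms tsum_bsum[OF assms(1), of "alg_coact A H p a"] bilin_rules[OF assms(1)]
  by (simp add: hh_rules alg_coact_bsum)

section \<open>Objects of the category of bicomodule bimodules\<close>

abbreviation "bm M \<equiv> bicomodule_bimodule A H p M"
abbreviation "lsum M X m b \<equiv> bsum A M X (lcoact M m) b"
abbreviation "rsum M X m b \<equiv> bsum M H X (rcoact M m) b"

context
  fixes M :: "('a, 'h, 'v) bi_data"
  assumes M: "bicomodule_bimodule A H p M"
begin

lemma bm_module: "module CC M"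
  using M by (simp add: bicomodule_bimodule_def)

lemma bm_left_action: "left_action A M (lact M)"
  and bm_right_action: "right_action A M (ract M)"
  and bm_left_coaction: "left_coaction A M (lcoact M)"
  and bm_right_coaction: "right_coaction H M (rcoact M)"
  and bm_commute: "a \<in> carrier A \<Longrightarrow> b \<in> carrier A \<Longrightarrow> f \<in> carrier M \<Longrightarrow>
    ract M (lact M a f) b = lact M a (ract M f b)"
  using M by (simp_all add: bicomodule_bimodule_def)

lemmas bilin_lact = A.left_actionD(1)[OF bm_left_action bm_module]
lemmas bm_lact = A.left_actionD(2,3)[OF bm_left_action bm_module]
lemmas bilin_ract = A.right_actionD(1)[OF bm_right_action bm_module]
lemmas bm_ract = A.right_actionD(2,3)[OF bm_right_action bm_module]

lemma lin_lcoact: "lin M (A \<boxtimes> M) (lcoact M)"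
  using bm_left_coaction A.left_coaction_iff[OF bm_module] by blast

lemma lin_rcoact: "lin M (M \<boxtimes> H) (rcoact M)"
  using bm_right_coaction H.right_coaction_iff[OF bm_module] by blast

lemma tsum_lcoact: "bilin A M X b \<Longrightarrow> f \<in> carrier M \<Longrightarrow> tsum X (lcoact M f) b = lsum M X f b"
  by (rule tsum_bsum) (use lin_rules[OF lin_lcoact] in auto)

lemma tsum_rcoact: "bilin M H X b \<Longrightarrow> f \<in> carrier M \<Longrightarrow> tsum X (rcoact M f) b = rsum M X f b"
  by (rule tsum_bsum) (use lin_rules[OF lin_rcoact] in auto)

lemmas bm_rules = bm_module bilin_rules[OF bilin_lact] bm_lact bilin_rules[OF bilin_ract] bm_ract
  lin_rules[OF lin_lcoact] lin_rules[OF lin_rcoact] tsum_lcoact tsum_rcoact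

lemmas bm_lassoc = A.left_coaction_assoc[OF bm_left_coaction bm_module]
lemmas bm_rassoc = H.right_coaction_assoc[OF bm_right_coaction bm_module]
lemmas bm_lcounit = A.left_coaction_counit[OF bm_left_coaction bm_module]
lemmas bm_rcounit = H.right_coaction_counit[OF bm_right_coaction bm_module]

text \<open>Oriented so that the left coaction ends up outside the right coaction.\<close>

lemma bm_bicomodule:
  assumes b: "trilin A M H X b" and f: "f \<in> carrier M"
  shows "rsum M X f (\<lambda>g h. lsum M X g (\<lambda>a u. b a u h)) = lsum M X f (\<lambda>a g. rsum M X g (\<lambda>u h. b a u h))"
  by (rule bsum_assoc[OF A.module_A bm_module H.module_A lin_lcoact _ lin_rcoact _ _ b])
    (use M f lin_rules[OF lin_lcoact] lin_rules[OF lin_rcoact] in \<open>auto simp: bicomodule_bimodule_def\<close>)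

lemma bm_lcoact_bimod:
  assumes "a \<in> carrier A" "b \<in> carrier A" "f \<in> carrier M"
  shows "lcoact M (ract M (lact M a f) b) = A.sw (A \<boxtimes> M) a (\<lambda>a\<^sub>1 a\<^sub>2. lsum M (A \<boxtimes> M) f (\<lambda>f\<^sub>1 f\<^sub>0.
    A.sw (A \<boxtimes> M) b (\<lambda>b\<^sub>1 b\<^sub>2. pure A M (a\<^sub>1 \<otimes>\<^bsub>A\<^esub> f\<^sub>1 \<otimes>\<^bsub>A\<^esub> b\<^sub>1) (ract M (lact M a\<^sub>2 f\<^sub>0) b\<^sub>2))))"
proof -
  have "lcoact M (ract M (lact M a f) b) =
      tsum (A \<boxtimes> M) (comult A a) (\<lambda>a\<^sub>1 a\<^sub>2. tsum (A \<boxtimes> M) (lcoact M f) (\<lambda>f\<^sub>1 f\<^sub>0.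
        tsum (A \<boxtimes> M) (comult A b) (\<lambda>b\<^sub>1 b\<^sub>2.
          pure A M (a\<^sub>1 \<otimes>\<^bsub>A\<^esub> f\<^sub>1 \<otimes>\<^bsub>A\<^esub> b\<^sub>1) (ract M (lact M a\<^sub>2 f\<^sub>0) b\<^sub>2))))"
    using M assms unfolding bicomodule_bimodule_def by blast
  then show ?thesis using assms by (simp add: hh_rules bm_rules)
qed

lemma bm_rcoact_bimod:
  assumes "a \<in> carrier A" "b \<in> carrier A" "f \<in> carrier M"
  shows "rcoact M (ract M (lact M a f) b) = A.sw (M \<boxtimes> H) a (\<lambda>a\<^sub>1 a\<^sub>2. rsum M (M \<boxtimes> H) f (\<lambda>f\<^sub>0 f\<^sub>1.
    A.sw (M \<boxtimes> H) b (\<lambda>b\<^sub>1 b\<^sub>2. pure M H (ract M (lact M a\<^sub>1 f\<^sub>0) b\<^sub>1) (p a\<^sub>2 \<otimes>\<^bsub>H\<^esub> f\<^sub>1 \<otimes>\<^bsub>H\<^esub> p b\<^sub>2))))"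
proof -
  have "rcoact M (ract M (lact M a f) b) =
      tsum (M \<boxtimes> H) (alg_coact A H p a) (\<lambda>a\<^sub>0 a\<^sub>1. tsum (M \<boxtimes> H) (rcoact M f) (\<lambda>f\<^sub>0 f\<^sub>1.
        tsum (M \<boxtimes> H) (alg_coact A H p b) (\<lambda>b\<^sub>0 b\<^sub>1.
          pure M H (ract M (lact M a\<^sub>0 f\<^sub>0) b\<^sub>0) (a\<^sub>1 \<otimes>\<^bsub>H\<^esub> f\<^sub>1 \<otimes>\<^bsub>H\<^esub> b\<^sub>1))))"
    using M assms unfolding bicomodule_bimodule_def by blast
  then show ?thesis using assms by (simp add: hh_rules bm_rules tsum_alg_coact)
qed

text \<open>The two-sided compatibility at \<open>b = 1\<close>, where the coproduct is
  \<open>1 \<otimes> 1\<close>. The other one-sided rules arise in the same way.\<close>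

lemma bm_lcoact_lact:
  assumes "a \<in> carrier A" "f \<in> carrier M"
  shows "lcoact M (lact M a f) = A.sw (A \<boxtimes> M) a (\<lambda>a\<^sub>1 a\<^sub>2. lsum M (A \<boxtimes> M) f (\<lambda>f\<^sub>1 f\<^sub>0.
    pure A M (a\<^sub>1 \<otimes>\<^bsub>A\<^esub> f\<^sub>1) (lact M a\<^sub>2 f\<^sub>0)))"
  using bm_lcoact_bimod[OF assms(1) A.one_closed assms(2)] assms by (simp add: hh_rules bm_rules A.comult_one)

lemma bm_lcoact_ract:
  assumes "b \<in> carrier A" "f \<in> carrier M"
  shows "lcoact M (ract M f b) = lsum M (A \<boxtimes> M) f (\<lambda>f\<^sub>1 f\<^sub>0. A.sw (A \<boxtimes> M) b (\<lambda>b\<^sub>1 b\<^sub>2.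
    pure A M (f\<^sub>1 \<otimes>\<^bsub>A\<^esub> b\<^sub>1) (ract M f\<^sub>0 b\<^sub>2)))"
  using bm_lcoact_bimod[OF A.one_closed assms] assms by (simp add: hh_rules bm_rules A.comult_one)

lemma bm_rcoact_lact:
  assumes "a \<in> carrier A" "f \<in> carrier M"
  shows "rcoact M (lact M a f) = A.sw (M \<boxtimes> H) a (\<lambda>a\<^sub>1 a\<^sub>2. rsum M (M \<boxtimes> H) f (\<lambda>f\<^sub>0 f\<^sub>1.
    pure M H (lact M a\<^sub>1 f\<^sub>0) (p a\<^sub>2 \<otimes>\<^bsub>H\<^esub> f\<^sub>1)))"
  using bm_rcoact_bimod[OF assms(1) A.one_closed assms(2)] assms by (simp add: hh_rules bm_rules A.comult_one)

lemma bm_rcoact_ract: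
  assumes "b \<in> carrier A" "f \<in> carrier M"
  shows "rcoact M (ract M f b) = rsum M (M \<boxtimes> H) f (\<lambda>f\<^sub>0 f\<^sub>1. A.sw (M \<boxtimes> H) b (\<lambda>b\<^sub>1 b\<^sub>2.
    pure M H (ract M f\<^sub>0 b\<^sub>1) (f\<^sub>1 \<otimes>\<^bsub>H\<^esub> p b\<^sub>2)))"
  using bm_rcoact_bimod[OF A.one_closed assms] assms by (simp add: hh_rules bm_rules A.comult_one)

end

text \<open>The one-sided compatibilities recover the two-sided ones: the rule for the right action
  is applied to \<open>lact M a f\<close>, then the rule for the left action. Hence each pair of an
  action and a coaction can be verified separately.\<close>

lemma bmI:
  assumes M: "module CC M" and la: "left_action A M (lact M)" and ra: "right_action A M (ract M)"
    and comm: "\<And>a b f. \<lbrakk>a \<in> carrier A; b \<in> carrier A; f \<in> carrier M\<rbrakk> \<Longrightarrow>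
      ract M (lact M a f) b = lact M a (ract M f b)"
    and lc: "left_coaction A M (lcoact M)" and rc: "right_coaction H M (rcoact M)"
    and bic: "\<And>f. f \<in> carrier M \<Longrightarrow>
      rsum M (A \<boxtimes> M \<boxtimes> H) f (\<lambda>g h. lsum M (A \<boxtimes> M \<boxtimes> H) g (\<lambda>a u. pure A (M \<boxtimes> H) a (pure M H u h))) =
      lsum M (A \<boxtimes> M \<boxtimes> H) f (\<lambda>a g. rsum M (A \<boxtimes> M \<boxtimes> H) g (\<lambda>u h. pure A (M \<boxtimes> H) a (pure M H u h)))"
    and ll: "\<And>a f. \<lbrakk>a \<in> carrier A; f \<in> carrier M\<rbrakk> \<Longrightarrow>
      lcoact M (lact M a f) = A.sw (A \<boxtimes> M) a (\<lambda>a\<^sub>1 a\<^sub>2. lsum M (A \<boxtimes> M) f (\<lambda>f\<^sub>1 f\<^sub>0.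
        pure A M (a\<^sub>1 \<otimes>\<^bsub>A\<^esub> f\<^sub>1) (lact M a\<^sub>2 f\<^sub>0)))"
    and lr: "\<And>b f. \<lbrakk>b \<in> carrier A; f \<in> carrier M\<rbrakk> \<Longrightarrow>
      lcoact M (ract M f b) = lsum M (A \<boxtimes> M) f (\<lambda>f\<^sub>1 f\<^sub>0. A.sw (A \<boxtimes> M) b (\<lambda>b\<^sub>1 b\<^sub>2.
        pure A M (f\<^sub>1 \<otimes>\<^bsub>A\<^esub> b\<^sub>1) (ract M f\<^sub>0 b\<^sub>2)))"
    and rl: "\<And>a f. \<lbrakk>a \<in> carrier A; f \<in> carrier M\<rbrakk> \<Longrightarrow>
      rcoact M (lact M a f) = A.sw (M \<boxtimes> H) a (\<lambda>a\<^sub>1 a\<^sub>2. rsum M (M \<boxtimes> H) f (\<lambda>f\<^sub>0 f\<^sub>1.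
        pure M H (lact M a\<^sub>1 f\<^sub>0) (p a\<^sub>2 \<otimes>\<^bsub>H\<^esub> f\<^sub>1)))"
    and rr: "\<And>b f. \<lbrakk>b \<in> carrier A; f \<in> carrier M\<rbrakk> \<Longrightarrow>
      rcoact M (ract M f b) = rsum M (M \<boxtimes> H) f (\<lambda>f\<^sub>0 f\<^sub>1. A.sw (M \<boxtimes> H) b (\<lambda>b\<^sub>1 b\<^sub>2.
        pure M H (ract M f\<^sub>0 b\<^sub>1) (f\<^sub>1 \<otimes>\<^bsub>H\<^esub> p b\<^sub>2)))"
  shows "bm M"
proof -
  have lcl: "lin M (A \<boxtimes> M) (lcoact M)" using lc A.left_coaction_iff[OF M] by blast
  have rcl: "lin M (M \<boxtimes> H) (rcoact M)" using rc H.right_coaction_iff[OF M] by blast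
  note R = hh_rules bilin_rules[OF A.left_actionD(1)[OF la M]] bilin_rules[OF A.right_actionD(1)[OF ra M]]
    lin_rules[OF lcl] lin_rules[OF rcl] tsum_alg_coact
    tsum_bsum[of A M _ _ "lcoact M _"] tsum_bsum[of M H _ _ "rcoact M _"]
  show ?thesis
    unfolding bicomodule_bimodule_def
  proof (intro conjI ballI)
    fix a b f assume abf: "a \<in> carrier A" "b \<in> carrier A" "f \<in> carrier M"
    show "ract M (lact M a f) b = lact M a (ract M f b)" by (rule comm) fact+
    show "lcoact M (ract M (lact M a f) b) =
      tsum (A \<boxtimes> M) (comult A a) (\<lambda>a\<^sub>1 a\<^sub>2. tsum (A \<boxtimes> M) (lcoact M f) (\<lambda>f\<^sub>1 f\<^sub>0.
        tsum (A \<boxtimes> M) (comult A b) (\<lambda>b\<^sub>1 b\<^sub>2.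
          pure A M (a\<^sub>1 \<otimes>\<^bsub>A\<^esub> f\<^sub>1 \<otimes>\<^bsub>A\<^esub> b\<^sub>1) (ract M (lact M a\<^sub>2 f\<^sub>0) b\<^sub>2))))"
      using abf by (simp add: R lr ll)
    show "rcoact M (ract M (lact M a f) b) =
      tsum (M \<boxtimes> H) (alg_coact A H p a) (\<lambda>a\<^sub>0 a\<^sub>1. tsum (M \<boxtimes> H) (rcoact M f) (\<lambda>f\<^sub>0 f\<^sub>1.
        tsum (M \<boxtimes> H) (alg_coact A H p b) (\<lambda>b\<^sub>0 b\<^sub>1.
          pure M H (ract M (lact M a\<^sub>0 f\<^sub>0) b\<^sub>0) (a\<^sub>1 \<otimes>\<^bsub>H\<^esub> f\<^sub>1 \<otimes>\<^bsub>H\<^esub> b\<^sub>1))))"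
      using abf by (simp add: R rr rl)
  next
    fix f assume f: "f \<in> carrier M"
    show "tassoc A M H (tmap (A \<boxtimes> M) H (lcoact M) id (rcoact M f)) =
        tmap A (M \<boxtimes> H) id (rcoact M) (lcoact M f)"
      using bic[OF f] f R tassoc_bsum[OF A.module_A M H.module_A lcl, of "rcoact M f"]
        tmap_id_bsum[OF A.module_A M H.module_A rcl, of "lcoact M f"] by simp
  qed (fact M la ra lc rc)+
qed

section \<open>Relative Yetter-Drinfeld modules\<close>

abbreviation "yd V \<equiv> yd_module A H p V"

context
  fixes V :: "('a, 'h, 'v) right_data"
  assumes V: "yd_module A H p V"
begin

lemma yd_module': "module CC V"
  and yd_right_action: "right_action A V (ract V)"
  and yd_right_coaction: "right_coaction H V (rcoact V)"
  using V by (simp_all add: yd_module_def)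

lemmas bilin_yd_ract = A.right_actionD(1)[OF yd_right_action yd_module']
lemmas yd_ract = A.right_actionD(2,3)[OF yd_right_action yd_module']

lemma lin_yd_rcoact: "lin V (V \<boxtimes> H) (rcoact V)"
  using yd_right_coaction H.right_coaction_iff[OF yd_module'] by blast

lemma tsum_yd_rcoact:
  "bilin V H X b \<Longrightarrow> f \<in> carrier V \<Longrightarrow> tsum X (rcoact V f) b = bsum V H X (rcoact V f) b"
  by (rule tsum_bsum) (use lin_rules[OF lin_yd_rcoact] in auto)

lemmas yd_rules = yd_module' bilin_rules[OF bilin_yd_ract] yd_ract lin_rules[OF lin_yd_rcoact] tsum_yd_rcoact
lemmas yd_rassoc = H.right_coaction_assoc[OF yd_right_coaction yd_module']
lemmas yd_rcounit = H.right_coaction_counit[OF yd_right_coaction yd_module']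

text \<open>An arbitrary bilinear \<open>b\<close> in place of \<open>pure\<close> allows the
  condition to be applied inside a larger expression, where further factors multiply the
  \<open>H\<close>-leg.\<close>

lemma yd_compat:
  assumes b: "bilin V H X b" and v: "v \<in> carrier V" "a \<in> carrier A"
  shows "bsum V H X (rcoact V v) (\<lambda>v\<^sub>0 v\<^sub>1. A.sw X a (\<lambda>a\<^sub>1 a\<^sub>2. b (ract V v\<^sub>0 a\<^sub>1) (v\<^sub>1 \<otimes>\<^bsub>H\<^esub> p a\<^sub>2))) =
    A.sw X a (\<lambda>a\<^sub>1 a\<^sub>2. bsum V H X (rcoact V (ract V v a\<^sub>2)) (\<lambda>w\<^sub>0 w\<^sub>1. b w\<^sub>0 (p a\<^sub>1 \<otimes>\<^bsub>H\<^esub> w\<^sub>1)))"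
proof -
  have "tsum (V \<boxtimes> H) (rcoact V v) (\<lambda>v\<^sub>0 v\<^sub>1. tsum (V \<boxtimes> H) (comult A a) (\<lambda>a\<^sub>1 a\<^sub>2.
        pure V H (ract V v\<^sub>0 a\<^sub>1) (v\<^sub>1 \<otimes>\<^bsub>H\<^esub> p a\<^sub>2))) =
      tsum (V \<boxtimes> H) (comult A a) (\<lambda>a\<^sub>1 a\<^sub>2. tsum (V \<boxtimes> H) (rcoact V (ract V v a\<^sub>2)) (\<lambda>w\<^sub>0 w\<^sub>1.
        pure V H w\<^sub>0 (p a\<^sub>1 \<otimes>\<^bsub>H\<^esub> w\<^sub>1)))"
    using V v unfolding yd_module_def by blast
  then have "bsum V H (V \<boxtimes> H) (rcoact V v) (\<lambda>v\<^sub>0 v\<^sub>1. A.sw (V \<boxtimes> H) a (\<lambda>a\<^sub>1 a\<^sub>2.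
      pure V H (ract V v\<^sub>0 a\<^sub>1) (v\<^sub>1 \<otimes>\<^bsub>H\<^esub> p a\<^sub>2))) =
    A.sw (V \<boxtimes> H) a (\<lambda>a\<^sub>1 a\<^sub>2. bsum V H (V \<boxtimes> H) (rcoact V (ract V v a\<^sub>2)) (\<lambda>w\<^sub>0 w\<^sub>1. pure V H w\<^sub>0 (p a\<^sub>1 \<otimes>\<^bsub>H\<^esub> w\<^sub>1)))"
    using v by (simp add: hh_rules yd_rules)
  from arg_cong[OF this, of "\<lambda>t. bsum V H X t b"] show ?thesis
    using v by (simp add: hh_rules yd_rules bilin_rules[OF b])
qed

end

lemma ydI:
  assumes V: "module CC V" and ra: "right_action A V (ract V)" and rc: "right_coaction H V (rcoact V)"
    and comp: "\<And>v a. v \<in> carrier V \<Longrightarrow> a \<in> carrier A \<Longrightarrow>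
      bsum V H (V \<boxtimes> H) (rcoact V v) (\<lambda>v\<^sub>0 v\<^sub>1. A.sw (V \<boxtimes> H) a (\<lambda>a\<^sub>1 a\<^sub>2.
        pure V H (ract V v\<^sub>0 a\<^sub>1) (v\<^sub>1 \<otimes>\<^bsub>H\<^esub> p a\<^sub>2))) =
      A.sw (V \<boxtimes> H) a (\<lambda>a\<^sub>1 a\<^sub>2. bsum V H (V \<boxtimes> H) (rcoact V (ract V v a\<^sub>2)) (\<lambda>w\<^sub>0 w\<^sub>1.
        pure V H w\<^sub>0 (p a\<^sub>1 \<otimes>\<^bsub>H\<^esub> w\<^sub>1)))"
  shows "yd V"
proof -
  have rcl: "lin V (V \<boxtimes> H) (rcoact V)" using rc H.right_coaction_iff[OF V] by blast
  note R = hh_rules bilin_rules[OF A.right_actionD(1)[OF ra V]] lin_rules[OF rcl]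
    tsum_bsum[of V H _ _ "rcoact V _"]
  show ?thesis
    unfolding yd_module_def
    by (intro conjI ballI V ra rc) (simp add: R comp)
qed

end

section \<open>Transport of structure\<close>

lemma module_minus:
  assumes "module CC V" "x \<in> carrier V" shows "\<ominus>\<^bsub>V\<^esub> x = (-1) \<odot>\<^bsub>V\<^esub> x"
proof -
  interpret module CC V by fact
  have "(-1) \<odot>\<^bsub>V\<^esub> x \<oplus>\<^bsub>V\<^esub> x = \<zero>\<^bsub>V\<^esub>"
    using smult_l_distr[of "-1" 1 x] smult_one[of x] smult_l_null[of x] assms(2) by simp
  then show ?thesis using M.minus_equality assms by (simp add: module_smult_closed)
qed

text \<open>Each module axiom passes along a surjection that respects the operations. Both
  constructions become vector spaces in this way, \<open>A \<otimes> V\<close> along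
  \<open>encode\<close> and \<open>M / A^+M\<close> along \<open>cls\<close>.\<close>

lemma module_image:
  assumes M: "module CC M" and car: "carrier U = f ` carrier M"
    and add: "\<And>x y. x \<in> carrier M \<Longrightarrow> y \<in> carrier M \<Longrightarrow> f (x \<oplus>\<^bsub>M\<^esub> y) = f x \<oplus>\<^bsub>U\<^esub> f y"
    and smult: "\<And>c x. x \<in> carrier M \<Longrightarrow> f (c \<odot>\<^bsub>M\<^esub> x) = c \<odot>\<^bsub>U\<^esub> f x"
    and zero: "f \<zero>\<^bsub>M\<^esub> = \<zero>\<^bsub>U\<^esub>"
  shows "lin M U f"
proof -
  interpret module CC M by fact
  have "module CC U"
  proof (intro moduleI abelian_groupI is_cring)
    fix x assume "x \<in> carrier U"
    then obtain m where m: "m \<in> carrier M" "x = f m" by (auto simp: car)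
    show "\<exists>y\<in>carrier U. y \<oplus>\<^bsub>U\<^esub> x = \<zero>\<^bsub>U\<^esub>"
      using m add[of "\<ominus>\<^bsub>M\<^esub> m" m] zero by (intro bexI[of _ "f (\<ominus>\<^bsub>M\<^esub> m)"]) (auto simp: car l_neg)
  qed (auto simp: car add[symmetric] smult[symmetric] zero[symmetric] M.a_ac smult_l_distr[of _ _ , simplified]
      smult_r_distr[simplified] smult_assoc1[simplified] smult_one[simplified] module_smult_closed[OF M])
  then show ?thesis by (intro linI) (auto simp: M car add smult)
qed

text \<open>\<open>free_obj\<close> and \<open>quot_obj\<close> copy the spaces
  \<open>utensor\<close> and \<open>quot_space\<close> into larger records, so the two cannot be
  compared by equality. Tensor products, \<open>pure\<close> and \<open>tsum\<close> depend only on
  the fields listed here, which allows one record to replace the other.\<close>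

definition same_space :: "(complex, 'v, 'm) module_scheme \<Rightarrow> (complex, 'v, 'n) module_scheme \<Rightarrow> bool"
  where "same_space V V' \<longleftrightarrow> carrier V = carrier V' \<and> \<zero>\<^bsub>V\<^esub> = \<zero>\<^bsub>V'\<^esub> \<and> add V = add V' \<and> smult V = smult V'"

lemma same_space_sym: "same_space V V' \<Longrightarrow> same_space V' V"
  by (simp add: same_space_def)

lemma tensor_rel_same_spaceD:
  assumes "(l, m) \<in> tensor_rel V W" "same_space V V'" "same_space W W'"
  shows "(l, m) \<in> tensor_rel V' W'"
  using assms
proof (induction rule: tensor_rel.induct)
  case zero then show ?case using tensor_rel.zero[of _ W' V'] by (simp add: same_space_def)
next
  case add_left then show ?case using tensor_rel.add_left[of _ V' _ _ W'] by (simp add: same_space_def)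
next
  case add_right then show ?case using tensor_rel.add_right[of _ V' _ W'] by (simp add: same_space_def)
next
  case balance then show ?case using tensor_rel.balance[of _ V' _ W'] by (simp add: same_space_def)
next
  case refl then show ?case using tensor_rel.refl[of _ V' W'] by (simp add: same_space_def)
next
  case commute then show ?case using tensor_rel.commute[of _ V' W'] by (simp add: same_space_def)
qed (auto intro: tensor_rel.sym tensor_rel.append tensor_rel.trans)

lemma tensor_rel_same_space:
  assumes "same_space V V'" "same_space W W'"
  shows "tensor_rel V W = tensor_rel V' W'"
  using tensor_rel_same_spaceD[OF _ assms] tensor_rel_same_spaceD[OF _ assms[THEN same_space_sym]] by auto

lemma tensor_same_space:
  "same_space V V' \<Longrightarrow> V \<boxtimes> W = V' \<boxtimes> W" "same_space W W' \<Longrightarrow> V \<boxtimes> W = V \<boxtimes> W'"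
proof -
  assume V: "same_space V V'"
  have "same_space W W" by (simp add: same_space_def)
  from tensor_rel_same_space[OF V this] V show "V \<boxtimes> W = V' \<boxtimes> W" by (simp add: tensor_def same_space_def)
next
  assume W: "same_space W W'"
  have "same_space V V" by (simp add: same_space_def)
  from tensor_rel_same_space[OF this W] W show "V \<boxtimes> W = V \<boxtimes> W'" by (simp add: tensor_def same_space_def)
qed

lemma pure_same_space:
  "same_space V V' \<Longrightarrow> pure V W = pure V' W" "same_space W W' \<Longrightarrow> pure V W = pure V W'"
  using tensor_rel_same_space[of V V' W W] tensor_rel_same_space[of V V W W']
  by (auto simp: pure_def same_space_def fun_eq_iff)

lemma tsum_same_space: "same_space V V' \<Longrightarrow> tsum V = tsum V'"
  by (simp add: tsum_def formal_sum_def same_space_def fun_eq_iff)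

lemmas same_space_simps = tensor_same_space pure_same_space tsum_same_space

context hopf_hom
begin

section \<open>The object \<open>A \<otimes> V\<close>\<close>

abbreviation "fr V \<equiv> free_obj A H p V"
abbreviation "qt M \<equiv> quot_obj A H p M"

lemma free_same_space: "same_space (utensor A V) (fr V)"
  by (simp add: same_space_def free_obj_def Let_def)

context
  fixes V :: "('a, 'h, ('a, 'x) univ) right_data"
  assumes V: "module CC V"
begin

text \<open>The encoded list is an element of its own class, and distinct equivalence classes are
  disjoint, so the list determines the class.\<close>

lemma inj_encode: "inj_on encode (carrier (A \<boxtimes> V))"
proof (rule inj_onI)
  fix s t assume st: "s \<in> carrier (A \<boxtimes> V)" "t \<in> carrier (A \<boxtimes> V)" and eq: "encode s = encode t"
  note E = equiv_tensor_rel[OF A.module_A V]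
  have ne: "(SOME l. l \<in> r) \<in> r" if "r \<in> carrier (A \<boxtimes> V)" for r
  proof -
    from that obtain l where "l \<in> lists (carrier A \<times> carrier V)" "r = tensor_rel A V `` {l}"
      by (rule tensor_carrierE)
    then have "l \<in> r" using tensor_rel.refl by auto
    then show ?thesis by (rule someI)
  qed
  have "(SOME l. l \<in> s) \<in> s \<inter> t"
    using ne[OF st(1)] ne[OF st(2)] eq by (simp add: encode_def)
  then show "s = t"
    using quotient_disj[OF E] st by (auto simp: tensor_def)
qed

lemma decode_encode: "t \<in> carrier (A \<boxtimes> V) \<Longrightarrow> decode A V (encode t) = t"
  by (simp add: decode_def inj_encode)

lemma carrier_free: "carrier (fr V) = encode ` carrier (A \<boxtimes> V)"
  by (simp add: free_obj_def utensor_def Let_def)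

lemma lin_encode: "lin (A \<boxtimes> V) (fr V) encode"
  by (rule module_image)
    (auto simp: free_obj_def utensor_def Let_def decode_encode hh_rules V tensor_module)

lemma lin_decode: "lin (fr V) (A \<boxtimes> V) (decode A V)"
proof -
  note [simp] = hh_rules V linD(1-3)[OF lin_encode]
  have "decode A V (x \<oplus>\<^bsub>fr V\<^esub> y) = decode A V x \<oplus>\<^bsub>A \<boxtimes> V\<^esub> decode A V y" if "x \<in> carrier (fr V)" "y \<in> carrier (fr V)" for x y
    using that by (auto simp: carrier_free decode_encode linD(4)[OF lin_encode, symmetric] module_add_closed)
  moreover have "decode A V (c \<odot>\<^bsub>fr V\<^esub> x) = c \<odot>\<^bsub>A \<boxtimes> V\<^esub> decode A V x" if "x \<in> carrier (fr V)" for c x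
    using that by (auto simp: carrier_free decode_encode linD(5)[OF lin_encode, symmetric])
  ultimately show ?thesis
    by (intro linI) (auto simp: carrier_free decode_encode)
qed

lemma bilin_upure: "bilin A V (fr V) (upure A V)"
  unfolding upure_def by (intro bilinI) (simp_all add: hh_rules V lin_rules[OF lin_encode])

lemma decode_upure: "a \<in> carrier A \<Longrightarrow> v \<in> carrier V \<Longrightarrow> decode A V (upure A V a v) = pure A V a v"
  by (simp add: upure_def decode_encode pure_closed)

lemma tsum_decode: "bilin A V X b \<Longrightarrow> x \<in> carrier (fr V) \<Longrightarrow> tsum X (decode A V x) b = bsum A V X (decode A V x) b"
  by (rule tsum_bsum) (use lin_rules[OF lin_decode] in auto)

lemmas free_rules = hh_rules V bilin_rules[OF bilin_upure] lin_rules[OF lin_decode] decode_upure tsum_decode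

lemma free_ext:
  assumes f: "lin (fr V) X f" and g: "lin (fr V) X g"
    and eq: "\<And>a v. a \<in> carrier A \<Longrightarrow> v \<in> carrier V \<Longrightarrow> f (upure A V a v) = g (upure A V a v)"
    and x: "x \<in> carrier (fr V)"
  shows "f x = g x"
proof -
  have "f (encode t) = g (encode t)" if "t \<in> carrier (A \<boxtimes> V)" for t
    by (rule lin_tensor_ext[OF lin_comp[OF f lin_encode] lin_comp[OF g lin_encode] A.module_A V _ that])
      (use eq in \<open>simp add: upure_def\<close>)
  then show ?thesis using x by (auto simp: carrier_free)
qed

end

section \<open>The object \<open>M / A\<^sup>+M\<close>\<close>

context
  fixes M :: "('a, 'h, 'v) bi_data"
  assumes M: "bicomodule_bimodule A H p M"
begin

interpretation M: module CC M by (rule bm_module[OF M])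

text \<open>The kernel of \<open>g\<close> is a submodule containing the generators of
  \<open>A^+M\<close>, hence contains their hull.\<close>

lemma augmentation_least:
  assumes g: "lin M X g"
    and z: "\<And>a m. a \<in> carrier A \<Longrightarrow> m \<in> carrier M \<Longrightarrow> counit A a = 0 \<Longrightarrow> g (lact M a m) = \<zero>\<^bsub>X\<^esub>"
    and n: "n \<in> augmentation A M"
  shows "n \<in> carrier M" "g n = \<zero>\<^bsub>X\<^esub>"
proof -
  interpret X: module CC X by (rule linD(2)[OF g])
  have "submodule {m \<in> carrier M. g m = \<zero>\<^bsub>X\<^esub>} CC M"
  proof (rule M.submoduleI)
    fix m assume "m \<in> {m \<in> carrier M. g m = \<zero>\<^bsub>X\<^esub>}"
    moreover have "\<ominus>\<^bsub>M\<^esub> m = (-1) \<odot>\<^bsub>M\<^esub> m" if "m \<in> carrier M"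
      by (rule module_minus[OF M.module_axioms that])
    ultimately show "\<ominus>\<^bsub>M\<^esub> m \<in> {m \<in> carrier M. g m = \<zero>\<^bsub>X\<^esub>}"
      using lin_rules(4)[OF g, of m "-1"] X.smult_r_null[of "-1"] by simp
  qed (use linD[OF g] lin_zero[OF g] module_smult_zero[OF X.module_axioms] in auto)
  moreover have "{lact M a f |a f. a \<in> carrier A \<and> counit A a = 0 \<and> f \<in> carrier M} \<subseteq> {m \<in> carrier M. g m = \<zero>\<^bsub>X\<^esub>}"
    using z bm_rules[OF M] by auto
  ultimately have "augmentation A M \<subseteq> {m \<in> carrier M. g m = \<zero>\<^bsub>X\<^esub>}"
    unfolding augmentation_def by (intro hull_minimal)
  then show "n \<in> carrier M" "g n = \<zero>\<^bsub>X\<^esub>" using n by auto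
qed

lemma quot_same_space: "same_space (quot_space A M) (qt M)"
  by (simp add: same_space_def quot_obj_def Let_def)

lemma augmentation_closed:
  shows "n \<in> augmentation A M \<Longrightarrow> n \<in> carrier M"
    "\<zero>\<^bsub>M\<^esub> \<in> augmentation A M"
    "n \<in> augmentation A M \<Longrightarrow> n' \<in> augmentation A M \<Longrightarrow> n \<oplus>\<^bsub>M\<^esub> n' \<in> augmentation A M"
    "n \<in> augmentation A M \<Longrightarrow> c \<odot>\<^bsub>M\<^esub> n \<in> augmentation A M"
    "a \<in> carrier A \<Longrightarrow> counit A a = 0 \<Longrightarrow> f \<in> carrier M \<Longrightarrow> lact M a f \<in> augmentation A M"
proof -
  have sub: "\<zero>\<^bsub>M\<^esub> \<in> N" "n \<in> N \<Longrightarrow> n \<in> carrier M" "n \<in> N \<Longrightarrow> n' \<in> N \<Longrightarrow> n \<oplus>\<^bsub>M\<^esub> n' \<in> N" "n \<in> N \<Longrightarrow> c \<odot>\<^bsub>M\<^esub> n \<in> N"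
    if "submodule N CC M" for N n n' c
    using M.submoduleE[OF that] subgroup.one_closed[OF submodule.axioms(1)[OF that]] by auto
  have g: "{lact M a f |a f. a \<in> carrier A \<and> counit A a = 0 \<and> f \<in> carrier M} \<subseteq> carrier M"
    using bm_rules[OF M] by auto
  show "n \<in> augmentation A M \<Longrightarrow> n \<in> carrier M"
    using M.carrier_is_submodule g unfolding augmentation_def hull_def by auto
  show "\<zero>\<^bsub>M\<^esub> \<in> augmentation A M"
    "n \<in> augmentation A M \<Longrightarrow> n' \<in> augmentation A M \<Longrightarrow> n \<oplus>\<^bsub>M\<^esub> n' \<in> augmentation A M"
    "n \<in> augmentation A M \<Longrightarrow> c \<odot>\<^bsub>M\<^esub> n \<in> augmentation A M"
    unfolding augmentation_def hull_def using sub by auto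
  show "a \<in> carrier A \<Longrightarrow> counit A a = 0 \<Longrightarrow> f \<in> carrier M \<Longrightarrow> lact M a f \<in> augmentation A M"
    unfolding augmentation_def hull_def by blast
qed

lemma cls_ex:
  assumes "f \<in> carrier M"
  obtains n where "n \<in> augmentation A M" "cls A M f = n \<oplus>\<^bsub>M\<^esub> f"
proof -
  have "f \<in> augmentation A M +>\<^bsub>M\<^esub> f"
    using augmentation_closed(2) assms by (auto simp: a_r_coset_def' intro!: bexI[of _ "\<zero>\<^bsub>M\<^esub>"])
  then have "cls A M f \<in> augmentation A M +>\<^bsub>M\<^esub> f"
    unfolding cls_def by (rule someI)
  then show ?thesis using that by (auto simp: a_r_coset_def')
qed

lemma cls_closed: "f \<in> carrier M \<Longrightarrow> cls A M f \<in> carrier M"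
  by (rule cls_ex) (auto dest: augmentation_closed(1))

text \<open>The two cosets are equal as sets, so the choice operator returns the same
  representative.\<close>

lemma cls_augmentation:
  assumes n: "n \<in> augmentation A M" and f: "f \<in> carrier M"
  shows "cls A M (n \<oplus>\<^bsub>M\<^esub> f) = cls A M f"
proof -
  note cl = augmentation_closed
  have nf: "n \<in> carrier M" using n by (rule cl)
  have "augmentation A M +>\<^bsub>M\<^esub> (n \<oplus>\<^bsub>M\<^esub> f) = augmentation A M +>\<^bsub>M\<^esub> f"
  proof (intro equalityI subsetI)
    fix x assume "x \<in> augmentation A M +>\<^bsub>M\<^esub> (n \<oplus>\<^bsub>M\<^esub> f)"
    then obtain h where h: "h \<in> augmentation A M" "x = h \<oplus>\<^bsub>M\<^esub> (n \<oplus>\<^bsub>M\<^esub> f)" by (auto simp: a_r_coset_def')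
    then have "x = (h \<oplus>\<^bsub>M\<^esub> n) \<oplus>\<^bsub>M\<^esub> f" using f nf cl(1)[OF h(1)] by (simp add: M.a_assoc)
    then show "x \<in> augmentation A M +>\<^bsub>M\<^esub> f" using cl(3)[OF h(1) n] by (auto simp: a_r_coset_def')
  next
    fix x assume "x \<in> augmentation A M +>\<^bsub>M\<^esub> f"
    then obtain h where h: "h \<in> augmentation A M" "x = h \<oplus>\<^bsub>M\<^esub> f" by (auto simp: a_r_coset_def')
    have m: "\<ominus>\<^bsub>M\<^esub> n \<in> augmentation A M"
      using cl(4)[OF n, of "-1"] by (simp add: module_minus[OF M.module_axioms nf])
    have "(\<ominus>\<^bsub>M\<^esub> n) \<oplus>\<^bsub>M\<^esub> (n \<oplus>\<^bsub>M\<^esub> f) = f" using nf f by (simp add: M.r_neg1)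
    then have "x = (h \<oplus>\<^bsub>M\<^esub> (\<ominus>\<^bsub>M\<^esub> n)) \<oplus>\<^bsub>M\<^esub> (n \<oplus>\<^bsub>M\<^esub> f)"
      using f nf cl(1)[OF h(1)] h(2) by (simp add: M.a_assoc)
    then show "x \<in> augmentation A M +>\<^bsub>M\<^esub> (n \<oplus>\<^bsub>M\<^esub> f)" using cl(3)[OF h(1) m] by (auto simp: a_r_coset_def')
  qed
  then show ?thesis by (simp add: cls_def)
qed

lemma cls_cls: "f \<in> carrier M \<Longrightarrow> cls A M (cls A M f) = cls A M f"
  by (rule cls_ex) (auto simp: cls_augmentation)

lemma carrier_quot: "carrier (qt M) = cls A M ` carrier M"
  by (simp add: quot_obj_def quot_space_def Let_def)

lemma quotD: "x \<in> carrier (qt M) \<Longrightarrow> x \<in> carrier M" "x \<in> carrier (qt M) \<Longrightarrow> cls A M x = x"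
  by (auto simp: carrier_quot cls_closed cls_cls)

lemma lin_cls: "lin M (qt M) (cls A M)"
proof (rule module_image[OF M.module_axioms carrier_quot])
  fix x y c assume xy: "x \<in> carrier M" "y \<in> carrier M"
  obtain n where n: "n \<in> augmentation A M" "cls A M x = n \<oplus>\<^bsub>M\<^esub> x" by (rule cls_ex[OF xy(1)])
  obtain n' where n': "n' \<in> augmentation A M" "cls A M y = n' \<oplus>\<^bsub>M\<^esub> y" by (rule cls_ex[OF xy(2)])
  note cl = augmentation_closed(1)[OF n(1)] augmentation_closed(1)[OF n'(1)]
  have "cls A M x \<oplus>\<^bsub>M\<^esub> cls A M y = (n \<oplus>\<^bsub>M\<^esub> n') \<oplus>\<^bsub>M\<^esub> (x \<oplus>\<^bsub>M\<^esub> y)"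
    using n n' xy cl by (simp add: M.a_ac)
  then show "cls A M (x \<oplus>\<^bsub>M\<^esub> y) = cls A M x \<oplus>\<^bsub>qt M\<^esub> cls A M y"
    using cls_augmentation[OF augmentation_closed(3)[OF n(1) n'(1)], of "x \<oplus>\<^bsub>M\<^esub> y"] xy
    by (simp add: quot_obj_def quot_space_def Let_def)
next
  fix x c assume x: "x \<in> carrier M"
  obtain n where n: "n \<in> augmentation A M" "cls A M x = n \<oplus>\<^bsub>M\<^esub> x" by (rule cls_ex[OF x])
  have "c \<odot>\<^bsub>M\<^esub> cls A M x = c \<odot>\<^bsub>M\<^esub> n \<oplus>\<^bsub>M\<^esub> c \<odot>\<^bsub>M\<^esub> x"
    using n x augmentation_closed(1)[OF n(1)] by (simp add: M.smult_r_distr[simplified])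
  then show "cls A M (c \<odot>\<^bsub>M\<^esub> x) = c \<odot>\<^bsub>qt M\<^esub> cls A M x"
    using cls_augmentation[OF augmentation_closed(4)[OF n(1), of c], of "c \<odot>\<^bsub>M\<^esub> x"] x
    by (simp add: quot_obj_def quot_space_def Let_def module_smult_closed[OF M.module_axioms])
qed (simp add: quot_obj_def quot_space_def Let_def)

text \<open>Independence of the representative, for maps that turn the left action into the counit:
  such a map vanishes on \<open>A^+M\<close>, and \<open>cls A M f\<close> differs from
  \<open>f\<close> by an element of \<open>A^+M\<close>. All well-definedness questions about the
  quotient reduce to this condition on \<open>g\<close>.\<close>

lemma cls_eqI:
  assumes g: "lin M X g"
    and z: "\<And>a m. a \<in> carrier A \<Longrightarrow> m \<in> carrier M \<Longrightarrow> g (lact M a m) = counit A a \<odot>\<^bsub>X\<^esub> g m"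
    and f: "f \<in> carrier M"
  shows "g (cls A M f) = g f"
proof -
  interpret X: module CC X by (rule linD(2)[OF g])
  obtain n where n: "n \<in> augmentation A M" "cls A M f = n \<oplus>\<^bsub>M\<^esub> f" by (rule cls_ex[OF f])
  have "g n = \<zero>\<^bsub>X\<^esub>"
    by (rule augmentation_least[OF g _ n(1)]) (use z X.smult_l_null linD(3)[OF g] in auto)
  then show ?thesis
    using n f linD[OF g] augmentation_closed(1)[OF n(1)] by simp
qed

text \<open>Elements of the quotient are themselves elements of \<open>M\<close>, so the induced map
  is \<open>g\<close> itself. What remains is linearity for the quotient operations, which is
  \<open>cls_eqI\<close> applied to sums and multiples.\<close>

lemma lin_quot:
  assumes g: "lin M X g"
    and z: "\<And>a m. a \<in> carrier A \<Longrightarrow> m \<in> carrier M \<Longrightarrow> g (lact M a m) = counit A a \<odot>\<^bsub>X\<^esub> g m"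
  shows "lin (qt M) X g"
proof (rule linI)
  note gc = cls_eqI[OF g z]
  show "module CC (qt M)" "module CC X" using lin_cls g by (auto dest: linD)
  fix x c assume x: "x \<in> carrier (qt M)"
  show "g x \<in> carrier X" using linD(3)[OF g] quotD(1)[OF x] .
  have "c \<odot>\<^bsub>qt M\<^esub> x = cls A M (c \<odot>\<^bsub>M\<^esub> x)" using linD(5)[OF lin_cls quotD(1)[OF x]] quotD(2)[OF x] by simp
  then show "g (c \<odot>\<^bsub>qt M\<^esub> x) = c \<odot>\<^bsub>X\<^esub> g x"
    using gc[of "c \<odot>\<^bsub>M\<^esub> x"] linD(5)[OF g] quotD(1)[OF x] by (simp add: module_smult_closed[OF M.module_axioms])
  fix y assume y: "y \<in> carrier (qt M)"
  have "x \<oplus>\<^bsub>qt M\<^esub> y = cls A M (x \<oplus>\<^bsub>M\<^esub> y)"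
    using linD(4)[OF lin_cls quotD(1)[OF x] quotD(1)[OF y]] quotD(2)[OF x] quotD(2)[OF y] by simp
  then show "g (x \<oplus>\<^bsub>qt M\<^esub> y) = g x \<oplus>\<^bsub>X\<^esub> g y"
    using gc[of "x \<oplus>\<^bsub>M\<^esub> y"] linD(4)[OF g] quotD(1)[OF x] quotD(1)[OF y] by simp
qed

lemma cls_lact:
  assumes a: "a \<in> carrier A" and m: "m \<in> carrier M"
  shows "cls A M (lact M a m) = counit A a \<odot>\<^bsub>qt M\<^esub> cls A M m"
proof -
  note [simp] = hh_rules bm_rules[OF M] linD(4)[OF lin_cls] lin_rules[OF lin_cls]
  \<comment> \<open>The correction \<open>a - \<epsilon>(a) 1\<close> lies in the kernel of the
    counit, so it acts by zero on classes.\<close>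
  let ?b = "a \<oplus>\<^bsub>A\<^esub> (- counit A a) \<odot>\<^bsub>A\<^esub> \<one>\<^bsub>A\<^esub>"
  have "counit A ?b = 0"
    using A.counit_linear a by (simp add: linear_map_def)
  then have n: "lact M ?b m \<in> augmentation A M"
    using augmentation_closed(5) a m by (simp add: A.a_closed)
  have "lact M a m = lact M ?b m \<oplus>\<^bsub>M\<^esub> counit A a \<odot>\<^bsub>M\<^esub> m"
  proof -
    have "lact M ?b m = lact M a m \<oplus>\<^bsub>M\<^esub> (- counit A a) \<odot>\<^bsub>M\<^esub> m"
      using linD(4)[OF bilinD(5)[OF bilin_lact[OF M] m], of a] a m by simp
    then show ?thesis
      using a m M.smult_l_distr[of "- counit A a" "counit A a" m] M.smult_l_null[of m]
      by (simp add: M.a_assoc)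
  qed
  then have "cls A M (lact M a m) = cls A M (counit A a \<odot>\<^bsub>M\<^esub> m)"
    using cls_augmentation[OF n, of "counit A a \<odot>\<^bsub>M\<^esub> m"] m by simp
  then show ?thesis using m by simp
qed

lemmas q_rules = hh_rules bm_rules[OF M] lin_rules[OF lin_cls] cls_lact

text \<open>The right action descends because it commutes with the left action.\<close>

lemma ract_quot_cls:
  assumes f: "f \<in> carrier M" and a: "a \<in> carrier A"
  shows "ract (qt M) (cls A M f) a = cls A M (ract M f a)"
proof -
  have "cls A M (ract M (cls A M f) a) = cls A M (ract M f a)"
    by (rule cls_eqI[where X = "qt M" and g = "\<lambda>f. cls A M (ract M f a)"])
      (use f a in \<open>simp_all add: q_rules bm_commute[OF M]\<close>)
  then show ?thesis by (simp add: quot_obj_def Let_def)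
qed

lemma quot_coact_bsum:
  assumes f: "f \<in> carrier M"
  shows "quot_coact_formula A H p M f = lsum M (qt M \<boxtimes> H) f (\<lambda>a m. rsum M (qt M \<boxtimes> H) m (\<lambda>f\<^sub>0 f\<^sub>1.
    pure (qt M) H (cls A M f\<^sub>0) (p (antipode A a) \<otimes>\<^bsub>H\<^esub> f\<^sub>1)))"
proof -
  note [simp] = q_rules f
  have 1: "tmap A (M \<boxtimes> H) id (rcoact M) (lcoact M f) = lsum M (A \<boxtimes> M \<boxtimes> H) f (\<lambda>a m. pure A (M \<boxtimes> H) a (rcoact M m))"
    using tmap_bsum[OF lin_id[OF A.module_A] lin_rcoact[OF M], of "lcoact M f"] by (simp add: id_def)
  have 2: "bilin A (M \<boxtimes> H) (qt M \<boxtimes> H)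
      (\<lambda>a t. tsum (qt M \<boxtimes> H) t (\<lambda>f\<^sub>0 f\<^sub>1. pure (qt M) H (cls A M f\<^sub>0) (p (antipode A a) \<otimes>\<^bsub>H\<^esub> f\<^sub>1)))"
    by (rule bilinI) (simp_all add: tsum_bsum[of M H])
  show ?thesis
    unfolding quot_coact_formula_def Let_def same_space_simps[OF quot_same_space] 1
    by (subst tsum_bsum[OF 2]) (simp_all add: tsum_bsum[of M H])
qed

lemma rcoact_quot: "rcoact (qt M) = quot_coact_formula A H p M"
  by (simp add: quot_obj_def Let_def)

text \<open>In the formula for \<open>bf\<close> the middle leg \<open>b\<^sub>2\<close> acts inside
  the class and becomes \<open>\<epsilon>(b\<^sub>2)\<close> (fact \<open>1\<close>). Since
  \<open>S\<close> is antimultiplicative, \<open>S(b\<^sub>1)\<close> then stands directly before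
  the remaining leg and cancels it. This makes the coaction well defined on classes.\<close>

lemma quot_coact_lact:
  assumes b: "b \<in> carrier A" and f: "f \<in> carrier M"
  shows "quot_coact_formula A H p M (lact M b f) = counit A b \<odot>\<^bsub>qt M \<boxtimes> H\<^esub> quot_coact_formula A H p M f"
proof -
  note [simp] = q_rules bm_lcoact_lact[OF M] bm_rcoact_lact[OF M] A.antipode_mult H.m_assoc
  let ?Y = "qt M \<boxtimes> H" and ?S = "antipode A"
  let ?g = "\<lambda>f. lsum M ?Y f (\<lambda>a m. rsum M ?Y m (\<lambda>f\<^sub>0 f\<^sub>1. pure (qt M) H (cls A M f\<^sub>0) (p (?S a) \<otimes>\<^bsub>H\<^esub> f\<^sub>1)))"
  have 1: "A.sw ?Y x (\<lambda>b\<^sub>2 b\<^sub>3. counit A b\<^sub>2 \<odot>\<^bsub>?Y\<^esub> rsum M ?Y f\<^sub>0 (\<lambda>u h.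
        pure (qt M) H (cls A M u) (w \<otimes>\<^bsub>H\<^esub> (z \<otimes>\<^bsub>H\<^esub> (p b\<^sub>3 \<otimes>\<^bsub>H\<^esub> h)))))
      = rsum M ?Y f\<^sub>0 (\<lambda>u h. pure (qt M) H (cls A M u) (w \<otimes>\<^bsub>H\<^esub> (z \<otimes>\<^bsub>H\<^esub> (p x \<otimes>\<^bsub>H\<^esub> h))))"
    if "x \<in> carrier A" "w \<in> carrier H" "z \<in> carrier H" "f\<^sub>0 \<in> carrier M" for x w z f\<^sub>0
    by (rule A.counit_left_bsum) (use that in simp_all)
  have "?g (lact M b f) = A.sw ?Y b (\<lambda>b\<^sub>1 x. lsum M ?Y f (\<lambda>a m. rsum M ?Y m (\<lambda>u h.
      pure (qt M) H (cls A M u) (p (?S a) \<otimes>\<^bsub>H\<^esub> (p (?S b\<^sub>1) \<otimes>\<^bsub>H\<^esub> (p x \<otimes>\<^bsub>H\<^esub> h))))))"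
    using b f by (simp add: 1)
  also have "\<dots> = counit A b \<odot>\<^bsub>?Y\<^esub> ?g f"
    using A.antipode_left_bsum[of ?Y "\<lambda>w. lsum M ?Y f (\<lambda>a m. rsum M ?Y m (\<lambda>u h.
      pure (qt M) H (cls A M u) (p (?S a) \<otimes>\<^bsub>H\<^esub> (p w \<otimes>\<^bsub>H\<^esub> h))))" b] b f by simp
  finally show ?thesis using b f by (simp only: quot_coact_bsum q_rules)
qed

lemma lin_quot_coact: "lin M (qt M \<boxtimes> H) (quot_coact_formula A H p M)"
  by (simp add: quot_coact_bsum q_rules)

lemma lin_rcoact_quot: "lin (qt M) (qt M \<boxtimes> H) (rcoact (qt M))"
  unfolding rcoact_quot using lin_quot[OF lin_quot_coact quot_coact_lact] .

lemma rcoact_quot_formula: "f \<in> carrier M \<Longrightarrow> rcoact (qt M) (cls A M f) = quot_coact_formula A H p M f"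
  unfolding rcoact_quot using cls_eqI[OF lin_quot_coact quot_coact_lact] .

lemma rcoact_quot_cls:
  "f \<in> carrier M \<Longrightarrow> rcoact (qt M) (cls A M f) = lsum M (qt M \<boxtimes> H) f (\<lambda>a m. rsum M (qt M \<boxtimes> H) m (\<lambda>f\<^sub>0 f\<^sub>1.
    pure (qt M) H (cls A M f\<^sub>0) (p (antipode A a) \<otimes>\<^bsub>H\<^esub> f\<^sub>1)))"
  by (simp only: rcoact_quot_formula quot_coact_bsum)

end

section \<open>The bicomodule bimodule structure on \<open>A \<otimes> V\<close>\<close>

lemma free_extB:
  assumes V: "module CC V" and f: "lin (fr V) X f" and g: "lin (fr V) X g"
    and eq: "\<And>a v. a \<in> carrier A \<Longrightarrow> v \<in> carrier V \<Longrightarrow> f (upure A V a v) = g (upure A V a v)"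
  shows "\<forall>x\<in>carrier (fr V). f x = g x"
  using free_ext[OF V f g eq] by blast

context
  fixes V :: "('a, 'h, ('a, 'x) univ) right_data"
  assumes V: "yd_module A H p V"
begin

lemmas fy_rules = free_rules[OF yd_module'[OF V]] yd_rules[OF V]

lemma lact_free:
  assumes "a \<in> carrier A" "x \<in> carrier (fr V)"
  shows "lact (fr V) a x = bsum A V (fr V) (decode A V x) (\<lambda>b v. upure A V (a \<otimes>\<^bsub>A\<^esub> b) v)"
proof -
  have "lact (fr V) a x = tsum (utensor A V) (decode A V x) (\<lambda>b v. upure A V (a \<otimes>\<^bsub>A\<^esub> b) v)"
    by (simp add: free_obj_def Let_def)
  then show ?thesis
    unfolding same_space_simps[OF free_same_space] using assms by (simp add: fy_rules)
qed

lemma ract_free: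
  assumes "a \<in> carrier A" "x \<in> carrier (fr V)"
  shows "ract (fr V) x a = bsum A V (fr V) (decode A V x) (\<lambda>b v. A.sw (fr V) a (\<lambda>a\<^sub>1 a\<^sub>2.
    upure A V (b \<otimes>\<^bsub>A\<^esub> a\<^sub>1) (ract V v a\<^sub>2)))"
proof -
  have "ract (fr V) x a = tsum (utensor A V) (decode A V x) (\<lambda>b v. tsum (utensor A V) (comult A a) (\<lambda>a\<^sub>1 a\<^sub>2.
    upure A V (b \<otimes>\<^bsub>A\<^esub> a\<^sub>1) (ract V v a\<^sub>2)))"
    by (simp add: free_obj_def Let_def)
  then show ?thesis
    unfolding same_space_simps[OF free_same_space] using assms by (simp add: fy_rules)
qed

lemma rcoact_free:
  assumes "x \<in> carrier (fr V)"
  shows "rcoact (fr V) x = bsum A V (fr V \<boxtimes> H) (decode A V x) (\<lambda>a v. A.sw (fr V \<boxtimes> H) a (\<lambda>a\<^sub>1 a\<^sub>2.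
    bsum V H (fr V \<boxtimes> H) (rcoact V v) (\<lambda>v\<^sub>0 v\<^sub>1. pure (fr V) H (upure A V a\<^sub>1 v\<^sub>0) (p a\<^sub>2 \<otimes>\<^bsub>H\<^esub> v\<^sub>1))))"
proof -
  have "rcoact (fr V) x = tsum (utensor A V \<boxtimes> H) (decode A V x) (\<lambda>a v.
    tsum (utensor A V \<boxtimes> H) (comult A a) (\<lambda>a\<^sub>1 a\<^sub>2.
    tsum (utensor A V \<boxtimes> H) (rcoact V v) (\<lambda>v\<^sub>0 v\<^sub>1. pure (utensor A V) H (upure A V a\<^sub>1 v\<^sub>0) (p a\<^sub>2 \<otimes>\<^bsub>H\<^esub> v\<^sub>1))))"
    by (simp add: free_obj_def Let_def)
  then show ?thesis
    unfolding same_space_simps[OF free_same_space] using assms by (simp add: fy_rules)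
qed

lemma lcoact_free:
  assumes "x \<in> carrier (fr V)"
  shows "lcoact (fr V) x = bsum A V (A \<boxtimes> fr V) (decode A V x) (\<lambda>a v. A.sw (A \<boxtimes> fr V) a (\<lambda>a\<^sub>1 a\<^sub>2.
    pure A (fr V) a\<^sub>1 (upure A V a\<^sub>2 v)))"
proof -
  have "lcoact (fr V) x = tsum (A \<boxtimes> utensor A V) (decode A V x) (\<lambda>a v.
    tsum (A \<boxtimes> utensor A V) (comult A a) (\<lambda>a\<^sub>1 a\<^sub>2. pure A (utensor A V) a\<^sub>1 (upure A V a\<^sub>2 v)))"
    by (simp add: free_obj_def Let_def)
  then show ?thesis
    unfolding same_space_simps[OF free_same_space] using assms by (simp add: fy_rules)
qed

lemma bilin_lact_free: "bilin A (fr V) (fr V) (lact (fr V))"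
  by (rule bilinI) (simp_all add: fy_rules lact_free)

lemma bilin_ract_free: "bilin (fr V) A (fr V) (ract (fr V))"
  by (rule bilinI) (simp_all add: fy_rules ract_free)

lemma lin_lcoact_free: "lin (fr V) (A \<boxtimes> fr V) (lcoact (fr V))"
  by (simp add: fy_rules lcoact_free)

lemma lin_rcoact_free: "lin (fr V) (fr V \<boxtimes> H) (rcoact (fr V))"
  by (simp add: fy_rules rcoact_free)

text \<open>On pure tensors the structure maps take their textbook form. After
  \<open>free_extB\<close> these rules reduce every axiom to a Sweedler identity in
  \<open>A\<close>, \<open>H\<close> and \<open>V\<close>.\<close>

lemma free_upure:
  assumes b: "b \<in> carrier A" and v: "v \<in> carrier V"
  shows "a \<in> carrier A \<Longrightarrow> lact (fr V) a (upure A V b v) = upure A V (a \<otimes>\<^bsub>A\<^esub> b) v"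
    "a \<in> carrier A \<Longrightarrow> ract (fr V) (upure A V b v) a = A.sw (fr V) a (\<lambda>a\<^sub>1 a\<^sub>2.
      upure A V (b \<otimes>\<^bsub>A\<^esub> a\<^sub>1) (ract V v a\<^sub>2))"
    "lcoact (fr V) (upure A V b v) = A.sw (A \<boxtimes> fr V) b (\<lambda>a\<^sub>1 a\<^sub>2. pure A (fr V) a\<^sub>1 (upure A V a\<^sub>2 v))"
    "rcoact (fr V) (upure A V b v) = A.sw (fr V \<boxtimes> H) b (\<lambda>a\<^sub>1 a\<^sub>2.
      bsum V H (fr V \<boxtimes> H) (rcoact V v) (\<lambda>v\<^sub>0 v\<^sub>1. pure (fr V) H (upure A V a\<^sub>1 v\<^sub>0) (p a\<^sub>2 \<otimes>\<^bsub>H\<^esub> v\<^sub>1)))"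
  using b v by (simp_all add: fy_rules lact_free ract_free lcoact_free rcoact_free)

lemmas free_all_rules = fy_rules bilin_rules[OF bilin_lact_free] bilin_rules[OF bilin_ract_free]
  lin_rules[OF lin_lcoact_free] lin_rules[OF lin_rcoact_free] free_upure

lemma left_action_free: "left_action A (fr V) (lact (fr V))"
proof -
  note [simp] = free_all_rules A.m_assoc
  have "\<forall>x\<in>carrier (fr V). lact (fr V) \<one>\<^bsub>A\<^esub> x = x"
    by (rule free_extB[where X = "fr V"]) simp_all
  moreover have "\<forall>x\<in>carrier (fr V). lact (fr V) (a \<otimes>\<^bsub>A\<^esub> b) x = lact (fr V) a (lact (fr V) b x)"
    if "a \<in> carrier A" "b \<in> carrier A" for a b
    by (rule free_extB[where X = "fr V"]) (use that in simp_all)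
  ultimately show ?thesis using bilin_lact_free by (auto simp: left_action_def bilin_def)
qed

lemma right_action_free: "right_action A (fr V) (ract (fr V))"
proof -
  note [simp] = free_all_rules A.m_assoc A.comult_one A.comult_mult_bsum
  have "\<forall>x\<in>carrier (fr V). ract (fr V) x \<one>\<^bsub>A\<^esub> = x"
    by (rule free_extB[where X = "fr V"]) simp_all
  moreover have "\<forall>x\<in>carrier (fr V). ract (fr V) x (a \<otimes>\<^bsub>A\<^esub> b) = ract (fr V) (ract (fr V) x a) b"
    if "a \<in> carrier A" "b \<in> carrier A" for a b
  proof (rule free_extB[where X = "fr V"])
    fix c v assume cv: "c \<in> carrier A" "v \<in> carrier V"
    show "ract (fr V) (upure A V c v) (a \<otimes>\<^bsub>A\<^esub> b) = ract (fr V) (ract (fr V) (upure A V c v) a) b"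
      using cv that by simp
  qed (use that in simp_all)
  ultimately show ?thesis using bilin_ract_free by (auto simp: right_action_def bilin_def)
qed

lemma free_commute:
  assumes ab: "a \<in> carrier A" "b \<in> carrier A"
  shows "\<forall>x\<in>carrier (fr V). ract (fr V) (lact (fr V) a x) b = lact (fr V) a (ract (fr V) x b)"
  by (rule free_extB[where X = "fr V"]) (use ab in \<open>simp_all add: free_all_rules A.m_assoc\<close>)

lemma left_coaction_free: "left_coaction A (fr V) (lcoact (fr V))"
proof -
  note [simp] = free_all_rules
  let ?F = "fr V" and ?Z = "A \<boxtimes> A \<boxtimes> fr V"
  have "\<forall>x\<in>carrier ?F. bsum A ?F ?F (lcoact ?F x) (\<lambda>a w. counit A a \<odot>\<^bsub>?F\<^esub> w) = x"
  proof (rule free_extB[where X = "?F"])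
    fix a v assume a: "a \<in> carrier A" "v \<in> carrier V"
    show "bsum A ?F ?F (lcoact ?F (upure A V a v)) (\<lambda>a w. counit A a \<odot>\<^bsub>?F\<^esub> w) = upure A V a v"
      using a A.counit_left_bsum[of ?F "\<lambda>a. upure A V a v" a] by simp
  qed simp_all
  moreover have "\<forall>x\<in>carrier ?F. bsum A ?F ?Z (lcoact ?F x) (\<lambda>x w.
        bsum A A ?Z (comult A x) (\<lambda>a b. pure A (A \<boxtimes> ?F) a (pure A ?F b w))) =
      bsum A ?F ?Z (lcoact ?F x) (\<lambda>a w.
        bsum A ?F ?Z (lcoact ?F w) (\<lambda>b u. pure A (A \<boxtimes> ?F) a (pure A ?F b u)))"
  proof (rule free_extB[where X = "?Z"])
    fix a v assume a: "a \<in> carrier A" "v \<in> carrier V"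
    show "bsum A ?F ?Z (lcoact ?F (upure A V a v)) (\<lambda>x w.
        bsum A A ?Z (comult A x) (\<lambda>a b. pure A (A \<boxtimes> ?F) a (pure A ?F b w))) =
      bsum A ?F ?Z (lcoact ?F (upure A V a v)) (\<lambda>a w.
        bsum A ?F ?Z (lcoact ?F w) (\<lambda>b u. pure A (A \<boxtimes> ?F) a (pure A ?F b u)))"
      using a by (simp add: A.coassoc_bsum)
  qed simp_all
  ultimately show ?thesis by (simp add: A.left_coaction_iff lin_lcoact_free)
qed

lemma right_coaction_free: "right_coaction H (fr V) (rcoact (fr V))"
proof -
  note [simp] = free_all_rules
  let ?F = "fr V" and ?Z = "fr V \<boxtimes> H \<boxtimes> H"
  have "\<forall>x\<in>carrier ?F. bsum ?F H ?F (rcoact ?F x) (\<lambda>w a. counit H a \<odot>\<^bsub>?F\<^esub> w) = x"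
  proof (rule free_extB[where X = "?F"])
    fix a v assume a: "a \<in> carrier A" "v \<in> carrier V"
    have 1: "bsum V H ?F (rcoact V v) (\<lambda>v\<^sub>0 v\<^sub>1. counit H v\<^sub>1 \<odot>\<^bsub>?F\<^esub> upure A V b v\<^sub>0) = upure A V b v" if "b \<in> carrier A" for b
      by (rule yd_rcounit[OF V]) (use a that in simp_all)
    show "bsum ?F H ?F (rcoact ?F (upure A V a v)) (\<lambda>w a. counit H a \<odot>\<^bsub>?F\<^esub> w) = upure A V a v"
      using a A.counit_right_bsum[of ?F "\<lambda>a. upure A V a v" a] by (simp add: 1 smult_smult[symmetric])
  qed simp_all
  moreover have "\<forall>x\<in>carrier ?F. bsum ?F H ?Z (rcoact ?F x) (\<lambda>w b.
        bsum ?F H ?Z (rcoact ?F w) (\<lambda>u a. pure ?F (H \<boxtimes> H) u (pure H H a b))) =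
      bsum ?F H ?Z (rcoact ?F x) (\<lambda>w x.
        bsum H H ?Z (comult H x) (\<lambda>a b. pure ?F (H \<boxtimes> H) w (pure H H a b)))"
  proof (rule free_extB[where X = "?Z"])
    fix a v assume a: "a \<in> carrier A" "v \<in> carrier V"
    \<comment> \<open>The coaction of \<open>v\<close> and the coproducts of \<open>a\<close> are
      independent, and the two sides of coassociativity produce them in different orders.
      \<open>1\<close> and \<open>2\<close> move the coproducts outward.\<close>
    have 1: "bsum V H ?Z (rcoact V v) (\<lambda>v\<^sub>0 v\<^sub>1. A.sw ?Z b (\<lambda>x y. bsum V H ?Z (rcoact V v\<^sub>0) (\<lambda>w g.
        pure ?F (H \<boxtimes> H) (upure A V x w) (pure H H (p y \<otimes>\<^bsub>H\<^esub> g) (p c \<otimes>\<^bsub>H\<^esub> v\<^sub>1))))) =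
      A.sw ?Z b (\<lambda>x y. bsum V H ?Z (rcoact V v) (\<lambda>v\<^sub>0 v\<^sub>1. bsum V H ?Z (rcoact V v\<^sub>0) (\<lambda>w g.
        pure ?F (H \<boxtimes> H) (upure A V x w) (pure H H (p y \<otimes>\<^bsub>H\<^esub> g) (p c \<otimes>\<^bsub>H\<^esub> v\<^sub>1)))))"
      if "b \<in> carrier A" "c \<in> carrier A" for b c
      by (rule bsum_swap) (use that in simp_all)
    have 2: "bsum V H ?Z (rcoact V v) (\<lambda>v\<^sub>0 v\<^sub>1. A.sw ?Z c (\<lambda>y z. H.sw ?Z v\<^sub>1 (\<lambda>g h.
        pure ?F (H \<boxtimes> H) (upure A V x v\<^sub>0) (pure H H (p y \<otimes>\<^bsub>H\<^esub> g) (p z \<otimes>\<^bsub>H\<^esub> h))))) =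
      A.sw ?Z c (\<lambda>y z. bsum V H ?Z (rcoact V v) (\<lambda>v\<^sub>0 v\<^sub>1. H.sw ?Z v\<^sub>1 (\<lambda>g h.
        pure ?F (H \<boxtimes> H) (upure A V x v\<^sub>0) (pure H H (p y \<otimes>\<^bsub>H\<^esub> g) (p z \<otimes>\<^bsub>H\<^esub> h)))))"
      if "x \<in> carrier A" "c \<in> carrier A" for x c
      by (rule bsum_swap) (use that in simp_all)
    show "bsum ?F H ?Z (rcoact ?F (upure A V a v)) (\<lambda>w b.
        bsum ?F H ?Z (rcoact ?F w) (\<lambda>u a. pure ?F (H \<boxtimes> H) u (pure H H a b))) =
      bsum ?F H ?Z (rcoact ?F (upure A V a v)) (\<lambda>w x.
        bsum H H ?Z (comult H x) (\<lambda>a b. pure ?F (H \<boxtimes> H) w (pure H H a b)))"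
      using a by (simp add: A.coassoc_bsum H.comult_mult_bsum comult_p 1 2 yd_rassoc[OF V])
  qed simp_all
  ultimately show ?thesis by (simp add: H.right_coaction_iff lin_rcoact_free)
qed

lemma free_bicomodule:
  "\<forall>f\<in>carrier (fr V).
      rsum (fr V) (A \<boxtimes> fr V \<boxtimes> H) f (\<lambda>g h. lsum (fr V) (A \<boxtimes> fr V \<boxtimes> H) g (\<lambda>a u. pure A (fr V \<boxtimes> H) a (pure (fr V) H u h))) =
      lsum (fr V) (A \<boxtimes> fr V \<boxtimes> H) f (\<lambda>a g. rsum (fr V) (A \<boxtimes> fr V \<boxtimes> H) g (\<lambda>u h. pure A (fr V \<boxtimes> H) a (pure (fr V) H u h)))"
proof -
  note [simp] = free_all_rules
  let ?F = "fr V" and ?Z = "A \<boxtimes> fr V \<boxtimes> H"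
  show ?thesis
  proof (rule free_extB[where X = "?Z"])
    fix a v assume a: "a \<in> carrier A" "v \<in> carrier V"
    have 1: "bsum V H ?Z (rcoact V v) (\<lambda>v\<^sub>0 v\<^sub>1. A.sw ?Z b (\<lambda>x y. pure A (?F \<boxtimes> H) x (pure ?F H (upure A V y v\<^sub>0) (p c \<otimes>\<^bsub>H\<^esub> v\<^sub>1)))) =
      A.sw ?Z b (\<lambda>x y. bsum V H ?Z (rcoact V v) (\<lambda>v\<^sub>0 v\<^sub>1. pure A (?F \<boxtimes> H) x (pure ?F H (upure A V y v\<^sub>0) (p c \<otimes>\<^bsub>H\<^esub> v\<^sub>1))))"
      if "b \<in> carrier A" "c \<in> carrier A" for b c
      by (rule bsum_swap) (use that in simp_all)
    show "rsum ?F ?Z (upure A V a v) (\<lambda>g h. lsum ?F ?Z g (\<lambda>a u. pure A (?F \<boxtimes> H) a (pure ?F H u h))) =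
      lsum ?F ?Z (upure A V a v) (\<lambda>a g. rsum ?F ?Z g (\<lambda>u h. pure A (?F \<boxtimes> H) a (pure ?F H u h)))"
      using a by (simp add: A.coassoc_bsum 1)
  qed simp_all
qed

lemma free_lcoact_lact:
  assumes a: "a \<in> carrier A"
  shows "\<forall>f\<in>carrier (fr V). lcoact (fr V) (lact (fr V) a f) = A.sw (A \<boxtimes> fr V) a (\<lambda>a\<^sub>1 a\<^sub>2.
    lsum (fr V) (A \<boxtimes> fr V) f (\<lambda>f\<^sub>1 f\<^sub>0. pure A (fr V) (a\<^sub>1 \<otimes>\<^bsub>A\<^esub> f\<^sub>1) (lact (fr V) a\<^sub>2 f\<^sub>0)))"
  by (rule free_extB[where X = "A \<boxtimes> fr V"]) (use a in \<open>simp_all add: free_all_rules A.comult_mult_bsum\<close>)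

lemma free_lcoact_ract:
  assumes b: "b \<in> carrier A"
  shows "\<forall>f\<in>carrier (fr V). lcoact (fr V) (ract (fr V) f b) = lsum (fr V) (A \<boxtimes> fr V) f (\<lambda>f\<^sub>1 f\<^sub>0.
    A.sw (A \<boxtimes> fr V) b (\<lambda>b\<^sub>1 b\<^sub>2. pure A (fr V) (f\<^sub>1 \<otimes>\<^bsub>A\<^esub> b\<^sub>1) (ract (fr V) f\<^sub>0 b\<^sub>2)))"
proof -
  note [simp] = free_all_rules
  let ?F = "fr V" and ?Z = "A \<boxtimes> fr V"
  show ?thesis
  proof (rule free_extB[where X = "?Z"])
    fix c v assume c: "c \<in> carrier A" "v \<in> carrier V"
    have 1: "A.sw ?Z b (\<lambda>b\<^sub>1 b\<^sub>2. A.sw ?Z c (\<lambda>c\<^sub>1 c\<^sub>2. A.sw ?Z b\<^sub>1 (\<lambda>x y.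
        pure A ?F (c\<^sub>1 \<otimes>\<^bsub>A\<^esub> x) (upure A V (c\<^sub>2 \<otimes>\<^bsub>A\<^esub> y) (ract V v b\<^sub>2))))) =
      A.sw ?Z c (\<lambda>c\<^sub>1 c\<^sub>2. A.sw ?Z b (\<lambda>b\<^sub>1 b\<^sub>2. A.sw ?Z b\<^sub>1 (\<lambda>x y.
        pure A ?F (c\<^sub>1 \<otimes>\<^bsub>A\<^esub> x) (upure A V (c\<^sub>2 \<otimes>\<^bsub>A\<^esub> y) (ract V v b\<^sub>2)))))"
      by (rule bsum_swap) (use b c in simp_all)
    show "lcoact ?F (ract ?F (upure A V c v) b) = lsum ?F ?Z (upure A V c v) (\<lambda>f\<^sub>1 f\<^sub>0.
        A.sw ?Z b (\<lambda>b\<^sub>1 b\<^sub>2. pure A ?F (f\<^sub>1 \<otimes>\<^bsub>A\<^esub> b\<^sub>1) (ract ?F f\<^sub>0 b\<^sub>2)))"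
      using b c 1 by (simp add: A.comult_mult_bsum A.coassoc_bsum)
  qed (use b in simp_all)
qed

lemma free_rcoact_lact:
  assumes a: "a \<in> carrier A"
  shows "\<forall>f\<in>carrier (fr V). rcoact (fr V) (lact (fr V) a f) = A.sw (fr V \<boxtimes> H) a (\<lambda>a\<^sub>1 a\<^sub>2.
    rsum (fr V) (fr V \<boxtimes> H) f (\<lambda>f\<^sub>0 f\<^sub>1. pure (fr V) H (lact (fr V) a\<^sub>1 f\<^sub>0) (p a\<^sub>2 \<otimes>\<^bsub>H\<^esub> f\<^sub>1)))"
  by (rule free_extB[where X = "fr V \<boxtimes> H"]) (use a in \<open>simp_all add: free_all_rules A.comult_mult_bsum H.m_assoc\<close>)

text \<open>This is the compatibility that requires the Yetter-Drinfeld condition. The left side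
  involves the coaction of \<open>v\<close> acted on by a leg of \<open>b\<close>, with a leg of
  \<open>b\<close> multiplied from the left; the right side acts after the coaction and multiplies
  from the right.\<close>

lemma free_rcoact_ract:
  assumes b: "b \<in> carrier A"
  shows "\<forall>f\<in>carrier (fr V). rcoact (fr V) (ract (fr V) f b) = rsum (fr V) (fr V \<boxtimes> H) f (\<lambda>f\<^sub>0 f\<^sub>1.
    A.sw (fr V \<boxtimes> H) b (\<lambda>b\<^sub>1 b\<^sub>2. pure (fr V) H (ract (fr V) f\<^sub>0 b\<^sub>1) (f\<^sub>1 \<otimes>\<^bsub>H\<^esub> p b\<^sub>2)))"
proof -
  note [simp] = free_all_rules H.m_assoc
  let ?F = "fr V" and ?Z = "fr V \<boxtimes> H"
  show ?thesis
  proof (rule free_extB[where X = "?Z"])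
    fix c v assume c: "c \<in> carrier A" "v \<in> carrier V"
    have 1: "A.sw ?Z b (\<lambda>b\<^sub>1 b\<^sub>2. A.sw ?Z c (\<lambda>c\<^sub>1 c\<^sub>2. A.sw ?Z b\<^sub>1 (\<lambda>x y. bsum V H ?Z (rcoact V (ract V v b\<^sub>2)) (\<lambda>w\<^sub>0 w\<^sub>1.
        pure ?F H (upure A V (c\<^sub>1 \<otimes>\<^bsub>A\<^esub> x) w\<^sub>0) (p c\<^sub>2 \<otimes>\<^bsub>H\<^esub> (p y \<otimes>\<^bsub>H\<^esub> w\<^sub>1)))))) =
      A.sw ?Z c (\<lambda>c\<^sub>1 c\<^sub>2. A.sw ?Z b (\<lambda>b\<^sub>1 b\<^sub>2. A.sw ?Z b\<^sub>1 (\<lambda>x y. bsum V H ?Z (rcoact V (ract V v b\<^sub>2)) (\<lambda>w\<^sub>0 w\<^sub>1.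
        pure ?F H (upure A V (c\<^sub>1 \<otimes>\<^bsub>A\<^esub> x) w\<^sub>0) (p c\<^sub>2 \<otimes>\<^bsub>H\<^esub> (p y \<otimes>\<^bsub>H\<^esub> w\<^sub>1))))))"
      by (rule bsum_swap) (use b c in simp_all)
    have 2: "bsum V H ?Z (rcoact V v) (\<lambda>v\<^sub>0 v\<^sub>1. A.sw ?Z b (\<lambda>x z. A.sw ?Z z (\<lambda>y b\<^sub>2.
        pure ?F H (upure A V (c\<^sub>1 \<otimes>\<^bsub>A\<^esub> x) (ract V v\<^sub>0 y)) (p c\<^sub>2 \<otimes>\<^bsub>H\<^esub> (v\<^sub>1 \<otimes>\<^bsub>H\<^esub> p b\<^sub>2))))) =
      A.sw ?Z b (\<lambda>x z. bsum V H ?Z (rcoact V v) (\<lambda>v\<^sub>0 v\<^sub>1. A.sw ?Z z (\<lambda>y b\<^sub>2.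
        pure ?F H (upure A V (c\<^sub>1 \<otimes>\<^bsub>A\<^esub> x) (ract V v\<^sub>0 y)) (p c\<^sub>2 \<otimes>\<^bsub>H\<^esub> (v\<^sub>1 \<otimes>\<^bsub>H\<^esub> p b\<^sub>2)))))"
      if "c\<^sub>1 \<in> carrier A" "c\<^sub>2 \<in> carrier A" for c\<^sub>1 c\<^sub>2
      by (rule bsum_swap) (use b c that in simp_all)
    \<comment> \<open>The Yetter-Drinfeld condition, with the outer factors
      \<open>c\<^sub>1 x\<close> and \<open>p(c\<^sub>2)\<close> absorbed into the bilinear
      map.\<close>
    have 3: "bsum V H ?Z (rcoact V v) (\<lambda>v\<^sub>0 v\<^sub>1. A.sw ?Z z (\<lambda>y b\<^sub>2.
        pure ?F H (upure A V (c\<^sub>1 \<otimes>\<^bsub>A\<^esub> x) (ract V v\<^sub>0 y)) (p c\<^sub>2 \<otimes>\<^bsub>H\<^esub> (v\<^sub>1 \<otimes>\<^bsub>H\<^esub> p b\<^sub>2)))) =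
      A.sw ?Z z (\<lambda>y b\<^sub>2. bsum V H ?Z (rcoact V (ract V v b\<^sub>2)) (\<lambda>w\<^sub>0 w\<^sub>1.
        pure ?F H (upure A V (c\<^sub>1 \<otimes>\<^bsub>A\<^esub> x) w\<^sub>0) (p c\<^sub>2 \<otimes>\<^bsub>H\<^esub> (p y \<otimes>\<^bsub>H\<^esub> w\<^sub>1))))"
      if "c\<^sub>1 \<in> carrier A" "c\<^sub>2 \<in> carrier A" "x \<in> carrier A" "z \<in> carrier A" for c\<^sub>1 c\<^sub>2 x z
      by (rule yd_compat[OF V, where b = "\<lambda>w h. pure ?F H (upure A V (c\<^sub>1 \<otimes>\<^bsub>A\<^esub> x) w) (p c\<^sub>2 \<otimes>\<^bsub>H\<^esub> h)"])
        (use b c that in simp_all)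
    show "rcoact ?F (ract ?F (upure A V c v) b) = rsum ?F ?Z (upure A V c v) (\<lambda>f\<^sub>0 f\<^sub>1.
        A.sw ?Z b (\<lambda>b\<^sub>1 b\<^sub>2. pure ?F H (ract ?F f\<^sub>0 b\<^sub>1) (f\<^sub>1 \<otimes>\<^bsub>H\<^esub> p b\<^sub>2)))"
      using b c 1 by (simp add: A.comult_mult_bsum A.coassoc_bsum 2 3)
  qed (use b in simp_all)
qed

lemma bm_free: "bm (fr V)"
  by (rule bmI)
    (use left_action_free right_action_free left_coaction_free right_coaction_free free_commute free_bicomodule
      free_lcoact_lact free_lcoact_ract free_rcoact_lact free_rcoact_ract in \<open>simp_all add: free_all_rules\<close>)

end

section \<open>The Yetter-Drinfeld structure on \<open>M / A^+M\<close>\<close>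

context
  fixes M :: "('a, 'h, 'v) bi_data"
  assumes M: "bicomodule_bimodule A H p M"
begin

text \<open>Coassociativity turns the iterated coaction into a coproduct of its
  \<open>A\<close>-leg, where the antipode axiom applies; the counit axiom of the coaction removes
  what is left. The iterated form is stated because \<open>bm_lassoc\<close> rewrites towards
  it.\<close>

lemma lsum_antipode_right:
  assumes K: "bilin A M X K" and m: "m \<in> carrier M"
  shows "lsum M X m (\<lambda>a n. lsum M X n (\<lambda>b u. K (a \<otimes>\<^bsub>A\<^esub> antipode A b) u)) = K \<one>\<^bsub>A\<^esub> m"
proof -
  note [simp] = q_rules[OF M] bilin_rules[OF K]
  have "lsum M X m (\<lambda>x u. A.sw X x (\<lambda>a b. K (a \<otimes>\<^bsub>A\<^esub> antipode A b) u)) = K \<one>\<^bsub>A\<^esub> m"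
    using m A.antipode_right_bsum[of X "\<lambda>w. K w _"] bm_lcounit[OF M, of X "K \<one>\<^bsub>A\<^esub>" m] by simp
  then show ?thesis using m by (simp add: bm_lassoc[OF M])
qed

lemma lsum_antipode_left:
  assumes K: "bilin A M X K" and m: "m \<in> carrier M"
  shows "lsum M X m (\<lambda>a n. lsum M X n (\<lambda>b u. K (antipode A a \<otimes>\<^bsub>A\<^esub> b) u)) = K \<one>\<^bsub>A\<^esub> m"
proof -
  note [simp] = q_rules[OF M] bilin_rules[OF K]
  have "lsum M X m (\<lambda>x u. A.sw X x (\<lambda>a b. K (antipode A a \<otimes>\<^bsub>A\<^esub> b) u)) = K \<one>\<^bsub>A\<^esub> m"
    using m A.antipode_left_bsum[of X "\<lambda>w. K w _"] bm_lcounit[OF M, of X "K \<one>\<^bsub>A\<^esub>" m] by simp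
  then show ?thesis using m by (simp add: bm_lassoc[OF M])
qed

lemma ract_quot: "ract (qt M) x a = cls A M (ract M x a)"
  by (simp add: quot_obj_def Let_def)

lemma bilin_ract_quot: "bilin (qt M) A (qt M) (ract (qt M))"
proof (rule bilinI)
  note [simp] = q_rules[OF M]
  show "module CC (qt M)" "module CC A" "module CC (qt M)" by simp_all
  show "lin A (qt M) (ract (qt M) x)" if "x \<in> carrier (qt M)" for x
    using quotD(1)[OF M that] by (simp add: ract_quot)
  show "lin (qt M) (qt M) (\<lambda>x. ract (qt M) x a)" if "a \<in> carrier A" for a
    unfolding ract_quot by (rule lin_quot[OF M]) (use that in \<open>simp_all add: bm_commute[OF M]\<close>)
qed

text \<open>Counterpart of \<open>free_extB\<close> for the quotient: on classes the action and the
  coaction have explicit formulas.\<close>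

lemma quot_ball: "(\<forall>x\<in>carrier (qt M). P x) \<longleftrightarrow> (\<forall>m\<in>carrier M. P (cls A M m))"
  by (simp add: carrier_quot[OF M])

lemmas quot_all_rules = q_rules[OF M] bilin_rules[OF bilin_ract_quot] lin_rules[OF lin_rcoact_quot[OF M]]
  ract_quot_cls[OF M] rcoact_quot_cls[OF M]

lemma right_action_quot: "right_action A (qt M) (ract (qt M))"
proof -
  have "\<forall>x\<in>carrier (qt M). ract (qt M) x \<one>\<^bsub>A\<^esub> = x"
    unfolding quot_ball by (simp add: quot_all_rules)
  moreover have "\<forall>x\<in>carrier (qt M). ract (qt M) x (a \<otimes>\<^bsub>A\<^esub> b) = ract (qt M) (ract (qt M) x a) b"
    if "a \<in> carrier A" "b \<in> carrier A" for a b
    unfolding quot_ball using that by (simp add: quot_all_rules)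
  ultimately show ?thesis using bilin_ract_quot by (auto simp: right_action_def bilin_def)
qed

text \<open>The counit axiom uses that the antipode preserves the counit. Coassociativity holds
  because \<open>S\<close> reverses the coproduct: the legs \<open>S(a\<^sub>2)\<close> and
  \<open>S(a\<^sub>1)\<close> in the coproduct of \<open>S(a)\<close> are the ones that two
  successive applications of the formula produce.\<close>

lemma right_coaction_quot: "right_coaction H (qt M) (rcoact (qt M))"
proof -
  note [simp] = quot_all_rules
  let ?Q = "qt M" and ?Z = "qt M \<boxtimes> H \<boxtimes> H" and ?S = "antipode A"
  have "\<forall>x\<in>carrier ?Q. bsum ?Q H ?Q (rcoact ?Q x) (\<lambda>w h. counit H h \<odot>\<^bsub>?Q\<^esub> w) = x"
    unfolding quot_ball
  proof
    fix f assume f: "f \<in> carrier M"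
    have 1: "rsum M ?Q m (\<lambda>u h. counit H h \<odot>\<^bsub>?Q\<^esub> cls A M u) = cls A M m" if "m \<in> carrier M" for m
      by (rule bm_rcounit[OF M]) (use that in simp_all)
    show "bsum ?Q H ?Q (rcoact ?Q (cls A M f)) (\<lambda>w h. counit H h \<odot>\<^bsub>?Q\<^esub> w) = cls A M f"
      using f bm_lcounit[OF M, of ?Q "cls A M" f] by (simp add: 1 smult_smult[symmetric] A.counit_antipode)
  qed
  moreover have "\<forall>x\<in>carrier ?Q. bsum ?Q H ?Z (rcoact ?Q x) (\<lambda>w b.
        bsum ?Q H ?Z (rcoact ?Q w) (\<lambda>u a. pure ?Q (H \<boxtimes> H) u (pure H H a b))) =
      bsum ?Q H ?Z (rcoact ?Q x) (\<lambda>w x.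
        bsum H H ?Z (comult H x) (\<lambda>a b. pure ?Q (H \<boxtimes> H) w (pure H H a b)))"
    unfolding quot_ball
  proof
    fix f assume f: "f \<in> carrier M"
    have 1: "rsum M ?Z m (\<lambda>u k. A.sw ?Z a (\<lambda>a\<^sub>1 a\<^sub>2. H.sw ?Z k (\<lambda>g h.
        pure ?Q (H \<boxtimes> H) (cls A M u) (pure H H (p (?S a\<^sub>2) \<otimes>\<^bsub>H\<^esub> g) (p (?S a\<^sub>1) \<otimes>\<^bsub>H\<^esub> h))))) =
      A.sw ?Z a (\<lambda>a\<^sub>1 a\<^sub>2. rsum M ?Z m (\<lambda>u k. H.sw ?Z k (\<lambda>g h.
        pure ?Q (H \<boxtimes> H) (cls A M u) (pure H H (p (?S a\<^sub>2) \<otimes>\<^bsub>H\<^esub> g) (p (?S a\<^sub>1) \<otimes>\<^bsub>H\<^esub> h)))))"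
      if "a \<in> carrier A" "m \<in> carrier M" for a m
      by (rule bsum_swap) (use that in simp_all)
    show "bsum ?Q H ?Z (rcoact ?Q (cls A M f)) (\<lambda>w b.
        bsum ?Q H ?Z (rcoact ?Q w) (\<lambda>u a. pure ?Q (H \<boxtimes> H) u (pure H H a b))) =
      bsum ?Q H ?Z (rcoact ?Q (cls A M f)) (\<lambda>w x.
        bsum H H ?Z (comult H x) (\<lambda>a b. pure ?Q (H \<boxtimes> H) w (pure H H a b)))"
      using f by (simp add: H.comult_mult_bsum comult_p A.comult_antipode bm_bicomodule[OF M] bm_rassoc[OF M] 1 bm_lassoc[OF M])
  qed
  ultimately show ?thesis by (simp add: H.right_coaction_iff)
qed

text \<open>For the class of \<open>f a\<^sub>2\<close> the formula contains \<open>S\<close> of a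
  product, so antimultiplicativity puts the antipode of a leg of \<open>a\<^sub>2\<close> directly
  after the outer factor \<open>p(a\<^sub>1)\<close>. After the exchange \<open>1\<close> of the
  coproduct of \<open>a\<close> with the coaction of \<open>f\<close>, fact \<open>2\<close> cancels
  the two.\<close>

lemma yd_quot: "yd (qt M)"
proof (rule ydI)
  note [simp] = quot_all_rules A.antipode_mult H.m_assoc
  let ?Q = "qt M" and ?Y = "qt M \<boxtimes> H" and ?S = "antipode A"
  fix x a assume x: "x \<in> carrier ?Q" and a: "a \<in> carrier A"
  obtain f where f: "f \<in> carrier M" "x = cls A M f" using x by (auto simp: carrier_quot[OF M])
  have 1: "A.sw ?Y a (\<lambda>a\<^sub>1 a\<^sub>2. lsum M ?Y f (\<lambda>g m. A.sw ?Y a\<^sub>2 (\<lambda>x y. rsum M ?Y m (\<lambda>u h. A.sw ?Y y (\<lambda>y\<^sub>1 y\<^sub>2.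
      pure ?Q H (cls A M (ract M u y\<^sub>1)) (p a\<^sub>1 \<otimes>\<^bsub>H\<^esub> (p (?S x) \<otimes>\<^bsub>H\<^esub> (p (?S g) \<otimes>\<^bsub>H\<^esub> (h \<otimes>\<^bsub>H\<^esub> p y\<^sub>2))))))))) =
    lsum M ?Y f (\<lambda>g m. A.sw ?Y a (\<lambda>a\<^sub>1 a\<^sub>2. A.sw ?Y a\<^sub>2 (\<lambda>x y. rsum M ?Y m (\<lambda>u h. A.sw ?Y y (\<lambda>y\<^sub>1 y\<^sub>2.
      pure ?Q H (cls A M (ract M u y\<^sub>1)) (p a\<^sub>1 \<otimes>\<^bsub>H\<^esub> (p (?S x) \<otimes>\<^bsub>H\<^esub> (p (?S g) \<otimes>\<^bsub>H\<^esub> (h \<otimes>\<^bsub>H\<^esub> p y\<^sub>2)))))))))"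
    by (rule bsum_swap) (use a f in simp_all)
  have 2: "A.sw ?Y a (\<lambda>a\<^sub>1 a\<^sub>2. A.sw ?Y a\<^sub>2 (\<lambda>x y. rsum M ?Y m (\<lambda>u h. A.sw ?Y y (\<lambda>y\<^sub>1 y\<^sub>2.
      pure ?Q H (cls A M (ract M u y\<^sub>1)) (p a\<^sub>1 \<otimes>\<^bsub>H\<^esub> (p (?S x) \<otimes>\<^bsub>H\<^esub> (p (?S g) \<otimes>\<^bsub>H\<^esub> (h \<otimes>\<^bsub>H\<^esub> p y\<^sub>2)))))))) =
    rsum M ?Y m (\<lambda>u h. A.sw ?Y a (\<lambda>y\<^sub>1 y\<^sub>2.
      pure ?Q H (cls A M (ract M u y\<^sub>1)) (p (?S g) \<otimes>\<^bsub>H\<^esub> (h \<otimes>\<^bsub>H\<^esub> p y\<^sub>2))))"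
    if "m \<in> carrier M" "g \<in> carrier A" for m g
    using A.antipode_right_absorb[of ?Y "\<lambda>w y. rsum M ?Y m (\<lambda>u h. A.sw ?Y y (\<lambda>y\<^sub>1 y\<^sub>2.
      pure ?Q H (cls A M (ract M u y\<^sub>1)) (p w \<otimes>\<^bsub>H\<^esub> (p (?S g) \<otimes>\<^bsub>H\<^esub> (h \<otimes>\<^bsub>H\<^esub> p y\<^sub>2)))))" a] that a
    by simp
  show "bsum ?Q H ?Y (rcoact ?Q x) (\<lambda>v\<^sub>0 v\<^sub>1. A.sw ?Y a (\<lambda>a\<^sub>1 a\<^sub>2.
        pure ?Q H (ract ?Q v\<^sub>0 a\<^sub>1) (v\<^sub>1 \<otimes>\<^bsub>H\<^esub> p a\<^sub>2))) =
      A.sw ?Y a (\<lambda>a\<^sub>1 a\<^sub>2. bsum ?Q H ?Y (rcoact ?Q (ract ?Q x a\<^sub>2)) (\<lambda>w\<^sub>0 w\<^sub>1.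
        pure ?Q H w\<^sub>0 (p a\<^sub>1 \<otimes>\<^bsub>H\<^esub> w\<^sub>1)))"
    using f a by (simp add: bm_lcoact_ract[OF M] bm_rcoact_ract[OF M] 1 2)
qed (use right_action_quot right_coaction_quot in \<open>simp_all add: quot_all_rules\<close>)

end

section \<open>The two categories\<close>

abbreviation "BM \<equiv> bimod_category A H p"
abbreviation "YD \<equiv> yd_category A H p"

lemma Obj_simps: "M \<in> Obj BM \<longleftrightarrow> bm M" "V \<in> Obj YD \<longleftrightarrow> yd V"
  by (simp_all add: bimod_category_def yd_category_def)

lemma Comp_simps:
  "Comp BM L M N g f = compose (carrier L) g f" "Ident BM M = (\<lambda>m\<in>carrier M. m)"
  "Comp YD U V W g' f' = compose (carrier U) g' f'" "Ident YD V = (\<lambda>v\<in>carrier V. v)"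
  by (simp_all add: bimod_category_def yd_category_def)

lemma lin_hom: "module CC V \<Longrightarrow> module CC W \<Longrightarrow> linear_map V W f \<longleftrightarrow> lin V W f"
  by (simp add: lin_def)

lemma bm_hom_iff:
  assumes M: "bm M" and N: "bm N"
  shows "f \<in> Hom BM M N \<longleftrightarrow> f \<in> extensional (carrier M) \<and> lin M N f \<and>
    (\<forall>m\<in>carrier M. \<forall>a\<in>carrier A. f (lact M a m) = lact N a (f m)) \<and>
    (\<forall>m\<in>carrier M. \<forall>a\<in>carrier A. f (ract M m a) = ract N (f m) a) \<and>
    (\<forall>m\<in>carrier M. lcoact N (f m) = lsum M (A \<boxtimes> N) m (\<lambda>a u. pure A N a (f u))) \<and>
    (\<forall>m\<in>carrier M. rcoact N (f m) = rsum M (N \<boxtimes> H) m (\<lambda>u h. pure N H (f u) h))"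
proof (cases "lin M N f")
  case True
  then show ?thesis
    using bm_rules[OF M] tmap_bsum[OF lin_id[OF A.module_A] True] tmap_bsum[OF True lin_id[OF H.module_A]]
    by (simp add: bimod_category_def lin_hom[OF bm_module[OF M] bm_module[OF N]] id_def)
qed (simp add: bimod_category_def lin_hom[OF bm_module[OF M] bm_module[OF N]])

lemma yd_hom_iff:
  assumes V: "yd V" and W: "yd W"
  shows "f \<in> Hom YD V W \<longleftrightarrow> f \<in> extensional (carrier V) \<and> lin V W f \<and>
    (\<forall>v\<in>carrier V. \<forall>a\<in>carrier A. f (ract V v a) = ract W (f v) a) \<and>
    (\<forall>v\<in>carrier V. rcoact W (f v) = bsum V H (W \<boxtimes> H) (rcoact V v) (\<lambda>u h. pure W H (f u) h))"
proof (cases "lin V W f")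
  case True
  then show ?thesis
    using yd_rules[OF V] tmap_bsum[OF True lin_id[OF H.module_A]]
    by (simp add: yd_category_def lin_hom[OF yd_module'[OF V] yd_module'[OF W]] id_def)
qed (simp add: yd_category_def lin_hom[OF yd_module'[OF V] yd_module'[OF W]])

lemma bm_homD:
  assumes "bm M" "bm N" "f \<in> Hom BM M N"
  shows "lin M N f" "m \<in> carrier M \<Longrightarrow> a \<in> carrier A \<Longrightarrow> f (lact M a m) = lact N a (f m)"
    "m \<in> carrier M \<Longrightarrow> a \<in> carrier A \<Longrightarrow> f (ract M m a) = ract N (f m) a"
    "m \<in> carrier M \<Longrightarrow> lcoact N (f m) = lsum M (A \<boxtimes> N) m (\<lambda>a u. pure A N a (f u))"
    "m \<in> carrier M \<Longrightarrow> rcoact N (f m) = rsum M (N \<boxtimes> H) m (\<lambda>u h. pure N H (f u) h)"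
    "f \<in> extensional (carrier M)"
  using assms(3) unfolding bm_hom_iff[OF assms(1,2)] by blast+

lemma yd_homD:
  assumes "yd V" "yd W" "f \<in> Hom YD V W"
  shows "lin V W f" "v \<in> carrier V \<Longrightarrow> a \<in> carrier A \<Longrightarrow> f (ract V v a) = ract W (f v) a"
    "v \<in> carrier V \<Longrightarrow> rcoact W (f v) = bsum V H (W \<boxtimes> H) (rcoact V v) (\<lambda>u h. pure W H (f u) h)"
    "f \<in> extensional (carrier V)"
  using assms(3) unfolding yd_hom_iff[OF assms(1,2)] by blast+

lemma bm_id_hom: "bm M \<Longrightarrow> (\<lambda>m\<in>carrier M. m) \<in> Hom BM M M"
  by (simp add: bm_hom_iff hh_rules bm_rules)

lemma yd_id_hom: "yd V \<Longrightarrow> (\<lambda>v\<in>carrier V. v) \<in> Hom YD V V"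
  by (simp add: yd_hom_iff hh_rules yd_rules)

lemma bm_comp_hom:
  assumes XYZ: "bm X" "bm Y" "bm Z" and f: "f \<in> Hom BM X Y" and g: "g \<in> Hom BM Y Z"
  shows "compose (carrier X) g f \<in> Hom BM X Z"
proof -
  note F = bm_homD[OF XYZ(1,2) f] and G = bm_homD[OF XYZ(2,3) g]
  show ?thesis unfolding bm_hom_iff[OF XYZ(1,3)]
    by (simp add: compose_def F G hh_rules bm_rules[OF XYZ(1)] bm_rules[OF XYZ(2)] bm_rules[OF XYZ(3)]
      lin_rules[OF F(1)] lin_rules[OF G(1)])
qed

lemma yd_comp_hom:
  assumes XYZ: "yd X" "yd Y" "yd Z" and f: "f \<in> Hom YD X Y" and g: "g \<in> Hom YD Y Z"
  shows "compose (carrier X) g f \<in> Hom YD X Z"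
proof -
  note F = yd_homD[OF XYZ(1,2) f] and G = yd_homD[OF XYZ(2,3) g]
  show ?thesis unfolding yd_hom_iff[OF XYZ(1,3)]
    by (simp add: compose_def F G hh_rules yd_rules[OF XYZ(1)] yd_rules[OF XYZ(2)] yd_rules[OF XYZ(3)]
      lin_rules[OF F(1)] lin_rules[OF G(1)])
qed

lemma category_BM: "is_category (BM :: (('a, 'h, 'v) bi_data, 'v \<Rightarrow> 'v) category)"
  unfolding is_category_def
proof (intro conjI ballI)
  fix X Y :: "('a, 'h, 'v) bi_data" and f assume XY: "X \<in> Obj BM" "Y \<in> Obj BM" "f \<in> Hom BM X Y"
  have "bm X" "bm Y" using XY by (simp_all add: Obj_simps)
  note f = bm_homD[OF this XY(3)]
  show "Comp BM X Y Y (Ident BM Y) f = f" "Comp BM X X Y f (Ident BM X) = f"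
    using f(6) linD(3)[OF f(1)] by (auto simp: Comp_simps compose_def fun_eq_iff extensional_def)
  show "Comp BM X Z W h (Comp BM X Y Z g f) = Comp BM X Y W (Comp BM Y Z W h g) f" for Z W g h
    using linD(3)[OF f(1)] by (auto simp: Comp_simps compose_def)
qed (simp_all add: Obj_simps Comp_simps bm_id_hom bm_comp_hom)

lemma category_YD: "is_category (YD :: (('a, 'h, 'v) right_data, 'v \<Rightarrow> 'v) category)"
  unfolding is_category_def
proof (intro conjI ballI)
  fix X Y :: "('a, 'h, 'v) right_data" and f assume XY: "X \<in> Obj YD" "Y \<in> Obj YD" "f \<in> Hom YD X Y"
  have "yd X" "yd Y" using XY by (simp_all add: Obj_simps)
  note f = yd_homD[OF this XY(3)]
  show "Comp YD X Y Y (Ident YD Y) f = f" "Comp YD X X Y f (Ident YD X) = f"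
    using f(4) linD(3)[OF f(1)] by (auto simp: Comp_simps compose_def fun_eq_iff extensional_def)
  show "Comp YD X Z W h (Comp YD X Y Z g f) = Comp YD X Y W (Comp YD Y Z W h g) f" for Z W g h
    using linD(3)[OF f(1)] by (auto simp: Comp_simps compose_def)
qed (simp_all add: Obj_simps Comp_simps yd_id_hom yd_comp_hom)

lemma lin_inverse:
  assumes f: "lin V W f" and g: "\<And>w. w \<in> carrier W \<Longrightarrow> g w \<in> carrier V \<and> f (g w) = w"
    and gf: "\<And>v. v \<in> carrier V \<Longrightarrow> g (f v) = v"
  shows "lin W V g"
proof (rule linI)
  note F = linD[OF f]
  show "module CC W" "module CC V" by (fact F)+
  fix x c assume x: "x \<in> carrier W"
  show "g x \<in> carrier V" using g x by blast
  show "g (c \<odot>\<^bsub>W\<^esub> x) = c \<odot>\<^bsub>V\<^esub> g x"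
    using F(5)[of "g x" c] g[OF x] gf[of "c \<odot>\<^bsub>V\<^esub> g x"] module_smult_closed[OF F(1)] by simp
  fix y assume y: "y \<in> carrier W"
  show "g (x \<oplus>\<^bsub>W\<^esub> y) = g x \<oplus>\<^bsub>V\<^esub> g y"
    using F(4)[of "g x" "g y"] g[OF x] g[OF y] gf[of "g x \<oplus>\<^bsub>V\<^esub> g y"] module_add_closed[OF F(1)] by simp
qed

text \<open>The inverse of a bijective morphism preserves all structures automatically, so only a
  set-theoretic inverse has to be supplied.\<close>

lemma bm_isoI:
  assumes M: "bm M" and N: "bm N" and f: "f \<in> Hom BM M N"
    and g: "\<And>w. w \<in> carrier N \<Longrightarrow> g w \<in> carrier M \<and> f (g w) = w"
    and gf: "\<And>v. v \<in> carrier M \<Longrightarrow> g (f v) = v"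
  shows "is_iso BM M N f"
proof -
  note F = bm_homD[OF M N f]
  have lg: "lin N M g" by (rule lin_inverse[OF F(1) g gf])
  note R = hh_rules bm_rules[OF M] bm_rules[OF N] lin_rules[OF F(1)] lin_rules[OF lg]
  have "(\<lambda>x\<in>carrier N. g x) \<in> Hom BM N M"
    unfolding bm_hom_iff[OF N M]
  proof (intro conjI ballI)
    show "lin N M (\<lambda>x\<in>carrier N. g x)" using lg by simp
    fix n assume n: "n \<in> carrier N"
    have n': "g n \<in> carrier M" "f (g n) = n" using g n by auto
    show "restrict g (carrier N) (lact N a n) = lact M a (restrict g (carrier N) n)" if a: "a \<in> carrier A" for a
      using F(2)[OF n'(1) a] n' n a gf[of "lact M a (g n)"] by (simp add: R)
    show "restrict g (carrier N) (ract N n a) = ract M (restrict g (carrier N) n) a" if a: "a \<in> carrier A" for a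
      using F(3)[OF n'(1) a] n' n a gf[of "ract M (g n) a"] by (simp add: R)
    \<comment> \<open>Colinearity of \<open>f\<close> at \<open>g n\<close>, mapped by
      \<open>id \<otimes> g\<close>; the composite of \<open>g\<close> after \<open>f\<close>
      disappears on the module leg.\<close>
    have "lsum N (A \<boxtimes> M) n (\<lambda>a u. pure A M a (g u)) = lcoact M (g n)"
      using F(4)[OF n'(1)] n' by (simp add: R gf)
    then show "lcoact M (restrict g (carrier N) n) = lsum N (A \<boxtimes> M) n (\<lambda>a u. pure A M a (restrict g (carrier N) u))"
      using n by simp
    have "rsum N (M \<boxtimes> H) n (\<lambda>u h. pure M H (g u) h) = rcoact M (g n)"
      using F(5)[OF n'(1)] n' by (simp add: R gf)
    then show "rcoact M (restrict g (carrier N) n) = rsum N (M \<boxtimes> H) n (\<lambda>u h. pure M H (restrict g (carrier N) u) h)"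
      using n by simp
  qed simp
  moreover have "compose (carrier M) (\<lambda>x\<in>carrier N. g x) f = (\<lambda>m\<in>carrier M. m)"
    "compose (carrier N) f (\<lambda>x\<in>carrier N. g x) = (\<lambda>m\<in>carrier N. m)"
    using g gf by (auto simp: compose_def fun_eq_iff linD(3)[OF F(1)])
  ultimately show ?thesis using f unfolding is_iso_def Comp_simps by blast
qed

lemma yd_isoI:
  assumes M: "yd V" and N: "yd W" and f: "f \<in> Hom YD V W"
    and g: "\<And>w. w \<in> carrier W \<Longrightarrow> g w \<in> carrier V \<and> f (g w) = w"
    and gf: "\<And>v. v \<in> carrier V \<Longrightarrow> g (f v) = v"
  shows "is_iso YD V W f"
proof -
  note F = yd_homD[OF M N f]
  have lg: "lin W V g" by (rule lin_inverse[OF F(1) g gf])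
  note R = hh_rules yd_rules[OF M] yd_rules[OF N] lin_rules[OF F(1)] lin_rules[OF lg]
  have "(\<lambda>x\<in>carrier W. g x) \<in> Hom YD W V"
    unfolding yd_hom_iff[OF N M]
  proof (intro conjI ballI)
    show "lin W V (\<lambda>x\<in>carrier W. g x)" using lg by simp
    fix n assume n: "n \<in> carrier W"
    have n': "g n \<in> carrier V" "f (g n) = n" using g n by auto
    show "restrict g (carrier W) (ract W n a) = ract V (restrict g (carrier W) n) a" if a: "a \<in> carrier A" for a
      using F(2)[OF n'(1) a] n' n a gf[of "ract V (g n) a"] by (simp add: R)
    have "bsum W H (V \<boxtimes> H) (rcoact W n) (\<lambda>u h. pure V H (g u) h) = rcoact V (g n)"
      using F(3)[OF n'(1)] n' by (simp add: R gf)
    then show "rcoact V (restrict g (carrier W) n) = bsum W H (V \<boxtimes> H) (rcoact W n) (\<lambda>u h. pure V H (restrict g (carrier W) u) h)"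
      using n by simp
  qed simp
  moreover have "compose (carrier V) (\<lambda>x\<in>carrier W. g x) f = (\<lambda>m\<in>carrier V. m)"
    "compose (carrier W) f (\<lambda>x\<in>carrier W. g x) = (\<lambda>m\<in>carrier W. m)"
    using g gf by (auto simp: compose_def fun_eq_iff linD(3)[OF F(1)])
  ultimately show ?thesis using f unfolding is_iso_def Comp_simps by blast
qed

section \<open>The two functors\<close>

abbreviation "frh V W f \<equiv> on_hom (free_functor A H p) V W f"
abbreviation "qth M N f \<equiv> on_hom (quot_functor A H p) M N f"

lemma on_obj_simps: "on_obj (free_functor A H p) V = fr V" "on_obj (quot_functor A H p) M = qt M"
  by (simp_all add: free_functor_def quot_functor_def)

text \<open>Stated for linear \<open>f\<close>, since the formula on pure tensors involves nothing
  else; compatibility with the structures is added in \<open>frh_hom\<close>.\<close>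

lemma frh:
  assumes V: "yd V" and W: "yd W" and f: "lin V W f"
  shows lin_frh: "lin (fr V) (fr W) (frh V W f)"
    and frh_upure: "a \<in> carrier A \<Longrightarrow> v \<in> carrier V \<Longrightarrow> frh V W f (upure A V a v) = upure A W a (f v)"
proof -
  note [simp] = free_all_rules[OF V] free_all_rules[OF W] lin_rules[OF f]
  have 1: "frh V W f x = bsum A V (fr W) (decode A V x) (\<lambda>a v. upure A W a (f v))" if "x \<in> carrier (fr V)" for x
    using that by (simp add: free_functor_def)
  show "lin (fr V) (fr W) (frh V W f)" by (simp add: 1)
  show "frh V W f (upure A V a v) = upure A W a (f v)" if "a \<in> carrier A" "v \<in> carrier V"
    using that by (simp add: 1)
qed

lemma frh_hom:
  assumes V: "yd V" and W: "yd W" and f: "f \<in> Hom YD V W"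
  shows "frh V W f \<in> Hom BM (fr V) (fr W)"
proof -
  note F = yd_homD[OF V W f]
  note R = free_all_rules[OF V] free_all_rules[OF W] lin_rules[OF F(1)] lin_rules[OF lin_frh[OF V W F(1)]]
    frh_upure[OF V W F(1)] F(2,3)
  note ext = free_extB[OF yd_module'[OF V]]
  have "\<forall>m\<in>carrier (fr V). frh V W f (lact (fr V) a m) = lact (fr W) a (frh V W f m)" if "a \<in> carrier A" for a
    by (rule ext[where X = "fr W"]) (use that in \<open>simp_all add: R\<close>)
  moreover have "\<forall>m\<in>carrier (fr V). frh V W f (ract (fr V) m a) = ract (fr W) (frh V W f m) a" if "a \<in> carrier A" for a
    by (rule ext[where X = "fr W"]) (use that in \<open>simp_all add: R\<close>)
  moreover have "\<forall>m\<in>carrier (fr V). lcoact (fr W) (frh V W f m) =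
      lsum (fr V) (A \<boxtimes> fr W) m (\<lambda>a u. pure A (fr W) a (frh V W f u))"
    by (rule ext[where X = "A \<boxtimes> fr W"]) (simp_all add: R)
  moreover have "\<forall>m\<in>carrier (fr V). rcoact (fr W) (frh V W f m) =
      rsum (fr V) (fr W \<boxtimes> H) m (\<lambda>u h. pure (fr W) H (frh V W f u) h)"
    by (rule ext[where X = "fr W \<boxtimes> H"]) (simp_all add: R)
  moreover have "frh V W f \<in> extensional (carrier (fr V))" by (simp add: free_functor_def)
  ultimately show ?thesis
    using lin_frh[OF V W F(1)] by (simp add: bm_hom_iff[OF bm_free[OF V] bm_free[OF W]])
qed

lemma hom_ext: "f \<in> extensional X \<Longrightarrow> g \<in> extensional X \<Longrightarrow> \<forall>x\<in>X. f x = g x \<Longrightarrow> f = g"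
  by (auto intro: extensionalityI)

lemma functor_free:
  "is_functor (YD :: (('a, 'h, ('a, 'x) univ) right_data, ('a, 'x) univ \<Rightarrow> ('a, 'x) univ) category) BM (free_functor A H p)"
proof -
  have "frh V V (\<lambda>v\<in>carrier V. v) = (\<lambda>x\<in>carrier (fr V). x)"
    if V: "yd V" for V :: "('a, 'h, ('a, 'x) univ) right_data"
  proof (rule hom_ext)
    have 1: "lin V V (\<lambda>v\<in>carrier V. v)" by (simp add: free_all_rules[OF V])
    show "\<forall>x\<in>carrier (fr V). frh V V (\<lambda>v\<in>carrier V. v) x = (\<lambda>x\<in>carrier (fr V). x) x"
      by (rule free_extB[where X = "fr V"]) (simp_all add: free_all_rules[OF V] frh[OF V V 1])
  qed (simp_all add: free_functor_def)
  moreover have "frh U W (compose (carrier U) g f) = compose (carrier (fr U)) (frh V W g) (frh U V f)"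
    if U: "yd U" "yd V" "yd W" and fg: "f \<in> Hom YD U V" "g \<in> Hom YD V W"
    for U V W :: "('a, 'h, ('a, 'x) univ) right_data" and f g
  proof (rule hom_ext)
    note F = yd_homD(1)[OF U(1,2) fg(1)] and G = yd_homD(1)[OF U(2,3) fg(2)]
    note R = free_all_rules[OF U(1)] free_all_rules[OF U(2)] free_all_rules[OF U(3)] lin_rules[OF F] lin_rules[OF G]
      lin_rules[OF lin_frh[OF U(1,2) F]] lin_rules[OF lin_frh[OF U(2,3) G]]
      frh_upure[OF U(1,2) F] frh_upure[OF U(2,3) G]
    have 1: "lin U W (compose (carrier U) g f)" by (simp add: compose_eq R)
    show "\<forall>x\<in>carrier (fr U). frh U W (compose (carrier U) g f) x = compose (carrier (fr U)) (frh V W g) (frh U V f) x"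
      by (rule free_extB[where X = "fr W"]) (simp_all add: R lin_rules[OF lin_frh[OF U(1,3) 1]] frh_upure[OF U(1,3) 1] compose_eq)
  qed (simp_all add: free_functor_def compose_def)
  ultimately show ?thesis
    unfolding is_functor_def
    by (intro conjI ballI category_BM category_YD) (simp_all add: Obj_simps Comp_simps on_obj_simps frh_hom bm_free)
qed

text \<open>Left \<open>A\<close>-linearity of \<open>f\<close> makes the composite of
  \<open>f\<close> with the class map turn the action into the counit, so it descends by
  \<open>lin_quot\<close>.\<close>

lemma qth:
  assumes M: "bm M" and N: "bm N" and f: "f \<in> Hom BM M N"
  shows lin_qth: "lin (qt M) (qt N) (qth M N f)"
    and qth_cls: "m \<in> carrier M \<Longrightarrow> qth M N f (cls A M m) = cls A N (f m)"
proof -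
  note F = bm_homD[OF M N f]
  note R = quot_all_rules[OF M] quot_all_rules[OF N] lin_rules[OF F(1)] F(2,3)
  have 1: "qth M N f x = cls A N (f x)" if "x \<in> carrier (qt M)" for x
    using that by (simp add: quot_functor_def)
  have 2: "lin M (qt N) (\<lambda>m. cls A N (f m))" by (simp add: R)
  have 3: "cls A N (f (lact M a m)) = counit A a \<odot>\<^bsub>qt N\<^esub> cls A N (f m)" if "a \<in> carrier A" "m \<in> carrier M" for a m
    using that by (simp add: R)
  have "lin (qt M) (qt N) (\<lambda>m. cls A N (f m))" by (rule lin_quot[OF M 2 3])
  then show "lin (qt M) (qt N) (qth M N f)" by (simp add: 1)
  show "qth M N f (cls A M m) = cls A N (f m)" if "m \<in> carrier M"
    using cls_eqI[OF M 2 3 that] that by (simp add: 1 R)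
qed

lemma qth_hom:
  assumes M: "bm M" and N: "bm N" and f: "f \<in> Hom BM M N"
  shows "qth M N f \<in> Hom YD (qt M) (qt N)"
proof -
  note F = bm_homD[OF M N f]
  note R = quot_all_rules[OF M] quot_all_rules[OF N] lin_rules[OF F(1)] F lin_rules[OF lin_qth[OF M N f]] qth_cls[OF M N f]
  have "qth M N f \<in> extensional (carrier (qt M))" by (simp add: quot_functor_def)
  then show ?thesis
    unfolding yd_hom_iff[OF yd_quot[OF M] yd_quot[OF N]] quot_ball[OF M]
    by (simp add: R)
qed

lemma functor_quot:
  "is_functor (BM :: (('a, 'h, 'v) bi_data, 'v \<Rightarrow> 'v) category) YD (quot_functor A H p)"
proof -
  have "qth M M (\<lambda>m\<in>carrier M. m) = (\<lambda>x\<in>carrier (qt M). x)" if M: "bm M" for M :: "('a, 'h, 'v) bi_data"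
  proof (rule hom_ext)
    show "\<forall>x\<in>carrier (qt M). qth M M (\<lambda>m\<in>carrier M. m) x = (\<lambda>x\<in>carrier (qt M). x) x"
      by (simp add: quot_functor_def quotD[OF M])
  qed (simp_all add: quot_functor_def)
  moreover have "qth L N (compose (carrier L) g f) = compose (carrier (qt L)) (qth M N g) (qth L M f)"
    if L: "bm L" "bm M" "bm N" and fg: "f \<in> Hom BM L M" "g \<in> Hom BM M N"
    for L M N :: "('a, 'h, 'v) bi_data" and f g
  proof (rule hom_ext)
    note F = bm_homD(1)[OF L(1,2) fg(1)] and G = bm_homD(1)[OF L(2,3) fg(2)]
    have gf: "compose (carrier L) g f \<in> Hom BM L N"
      by (rule bm_comp_hom[OF L fg])
    show "\<forall>x\<in>carrier (qt L). qth L N (compose (carrier L) g f) x = compose (carrier (qt L)) (qth M N g) (qth L M f) x"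
      unfolding quot_ball[OF L(1)]
      by (simp add: qth_cls[OF L(1,3) gf] qth_cls[OF L(1,2) fg(1)] qth_cls[OF L(2,3) fg(2)] compose_eq
        quot_all_rules[OF L(1)] linD(3)[OF F])
  qed (simp_all add: quot_functor_def compose_def)
  ultimately show ?thesis
    unfolding is_functor_def
    by (intro conjI ballI category_BM category_YD) (simp_all add: Obj_simps Comp_simps on_obj_simps qth_hom yd_quot)
qed

section \<open>The unit\<close>

abbreviation "un M \<equiv> unit_map A H p M"

text \<open>The projection \<open>P\<close> onto the left coinvariants, through which the inverse of the unit is defined.\<close>

definition coinv :: "('a, 'h, 'v) bi_data \<Rightarrow> 'v \<Rightarrow> 'v"
  where "coinv M f = lsum M M f (\<lambda>a m. lact M (antipode A a) m)"

context
  fixes M :: "('a, 'h, ('a, 'x) univ) bi_data"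
  assumes M: "bicomodule_bimodule A H p M"
begin

lemmas un_rules = quot_all_rules[OF M] free_all_rules[OF yd_quot[OF M]]

lemma un_eq:
  assumes "f \<in> carrier M"
  shows "un M f = lsum M (fr (qt M)) f (\<lambda>a g. upure A (qt M) a (cls A M g))"
  using assms by (simp add: unit_map_def Let_def un_rules)

lemma lin_un: "lin M (fr (qt M)) (un M)"
  by (simp add: un_eq un_rules)

text \<open>In the coaction of \<open>af\<close> the second leg of \<open>a\<close> acts inside the
  class and becomes a scalar; the counit axiom returns \<open>a\<close> in the first tensor
  factor.\<close>

lemma un_lact:
  assumes a: "a \<in> carrier A" and f: "f \<in> carrier M"
  shows "un M (lact M a f) = lact (fr (qt M)) a (un M f)"
proof -
  note [simp] = un_rules
  let ?F = "fr (qt M)"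
  have 1: "A.sw ?F a (\<lambda>a\<^sub>1 a\<^sub>2. lsum M ?F f (\<lambda>b g. counit A a\<^sub>2 \<odot>\<^bsub>?F\<^esub> upure A (qt M) (a\<^sub>1 \<otimes>\<^bsub>A\<^esub> b) (cls A M g))) =
    lsum M ?F f (\<lambda>b g. upure A (qt M) (a \<otimes>\<^bsub>A\<^esub> b) (cls A M g))"
    using A.counit_right_bsum[of ?F "\<lambda>a. lsum M ?F f (\<lambda>b g. upure A (qt M) (a \<otimes>\<^bsub>A\<^esub> b) (cls A M g))" a] a f
    by simp
  show ?thesis using a f 1 by (simp add: un_eq bm_lcoact_lact[OF M])
qed

lemma un_hom: "un M \<in> Hom BM M (fr (qt M))"
proof -
  note [simp] = un_rules
  let ?F = "fr (qt M)" and ?Q = "qt M" and ?Y = "fr (qt M) \<boxtimes> H"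
  have "un M (ract M f a) = ract ?F (un M f) a" if "f \<in> carrier M" "a \<in> carrier A" for f a
    using that by (simp add: un_eq bm_lcoact_ract[OF M])
  moreover have "lcoact ?F (un M f) = lsum M (A \<boxtimes> ?F) f (\<lambda>a u. pure A ?F a (un M u))" if "f \<in> carrier M" for f
    using that by (simp add: un_eq bm_lassoc[OF M])
  moreover have "rcoact ?F (un M f) = rsum M ?Y f (\<lambda>u h. pure ?F H (un M u) h)" if f: "f \<in> carrier M" for f
  proof -
    \<comment> \<open>Right colinearity: the coaction of the first tensor factor contributes
      \<open>p(b)\<close>, the coaction of the class contributes \<open>p(S(c))\<close>, and these
      consecutive legs of the left coaction cancel.\<close>
    have 1: "lsum M ?Y x (\<lambda>b n. lsum M ?Y n (\<lambda>c m. rsum M ?Y m (\<lambda>u h.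
        pure ?F H (upure A ?Q a (cls A M u)) (p b \<otimes>\<^bsub>H\<^esub> (p (antipode A c) \<otimes>\<^bsub>H\<^esub> h))))) =
      rsum M ?Y x (\<lambda>u h. pure ?F H (upure A ?Q a (cls A M u)) h)"
      if "x \<in> carrier M" "a \<in> carrier A" for x a
      using lsum_antipode_right[OF M, of ?Y "\<lambda>w m. rsum M ?Y m (\<lambda>u h.
        pure ?F H (upure A ?Q a (cls A M u)) (p w \<otimes>\<^bsub>H\<^esub> h))" x] that by (simp add: H.m_assoc)
    show ?thesis using f by (simp add: un_eq bm_lassoc[OF M] bm_bicomodule[OF M] 1)
  qed
  moreover have "un M \<in> extensional (carrier M)" by (simp add: unit_map_def Let_def)
  ultimately show ?thesis
    unfolding bm_hom_iff[OF M bm_free[OF yd_quot[OF M]]] using lin_un un_lact by simp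
qed

lemma lin_coinv: "lin M M (coinv M)"
  by (simp add: coinv_def un_rules)

lemma coinv_lact:
  assumes b: "b \<in> carrier A" and f: "f \<in> carrier M"
  shows "coinv M (lact M b f) = counit A b \<odot>\<^bsub>M\<^esub> coinv M f"
proof -
  note [simp] = un_rules
  have "coinv M (lact M b f) = A.sw M b (\<lambda>b\<^sub>1 b\<^sub>2. lsum M M f (\<lambda>a m. lact M (antipode A a \<otimes>\<^bsub>A\<^esub> (antipode A b\<^sub>1 \<otimes>\<^bsub>A\<^esub> b\<^sub>2)) m))"
    using b f by (simp add: coinv_def bm_lcoact_lact[OF M] A.antipode_mult)
  also have "\<dots> = counit A b \<odot>\<^bsub>M\<^esub> coinv M f"
    using A.antipode_left_bsum[of M "\<lambda>w. lsum M M f (\<lambda>a m. lact M (antipode A a \<otimes>\<^bsub>A\<^esub> w) m)" b] b f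
    by (simp add: coinv_def)
  finally show ?thesis .
qed

lemma lin_coinv_quot: "lin (qt M) M (coinv M)"
  by (rule lin_quot[OF M lin_coinv coinv_lact])

lemma coinv_cls: "f \<in> carrier M \<Longrightarrow> coinv M (cls A M f) = coinv M f"
  by (rule cls_eqI[OF M lin_coinv coinv_lact])

lemma un_coinv:
  assumes f: "f \<in> carrier M"
  shows "un M (coinv M f) = upure A (qt M) \<one>\<^bsub>A\<^esub> (cls A M f)"
proof -
  note [simp] = un_rules lin_rules[OF lin_un]
  let ?F = "fr (qt M)"
  have "un M (coinv M f) = lsum M ?F f (\<lambda>a m. lact ?F (antipode A a) (un M m))"
    using f by (simp add: coinv_def un_lact)
  also have "\<dots> = lsum M ?F f (\<lambda>a m. lsum M ?F m (\<lambda>b u. upure A (qt M) (antipode A a \<otimes>\<^bsub>A\<^esub> b) (cls A M u)))"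
    using f by (simp add: un_eq)
  also have "\<dots> = upure A (qt M) \<one>\<^bsub>A\<^esub> (cls A M f)"
    using lsum_antipode_left[OF M, of ?F "\<lambda>w u. upure A (qt M) w (cls A M u)" f] f by simp
  finally show ?thesis .
qed

lemma un_iso: "is_iso BM M (fr (qt M)) (un M)"
proof (rule bm_isoI[OF M bm_free[OF yd_quot[OF M]] un_hom])
  note [simp] = un_rules lin_rules[OF lin_un] lin_rules[OF lin_coinv_quot]
  let ?F = "fr (qt M)"
  \<comment> \<open>\<open>coinv M\<close> is evaluated at the chosen representative
    \<open>q\<close>; that this is linear on the quotient is \<open>lin_coinv_quot\<close>.\<close>
  define g where "g = (\<lambda>x. bsum A (qt M) M (decode A (qt M) x) (\<lambda>a q. lact M a (coinv M q)))"
  have g: "lin ?F M g" unfolding g_def by simp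
  have gu: "g (upure A (qt M) a q) = lact M a (coinv M q)" if "a \<in> carrier A" "q \<in> carrier (qt M)" for a q
    unfolding g_def using that by simp
  note [simp] = lin_rules[OF g]
  have "un M (g (upure A (qt M) a q)) = upure A (qt M) a q" if "a \<in> carrier A" "q \<in> carrier (qt M)" for a q
    using that by (auto simp: gu un_lact carrier_quot[OF M] coinv_cls un_coinv linD(3)[OF lin_coinv])
  then have "\<forall>x\<in>carrier ?F. un M (g x) = x"
    by (intro free_extB[where X = ?F]) simp_all
  then show "g w \<in> carrier M \<and> un M (g w) = w" if "w \<in> carrier ?F" for w
    using that by simp
  show "g (un M f) = f" if "f \<in> carrier M" for f
  proof -
    have "g (un M f) = lsum M M f (\<lambda>a m. lsum M M m (\<lambda>b u. lact M (a \<otimes>\<^bsub>A\<^esub> antipode A b) u))"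
      \<comment> \<open>\<open>coinv_cls\<close> first removes the representative under
        \<open>coinv\<close>; only then is \<open>coinv\<close> unfolded.\<close>
      using that by (simp add: un_eq gu coinv_cls) (simp add: coinv_def)
    also have "\<dots> = f"
      using lsum_antipode_right[OF M, of M "lact M" f] that by simp
    finally show ?thesis .
  qed
qed

end

section \<open>The counit\<close>

abbreviation "co V \<equiv> counit_map A H p V"

context
  fixes V :: "('a, 'h, ('a, 'x) univ) right_data"
  assumes V: "yd_module A H p V"
begin

lemmas co_rules = free_all_rules[OF V] quot_all_rules[OF bm_free[OF V]]

text \<open>The counit before passage to the quotient. It is linear on all of
  \<open>A \<otimes> V\<close> and can be tested on pure tensors, while the elements of
  \<open>qt (fr V)\<close> are chosen representatives without a visible form.\<close>

definition eps :: "('a, 'x) univ \<Rightarrow> ('a, 'x) univ"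
  where "eps x = bsum A V V (decode A V x) (\<lambda>a v. counit A a \<odot>\<^bsub>V\<^esub> v)"

lemma lin_eps: "lin (fr V) V eps"
  by (simp add: eps_def co_rules)

lemma eps_upure: "a \<in> carrier A \<Longrightarrow> v \<in> carrier V \<Longrightarrow> eps (upure A V a v) = counit A a \<odot>\<^bsub>V\<^esub> v"
  by (simp add: eps_def co_rules)

lemma eps_lact:
  assumes "b \<in> carrier A" "x \<in> carrier (fr V)"
  shows "eps (lact (fr V) b x) = counit A b \<odot>\<^bsub>V\<^esub> eps x"
proof -
  have "\<forall>x\<in>carrier (fr V). eps (lact (fr V) b x) = counit A b \<odot>\<^bsub>V\<^esub> eps x"
    by (rule free_extB[where X = V]) (use assms in \<open>simp_all add: co_rules lin_rules[OF lin_eps] eps_upure smult_smult\<close>)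
  then show ?thesis using assms by blast
qed

lemma co_eq: "x \<in> carrier (qt (fr V)) \<Longrightarrow> co V x = eps x"
  using quotD(1)[OF bm_free[OF V]] by (simp add: counit_map_def eps_def co_rules tsum_decode A.bilin_counit_left)

lemma lin_co: "lin (qt (fr V)) V (co V)"
  using lin_quot[OF bm_free[OF V] lin_eps eps_lact] by (simp add: co_eq)

lemma co_cls: "x \<in> carrier (fr V) \<Longrightarrow> co V (cls A (fr V) x) = eps x"
  using cls_eqI[OF bm_free[OF V] lin_eps eps_lact] by (simp add: co_eq co_rules)

lemma co_hom: "co V \<in> Hom YD (qt (fr V)) V"
proof -
  note [simp] = co_rules lin_rules[OF lin_co] lin_rules[OF lin_eps] co_cls eps_upure
  let ?F = "fr V" and ?Q = "qt (fr V)" and ?Y = "V \<boxtimes> H"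
  note ext = free_extB[OF yd_module'[OF V]]
  have "\<forall>x\<in>carrier ?F. eps (ract ?F x a) = ract V (eps x) a" if a: "a \<in> carrier A" for a
  proof (rule ext[where X = V])
    fix b v assume bv: "b \<in> carrier A" "v \<in> carrier V"
    show "eps (ract ?F (upure A V b v) a) = ract V (eps (upure A V b v)) a"
      using a bv A.counit_left_bsum[of V "ract V v" a] by (simp add: smult_smult[symmetric])
  qed (use a in simp_all)
  then have "\<forall>x\<in>carrier ?Q. \<forall>a\<in>carrier A. co V (ract ?Q x a) = ract V (co V x) a"
    unfolding quot_ball[OF bm_free[OF V]] by simp
  moreover have "\<forall>x\<in>carrier ?F. rcoact V (eps x) =
     bsum ?Q H ?Y (rcoact ?Q (cls A ?F x)) (\<lambda>u h. pure V H (co V u) h)"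
  proof (rule ext[where X = ?Y])
    fix b v assume bv: "b \<in> carrier A" "v \<in> carrier V"
    \<comment> \<open>The coaction of the class of \<open>b \<otimes> v\<close> has the legs
      \<open>S(b\<^sub>1)\<close> and \<open>b\<^sub>3\<close> in \<open>H\<close>. Here the counit
      disposes of the middle leg; the antipode axiom for \<open>b\<close> then cancels the two
      others.\<close>
    have 1: "A.sw ?Y z (\<lambda>x y. counit A x \<odot>\<^bsub>?Y\<^esub> bsum V H ?Y (rcoact V v) (\<lambda>v\<^sub>0 v\<^sub>1. pure V H v\<^sub>0 (w \<otimes>\<^bsub>H\<^esub> (p y \<otimes>\<^bsub>H\<^esub> v\<^sub>1))))
      = bsum V H ?Y (rcoact V v) (\<lambda>v\<^sub>0 v\<^sub>1. pure V H v\<^sub>0 (w \<otimes>\<^bsub>H\<^esub> (p z \<otimes>\<^bsub>H\<^esub> v\<^sub>1)))"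
      if "z \<in> carrier A" "w \<in> carrier H" for z w
      by (rule A.counit_left_bsum) (use that bv in simp_all)
    show "rcoact V (eps (upure A V b v)) =
      bsum ?Q H ?Y (rcoact ?Q (cls A ?F (upure A V b v))) (\<lambda>u h. pure V H (co V u) h)"
      using bv A.antipode_left_bsum[of ?Y "\<lambda>w. bsum V H ?Y (rcoact V v) (\<lambda>v\<^sub>0 v\<^sub>1. pure V H v\<^sub>0 (p w \<otimes>\<^bsub>H\<^esub> v\<^sub>1))" b]
      by (simp add: 1 H.m_assoc)
  qed simp_all
  then have "\<forall>x\<in>carrier ?Q. rcoact V (co V x) = bsum ?Q H ?Y (rcoact ?Q x) (\<lambda>u h. pure V H (co V u) h)"
    unfolding quot_ball[OF bm_free[OF V]] by simp
  moreover have "co V \<in> extensional (carrier ?Q)" by (simp add: counit_map_def)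
  ultimately show ?thesis
    unfolding yd_hom_iff[OF yd_quot[OF bm_free[OF V]] V] using lin_co by blast
qed

lemma co_iso: "is_iso YD (qt (fr V)) V (co V)"
proof (rule yd_isoI[OF yd_quot[OF bm_free[OF V]] V co_hom])
  note [simp] = co_rules lin_rules[OF lin_co] lin_rules[OF lin_eps] co_cls eps_upure
  let ?F = "fr V" and ?Q = "qt (fr V)"
  let ?g = "\<lambda>v. cls A ?F (upure A V \<one>\<^bsub>A\<^esub> v)"
  show "?g v \<in> carrier ?Q \<and> co V (?g v) = v" if "v \<in> carrier V" for v
    using that module.smult_one[OF yd_module'[OF V], of v] by simp
  \<comment> \<open>\<open>a \<otimes> v\<close> is \<open>a\<close> acting on
    \<open>1 \<otimes> v\<close>, so its class is the multiple of the class of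
    \<open>1 \<otimes> v\<close> by the counit of \<open>a\<close>.\<close>
  have "?g (eps (upure A V a v)) = cls A ?F (upure A V a v)" if "a \<in> carrier A" "v \<in> carrier V" for a v
    using cls_lact[OF bm_free[OF V], of a "upure A V \<one>\<^bsub>A\<^esub> v"] that by simp
  then have "\<forall>x\<in>carrier ?F. ?g (eps x) = cls A ?F x"
    by (intro free_extB[where X = ?Q] allI) (simp_all del: eps_upure)
  then have "\<forall>x\<in>carrier ?Q. ?g (co V x) = x"
    unfolding quot_ball[OF bm_free[OF V]] by simp
  then show "?g (co V x) = x" if "x \<in> carrier ?Q" for x
    using that by blast
qed

end

section \<open>Naturality and the triangle identities\<close>

lemma un_natural:
  assumes M: "bm M" and N: "bm N" and f: "f \<in> Hom BM M N" and m: "m \<in> carrier M"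
  shows "un N (f m) = frh (qt M) (qt N) (qth M N f) (un M m)"
proof -
  note F = bm_homD[OF M N f]
  note G = lin_qth[OF M N f]
  show ?thesis
    using m by (simp add: un_eq[OF M] un_eq[OF N] un_rules[OF M] un_rules[OF N] F lin_rules[OF F(1)] lin_rules[OF G]
      lin_rules[OF lin_frh[OF yd_quot[OF M] yd_quot[OF N] G]] frh_upure[OF yd_quot[OF M] yd_quot[OF N] G]
      qth_cls[OF M N f])
qed

lemma co_natural:
  assumes V: "yd V" and W: "yd W" and f: "f \<in> Hom YD V W"
  shows "\<forall>x\<in>carrier (qt (fr V)). co W (qth (fr V) (fr W) (frh V W f) x) = f (co V x)"
proof -
  note F = yd_homD(1)[OF V W f] and G = frh_hom[OF V W f]
  note R = co_rules[OF V] co_rules[OF W] co_cls[OF V] co_cls[OF W] lin_rules[OF F] lin_rules[OF lin_frh[OF V W F]]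
    frh_upure[OF V W F] lin_rules[OF lin_eps[OF V]] lin_rules[OF lin_eps[OF W]] eps_upure[OF V] eps_upure[OF W]
    qth_cls[OF bm_free[OF V] bm_free[OF W] G]
  have "\<forall>x\<in>carrier (fr V). eps W (frh V W f x) = f (eps V x)"
    by (rule free_extB[where X = W]) (simp_all add: R)
  then show ?thesis
    unfolding quot_ball[OF bm_free[OF V]] by (simp add: R)
qed

text \<open>On the class of \<open>f\<close> the composite is the sum of
  \<open>\<epsilon>(a)\<close> times the class of \<open>u\<close> over the left coaction of
  \<open>f\<close>, so this is the counit axiom of that coaction.\<close>

lemma triangle_quot:
  assumes M: "bm M"
  shows "\<forall>x\<in>carrier (qt M). co (qt M) (qth M (fr (qt M)) (un M) x) = x"
proof -
  note V = yd_quot[OF M]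
  note R = co_rules[OF V] quot_all_rules[OF M] co_cls[OF V] lin_rules[OF lin_un[OF M]] eps_upure[OF V]
    lin_rules[OF lin_eps[OF V]] qth_cls[OF M bm_free[OF V] un_hom[OF M]] un_eq[OF M] lin_rules[OF lin_co[OF V]]
  show ?thesis
    unfolding quot_ball[OF M] using bm_lcounit[OF M, of "qt M" "cls A M"] by (simp add: R)
qed

text \<open>On \<open>a \<otimes> v\<close> the composite is
  \<open>a\<^sub>1 \<otimes> \<epsilon>(a\<^sub>2) v\<close>, which the counit axiom of
  \<open>A\<close> contracts.\<close>

lemma triangle_free:
  assumes V: "yd V"
  shows "\<forall>x\<in>carrier (fr V). frh (qt (fr V)) V (co V) (un (fr V) x) = x"
proof (rule free_extB[where X = "fr V"])
  note M = bm_free[OF V]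
  note W = yd_quot[OF M]
  note [simp] = co_rules[OF V] un_rules[OF M] co_cls[OF V] lin_rules[OF lin_un[OF M]] eps_upure[OF V]
    lin_rules[OF lin_eps[OF V]] lin_rules[OF lin_co[OF V]]
    lin_rules[OF lin_frh[OF W V lin_co[OF V]]] frh_upure[OF W V lin_co[OF V]]
  fix a v assume av: "a \<in> carrier A" "v \<in> carrier V"
  show "frh (qt (fr V)) V (co V) (un (fr V) (upure A V a v)) = upure A V a v"
    using av A.counit_right_bsum[of "fr V" "\<lambda>a. upure A V a v" a] by (simp add: un_eq[OF M])
qed (simp_all add: yd_module'[OF V] lin_comp[OF lin_frh[OF yd_quot[OF bm_free[OF V]] V lin_co[OF V]] lin_un[OF bm_free[OF V]]]
    free_all_rules[OF V])

lemma comp_functor_simps: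
  "on_obj (comp_functor (free_functor A H p) (quot_functor A H p)) M = fr (qt M)"
  "on_hom (comp_functor (free_functor A H p) (quot_functor A H p)) M N f = frh (qt M) (qt N) (qth M N f)"
  "on_obj (comp_functor (quot_functor A H p) (free_functor A H p)) V = qt (fr V)"
  "on_hom (comp_functor (quot_functor A H p) (free_functor A H p)) V W g = qth (fr V) (fr W) (frh V W g)"
  "on_obj id_functor X = X" "on_hom id_functor X Y h = h"
  by (simp_all add: comp_functor_def id_functor_def on_obj_simps)

lemma functor_id: "is_category C \<Longrightarrow> is_functor C C id_functor"
  by (simp add: is_functor_def is_category_def id_functor_def)

lemma functor_comp:
  "is_functor C D F \<Longrightarrow> is_functor D E G \<Longrightarrow> is_functor C E (comp_functor G F)"
  by (simp add: is_functor_def comp_functor_def)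

lemma adjoint_equivalence_BM_YD:
  "adjoint_equivalence
    (BM :: (('a, 'h, ('a, 'x) univ) bi_data, ('a, 'x) univ \<Rightarrow> ('a, 'x) univ) category) YD
    (quot_functor A H p) (free_functor A H p) (unit_map A H p) (counit_map A H p)"
proof -
  let ?BM = "BM :: (('a, 'h, ('a, 'x) univ) bi_data, ('a, 'x) univ \<Rightarrow> ('a, 'x) univ) category"
  let ?YD = "YD :: (('a, 'h, ('a, 'x) univ) right_data, ('a, 'x) univ \<Rightarrow> ('a, 'x) univ) category"
  have "natural_transformation ?BM ?BM id_functor (comp_functor (free_functor A H p) (quot_functor A H p)) (unit_map A H p)"
    unfolding natural_transformation_def
  proof (intro conjI ballI functor_id functor_comp[OF functor_quot functor_free] category_BM)
    fix X :: "('a, 'h, ('a, 'x) univ) bi_data" assume X: "X \<in> Obj ?BM"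
    then show "un X \<in> Hom ?BM (on_obj id_functor X) (on_obj (comp_functor (free_functor A H p) (quot_functor A H p)) X)"
      by (simp add: Obj_simps comp_functor_simps un_hom)
    fix Y f assume Y: "Y \<in> Obj ?BM" "f \<in> Hom ?BM X Y"
    have XY: "bm X" "bm Y" using X Y by (simp_all add: Obj_simps)
    show "Comp ?BM (on_obj id_functor X) (on_obj id_functor Y) (on_obj (comp_functor (free_functor A H p) (quot_functor A H p)) Y)
        (un Y) (on_hom id_functor X Y f) =
      Comp ?BM (on_obj id_functor X) (on_obj (comp_functor (free_functor A H p) (quot_functor A H p)) X)
        (on_obj (comp_functor (free_functor A H p) (quot_functor A H p)) Y)
        (on_hom (comp_functor (free_functor A H p) (quot_functor A H p)) X Y f) (un X)"
      using un_natural[OF XY Y(2)] by (simp add: comp_functor_simps Comp_simps compose_def cong: restrict_cong)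
  qed
  moreover have "natural_transformation ?YD ?YD (comp_functor (quot_functor A H p) (free_functor A H p)) id_functor (counit_map A H p)"
    unfolding natural_transformation_def
  proof (intro conjI ballI functor_id functor_comp[OF functor_free functor_quot] category_YD)
    fix X :: "('a, 'h, ('a, 'x) univ) right_data" assume X: "X \<in> Obj ?YD"
    then show "co X \<in> Hom ?YD (on_obj (comp_functor (quot_functor A H p) (free_functor A H p)) X) (on_obj id_functor X)"
      by (simp add: Obj_simps comp_functor_simps co_hom)
    fix Y f assume Y: "Y \<in> Obj ?YD" "f \<in> Hom ?YD X Y"
    have XY: "yd X" "yd Y" using X Y by (simp_all add: Obj_simps)
    show "Comp ?YD (on_obj (comp_functor (quot_functor A H p) (free_functor A H p)) X)
        (on_obj (comp_functor (quot_functor A H p) (free_functor A H p)) Y) (on_obj id_functor Y)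
        (co Y) (on_hom (comp_functor (quot_functor A H p) (free_functor A H p)) X Y f) =
      Comp ?YD (on_obj (comp_functor (quot_functor A H p) (free_functor A H p)) X) (on_obj id_functor X) (on_obj id_functor Y)
        (on_hom id_functor X Y f) (co X)"
      using co_natural[OF XY Y(2)] by (simp add: comp_functor_simps Comp_simps compose_def cong: restrict_cong)
  qed
  moreover have "(\<lambda>x\<in>carrier (qt M). co (qt M) (qth M (fr (qt M)) (un M) x)) = (\<lambda>x\<in>carrier (qt M). x)"
    if "bm M" for M :: "('a, 'h, ('a, 'x) univ) bi_data"
    by (rule restrict_ext) (use triangle_quot[OF that] in blast)
  moreover have "(\<lambda>x\<in>carrier (fr V). frh (qt (fr V)) V (co V) (un (fr V) x)) = (\<lambda>x\<in>carrier (fr V). x)"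
    if "yd V" for V :: "('a, 'h, ('a, 'x) univ) right_data"
    by (rule restrict_ext) (use triangle_free[OF that] in blast)
  ultimately show ?thesis
    unfolding adjoint_equivalence_def adjunction_def
    by (intro conjI ballI functor_quot functor_free)
      (simp_all add: Obj_simps Comp_simps on_obj_simps compose_def un_iso co_iso)
qed

end

text \<open>The functors and the counit are defined by applying formulas to chosen representatives.
  The conjuncts after the equivalence record that action, coaction, induced morphisms and counit are
  given by the intended formulas on every class, whatever representative is used.\<close>

theorem mainTheorem4:
  fixes A :: "'a hopf" and H :: "'h hopf" and p :: "'a \<Rightarrow> 'h"
  assumes "hopf_algebra A" and "hopf_algebra H"
    and "hopf_map A H p" and "p ` carrier A = carrier H"
  shows "adjoint_equivalence
      (bimod_category A H p :: (('a, 'h, ('a, 'x) univ) bi_data, ('a, 'x) univ \<Rightarrow> ('a, 'x) univ) category)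
      (yd_category A H p)
      (quot_functor A H p) (free_functor A H p) (unit_map A H p) (counit_map A H p) \<and>
    (\<forall>(M :: ('a, 'h, ('a, 'x) univ) bi_data) f. bicomodule_bimodule A H p M \<and> f \<in> carrier M \<longrightarrow>
      (\<forall>a\<in>carrier A. ract (quot_obj A H p M) (cls A M f) a = cls A M (ract M f a)) \<and>
      rcoact (quot_obj A H p M) (cls A M f) = quot_coact_formula A H p M f) \<and>
    (\<forall>(M :: ('a, 'h, ('a, 'x) univ) bi_data) N \<phi> f.
      bicomodule_bimodule A H p M \<and> bicomodule_bimodule A H p N \<and>
      \<phi> \<in> Hom (bimod_category A H p) M N \<and> f \<in> carrier M \<longrightarrow>
      on_hom (quot_functor A H p) M N \<phi> (cls A M f) = cls A N (\<phi> f)) \<and>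
    (\<forall>(V :: ('a, 'h, ('a, 'x) univ) right_data) a v.
      yd_module A H p V \<and> a \<in> carrier A \<and> v \<in> carrier V \<longrightarrow>
      counit_map A H p V (cls A (free_obj A H p V) (upure A V a v)) = counit A a \<odot>\<^bsub>V\<^esub> v)"
proof -
  interpret hopf_hom A H p
    using assms by (simp add: hopf_hom_def hopf_hom_axioms_def)
  show ?thesis
  proof (intro conjI allI impI ballI)
    show "adjoint_equivalence
      (BM :: (('a, 'h, ('a, 'x) univ) bi_data, ('a, 'x) univ \<Rightarrow> ('a, 'x) univ) category)
      YD (quot_functor A H p) (free_functor A H p) (unit_map A H p) (counit_map A H p)"
      by (rule adjoint_equivalence_BM_YD)
  next
    fix M :: "('a, 'h, ('a, 'x) univ) bi_data" and f assume "bm M \<and> f \<in> carrier M"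
    then have M: "bm M" "f \<in> carrier M" by auto
    show "ract (qt M) (cls A M f) a = cls A M (ract M f a)" if "a \<in> carrier A" for a
      by (rule ract_quot_cls[OF M that])
    show "rcoact (qt M) (cls A M f) = quot_coact_formula A H p M f"
      by (rule rcoact_quot_formula[OF M])
  next
    fix M N :: "('a, 'h, ('a, 'x) univ) bi_data" and \<phi> f
    assume "bm M \<and> bm N \<and> \<phi> \<in> Hom BM M N \<and> f \<in> carrier M"
    then have "bm M" "bm N" "\<phi> \<in> Hom BM M N" "f \<in> carrier M" by auto
    then show "qth M N \<phi> (cls A M f) = cls A N (\<phi> f)" by (rule qth_cls)
  next
    fix V :: "('a, 'h, ('a, 'x) univ) right_data" and a v
    assume "yd V \<and> a \<in> carrier A \<and> v \<in> carrier V"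
    then have V: "yd V" "a \<in> carrier A" "v \<in> carrier V" by auto
    show "co V (cls A (fr V) (upure A V a v)) = counit A a \<odot>\<^bsub>V\<^esub> v"
      using V(2,3) by (simp add: co_cls[OF V(1)] eps_upure[OF V(1)] co_rules[OF V(1)])
  qed
qed

end
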